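(* Let $D$ be a reduced diagram of a knot $K$, let $\Gamma_D=(V,W,E)$ be a balanced overlaid Tait graph for $D$ with its plane embedding, let $\mu:E\to\{\pm1\}$ be a Dehn weighting of $\Gamma_D$, let $\epsilon:E\to\{\pm1\}$ be any Kasteleyn weighting of $\Gamma_D$, and let $\mathcal{M}$ be the set of dimer coverings of $\Gamma_D$. Then $$\det(K)=\left|\sum_{m\in\mathcal{M}}\ \prod_{e\in m}\epsilon(e)\mu(e)\right|.$$
   Context: The faces of a knot diagram $D$ are the connected components of the complement in the plane of the underlying $4$-valent curve. $D$ is reduced if at each crossing the four surrounding corners belong to four distinct faces. A balanced overlaid Tait (BOT) graph of $D$ is the bipartite graph $\Gamma_D=(V,W,E)$ where $V$ is the set of crossings of $D$, $W$ is the set of all bounded faces of $D$ except one omitted bounded face, the omitted face being adjacent to the unbounded face (separated from it by a portion of an arc of $D$), and $xy\in E$ if and only if the crossing $x$ is incident to the face $y$. It carries the plane embedding coming from the diagram (each face vertex placed inside its face and joined to the incident crossings through the corresponding corners). Dehn weighting: at each crossing choose a direction along the over strand. The edges from the crossing to the two faces lying on either side of the over strand just before the crossing get weight $-1$, and the edges to the two faces lying on either side of the over strand just after the crossing get weight $+1$ (for those of the four faces that are vertices of $\Gamma_D$). These are the coefficients of the Dehn coloring relation at the crossing. A Kasteleyn weighting of a bipartite plane graph with edge set $E$ is a map $\epsilon:E\to\{\pm1\}$ such that each bounded face with $0$ (mod $4$) edges has an odd number of $-1$ assignments and each bounded face with $2$ (mod $4$) edges has an even number of $-1$ assignments (edges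 counted with multiplicity along the boundary walk of the face). A dimer covering of a graph is a set $m$ of edges such that each vertex is an endpoint of exactly one edge in $m$. The Fox coloring module $\mathrm{Col}(K)$ is the abelian group generated by the arcs of a diagram of $K$, with one relation $2a=b+c$ for each crossing, where $a$ is the over strand and $b,c$ are the under strands; it is independent of the diagram up to isomorphism and has rank $1$. The determinant $\det(K)$ is the order of its torsion subgroup; equivalently the absolute value of the Alexander polynomial of $K$ at $-1$. *)

theory Defs
  imports
    "HOL-Algebra.Free_Abelian_Groups"
    "HOL-Algebra.Coset"
    "HOL-Combinatorics.Permutations"
    "HOL-Combinatorics.Orbits"
begin

section \<open>Plane maps\<close>

text \<open>
  A graph embedded in the oriented sphere is given by its rotation system.  A dart is an edge
  together with a direction, and is thought of as leaving its origin; \<open>drev\<close> reverses a dart,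
  and \<open>rot\<close> sends a dart to the counterclockwise next dart with the same origin.
  The dart \<open>d\<close> also names the corner at its origin between \<open>d\<close> and \<open>rot d\<close>,
  that is, the corner immediately to the left of \<open>d\<close>.
\<close>

record 'd plane_map =
  darts :: "'d set"
  drev :: "'d \<Rightarrow> 'd"
  rot :: "'d \<Rightarrow> 'd"

definition vertex_at :: "('d, 'z) plane_map_scheme \<Rightarrow> 'd \<Rightarrow> 'd set" where
  "vertex_at M d = orbit (rot M) d"

definition vertices :: "('d, 'z) plane_map_scheme \<Rightarrow> 'd set set" where
  "vertices M = vertex_at M ` darts M"

definition edges :: "('d, 'z) plane_map_scheme \<Rightarrow> 'd set set" where
  "edges M = {{d, drev M d} | d. d \<in> darts M}"

definition rot_back :: "('d, 'z) plane_map_scheme \<Rightarrow> 'd \<Rightarrow> 'd" where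
  "rot_back M = inv_into UNIV (rot M)"

text \<open>
  Walk along \<open>d\<close> with a face on the left and turn maximally left at its end.  For a connected
  map the orbits of this permutation are the boundary walks of the faces, one for each face;
  by the corner convention they are also the sets of corners of the faces.
\<close>

definition face_step :: "('d, 'z) plane_map_scheme \<Rightarrow> 'd \<Rightarrow> 'd" where
  "face_step M d = rot_back M (drev M d)"

definition face_left :: "('d, 'z) plane_map_scheme \<Rightarrow> 'd \<Rightarrow> 'd set" where
  "face_left M d = orbit (face_step M) d"

definition faces :: "('d, 'z) plane_map_scheme \<Rightarrow> 'd set set" where
  "faces M = face_left M ` darts M"

definition linked_class :: "('d \<times> 'd) set \<Rightarrow> 'd \<Rightarrow> 'd set" where
  "linked_class R d = (R \<union> R\<inverse>)\<^sup>* `` {d}"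

text \<open>
  Let \<open>H\<close> be obtained from a connected plane map \<open>M\<close> by keeping the edges whose darts lie in
  \<open>S\<close> and deleting all other edges, together with the vertices that become isolated.
  A face of \<open>H\<close> is a union of faces of \<open>M\<close> glued across deleted edges (\<open>H\<close> itself need not be
  connected).  It is represented by the set of darts of \<open>M\<close> that have it on their left, so its
  boundary edges, counted with multiplicity, are the darts in this set that belong to \<open>S\<close>.
\<close>

definition subgraph_faces :: "('d, 'z) plane_map_scheme \<Rightarrow> 'd set \<Rightarrow> 'd set set" where
  "subgraph_faces M S =
    linked_class ({(d, face_step M d) | d. d \<in> darts M} \<union>
              {(d, drev M d) | d. d \<in> darts M \<and> d \<notin> S}) ` darts M"

section \<open>Knot diagrams\<close>

text \<open>
  The underlying curve of a diagram is a map on the sphere together with the face \<open>outer\<close>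
  containing the point at infinity; \<open>over\<close> is the set of darts that leave a crossing along its
  over strand.
\<close>

record 'd diagram = "'d plane_map" +
  over :: "'d set"
  outer :: "'d set"

definition straight :: "('d, 'z) plane_map_scheme \<Rightarrow> 'd \<Rightarrow> 'd" where
  "straight M d = rot M (rot M d)"

definition crossings :: "('d, 'z) plane_map_scheme \<Rightarrow> 'd set set" where
  "crossings M = {x \<in> vertices M. card x = 4}"

text \<open>
  The crossingless circle is represented with a single 2-valent vertex, an auxiliary base point
  which is not a crossing.
\<close>

definition crossingless_circle :: "('d, 'z) plane_map_scheme \<Rightarrow> bool" where
  "crossingless_circle M \<longleftrightarrow> (\<exists>d. darts M = {d, drev M d} \<and> rot M d = drev M d)"

text \<open>
  The fourth conjunct below says that the curve has one component: travelling along edges and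
  straight through crossings reaches every dart.  In particular the underlying graph is
  connected, so that the next one, Euler's formula, says that the surface is a sphere.
\<close>

definition knot_diagram :: "'d diagram \<Rightarrow> bool" where
  "knot_diagram D \<longleftrightarrow>
     finite (darts D) \<and> darts D \<noteq> {} \<and>
     (rot D permutes darts D \<and> drev D permutes darts D \<and>
       (\<forall>d\<in>darts D. drev D d \<noteq> d \<and> drev D (drev D d) = d)) \<and>
     (\<forall>d\<in>darts D. linked_class ({(e, drev D e) | e. e \<in> darts D} \<union>
                             {(e, straight D e) | e. e \<in> darts D}) d = darts D) \<and>
     card (vertices D) + card (faces D) = card (edges D) + 2 \<and>
     (vertices D = crossings D \<or> crossingless_circle D) \<and>
     (\<forall>x\<in>crossings D. \<forall>d\<in>x. d \<in> over D \<longleftrightarrow> rot D d \<notin> over D) \<and>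
     outer D \<in> faces D"

definition reduced :: "'d diagram \<Rightarrow> bool" where
  "reduced D \<longleftrightarrow> (\<forall>x\<in>crossings D. inj_on (face_left D) x)"

section \<open>The Fox coloring module and the determinant\<close>

text \<open>An arc is represented by the set of darts lying on it.\<close>

definition arc_of :: "'d diagram \<Rightarrow> 'd \<Rightarrow> 'd set" where
  "arc_of D = linked_class ({(d, drev D d) | d. d \<in> darts D} \<union>
                        {(d, straight D d) | d. \<exists>x\<in>crossings D. d \<in> x \<inter> over D})"

definition arcs :: "'d diagram \<Rightarrow> 'd set set" where
  "arcs D = arc_of D ` darts D"

definition fox_relations :: "'d diagram \<Rightarrow> ('d set \<Rightarrow>\<^sub>0 int) set" where
  "fox_relations D =
    {frag_cmul 2 (frag_of (arc_of D d)) - frag_of (arc_of D (rot D d)) - frag_of (arc_of D (rot_back D d))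
      | d. \<exists>x\<in>crossings D. d \<in> x \<inter> over D}"

definition fox_module :: "'d diagram \<Rightarrow> ('d set \<Rightarrow>\<^sub>0 int) set monoid" where
  "fox_module D =
    free_Abelian_group (arcs D) Mod generate (free_Abelian_group (arcs D)) (fox_relations D)"

definition torsion :: "('a, 'b) monoid_scheme \<Rightarrow> 'a set" where
  "torsion G = {g \<in> carrier G. \<exists>n::nat. n > 0 \<and> g [^]\<^bsub>G\<^esub> n = \<one>\<^bsub>G\<^esub>}"

definition knot_det :: "'d diagram \<Rightarrow> nat" where
  "knot_det D = card (torsion (fox_module D))"

section \<open>Balanced overlaid Tait graphs\<close>

definition omissible_face :: "'d diagram \<Rightarrow> 'd set \<Rightarrow> bool" where
  "omissible_face D f \<longleftrightarrow>
     f \<in> faces D \<and> f \<noteq> outer D \<and>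
     (\<exists>d\<in>darts D. face_left D d = outer D \<and> face_left D (drev D d) = f)"

definition bot_faces :: "'d diagram \<Rightarrow> 'd set \<Rightarrow> 'd set set" where
  "bot_faces D f = faces D - {outer D, f}"

text \<open>Crossings and faces are both sets of corners, so they are incident iff they intersect.\<close>

definition bot_edges :: "'d diagram \<Rightarrow> 'd set \<Rightarrow> ('d set \<times> 'd set) set" where
  "bot_edges D f = {(x, y). x \<in> crossings D \<and> y \<in> bot_faces D f \<and> x \<inter> y \<noteq> {}}"

text \<open>
  The graph joining every crossing to all incident faces, including the two omitted ones, as a
  plane map.  It has one edge for each corner \<open>c\<close> of a crossing: \<open>Inl c\<close> leaves the crossing and
  \<open>Inr c\<close> leaves the vertex placed inside the face (at infinity for the outer face).  The edges
  at the latter are cyclically ordered as the corners along the boundary walk of the face.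
\<close>

definition overlaid_tait_map :: "'d diagram \<Rightarrow> ('d + 'd) plane_map" where
  "overlaid_tait_map D =
    \<lparr>darts = \<Union>(crossings D) <+> \<Union>(crossings D),
     drev = case_sum Inr Inl,
     rot = map_sum (rot D) (face_step D)\<rparr>"

definition tait_edge :: "'d diagram \<Rightarrow> 'd + 'd \<Rightarrow> 'd set \<times> 'd set" where
  "tait_edge D = (let e = (\<lambda>c. (vertex_at D c, face_left D c)) in case_sum e e)"

definition bot_darts :: "'d diagram \<Rightarrow> 'd set \<Rightarrow> ('d + 'd) set" where
  "bot_darts D f = {a \<in> darts (overlaid_tait_map D). tait_edge D a \<in> bot_edges D f}"

text \<open>The unbounded face is the one containing the deleted vertex of the outer face.\<close>

definition bot_bounded_faces :: "'d diagram \<Rightarrow> 'd set \<Rightarrow> ('d + 'd) set set" where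
  "bot_bounded_faces D f =
    {F \<in> subgraph_faces (overlaid_tait_map D) (bot_darts D f). F \<inter> Inr ` outer D = {}}"

definition kasteleyn_weighting :: "'d diagram \<Rightarrow> 'd set \<Rightarrow> ('d set \<times> 'd set \<Rightarrow> int) \<Rightarrow> bool" where
  "kasteleyn_weighting D f \<epsilon> \<longleftrightarrow>
     (\<forall>e\<in>bot_edges D f. \<epsilon> e \<in> {1, -1}) \<and>
     (\<forall>F\<in>bot_bounded_faces D f.
        let boundary = F \<inter> bot_darts D f;
            negative = {a \<in> boundary. \<epsilon> (tait_edge D a) = -1}
        in (card boundary mod 4 = 0 \<longrightarrow> odd (card negative)) \<and>
           (card boundary mod 4 = 2 \<longrightarrow> even (card negative)))"

text \<open>
  The dart \<open>d\<close> below gives the chosen direction of the over strand at \<open>x\<close>.  The corners on the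
  two sides of the over strand after the crossing are \<open>d\<close> (left) and \<open>rot_back D d\<close> (right);
  those before it are \<open>rot D d\<close> (left) and \<open>straight D d\<close> (right).
\<close>

definition dehn_weighting :: "'d diagram \<Rightarrow> 'd set \<Rightarrow> ('d set \<times> 'd set \<Rightarrow> int) \<Rightarrow> bool" where
  "dehn_weighting D f \<mu> \<longleftrightarrow>
     (\<forall>x\<in>crossings D. \<exists>d\<in>x \<inter> over D.
        (\<forall>c\<in>{rot D d, straight D d}.
           face_left D c \<in> bot_faces D f \<longrightarrow> \<mu> (x, face_left D c) = -1) \<and>
        (\<forall>c\<in>{d, rot_back D d}.
           face_left D c \<in> bot_faces D f \<longrightarrow> \<mu> (x, face_left D c) = 1))"

text \<open>Dimer coverings of the bipartite graph with vertex classes \<open>V\<close>, \<open>W\<close> and edge set \<open>E\<close>.\<close>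

definition dimer_coverings :: "'v set \<Rightarrow> 'w set \<Rightarrow> ('v \<times> 'w) set \<Rightarrow> ('v \<times> 'w) set set" where
  "dimer_coverings V W E =
    {m. m \<subseteq> E \<and> (\<forall>x\<in>V. \<exists>!e. e \<in> m \<and> fst e = x) \<and> (\<forall>y\<in>W. \<exists>!e. e \<in> m \<and> snd e = y)}"

end

theory Submission
  imports Defs "HOL-Library.Z2" "Jordan_Normal_Form.Determinant"
begin

text \<open>
  Let \<open>A\<close> be the square integer matrix of the Dehn coloring relations: one row for each crossing,
  one column for each face except the outer one and \<open>f\<close>.  Both sides of the theorem equal
  \<open>\<bar>det A\<bar>\<close>.

  The determinant of the knot.  A Dehn relation says that the sum of the colors of the two faces
  beside the over strand does not change at the crossing.  Sending an arc to the sum of the two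
  faces beside it therefore turns Fox relations into combinations of Dehn relations.  Restricted
  to arc combinations of degree \<open>0\<close> and read off on the faces that are kept, this map is onto
  modulo Dehn relations (\<open>face_sum_onto\<close>) and only combinations of Fox relations become combinations of Dehn relations there (\<open>R_iff\<close>).
  Hence the degree \<open>0\<close> part of the Fox module is the cokernel of \<open>A\<close>.  A cokernel has
  \<open>\<bar>det A\<bar>\<close> elements if \<open>det A \<noteq> 0\<close> (\<open>row_span_transversal\<close>), and \<open>det A\<close> is odd because modulo
  \<open>2\<close> a Fox coloring is constant along the knot (\<open>no_mod_2_colouring\<close>).  So the degree \<open>0\<close> part is
  finite, and it is exactly the torsion subgroup, since the degree is a homomorphism to the
  integers (\<open>knot_det_eq_det\<close>).

  The dimer sum.  The nonzero entries of \<open>A\<close> are the Dehn weights of the edges, so the Leibniz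
  expansion of \<open>det A\<close> runs over the dimer coverings, with the sign of a permutation in place of
  the product of the Kasteleyn weights.  It remains to see that for two dimer coverings the
  quotient of the signs equals the quotient of the products of Kasteleyn weights
  (\<open>kasteleyn_sign\<close>).  The outer face and \<open>f\<close> meet along an arc, so every bounded face of the
  graph is a quadrilateral around one edge of the diagram.  The symmetric difference of the two
  coverings is the boundary, modulo \<open>2\<close>, of a set \<open>S\<close> of such quadrilaterals
  (\<open>region_between_matchings\<close>), and multiplying the Kasteleyn conditions in \<open>S\<close> gives
  \<open>-1\<close> to the power of the number of quadrilaterals in \<open>S\<close>.  To compare this with the sign, note that
  the darts of \<open>S\<close> carry three permutations, one around the crossings, one around the faces, and the
  reversal of darts; up to the permutation that compares the two coverings, the second is the
  product of the other two.  The first two have equal signs, because a covering matches the crossings that meet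
  \<open>S\<close> with the faces that meet \<open>S\<close>; the third contributes \<open>-1\<close> for each quadrilateral
  (\<open>sign_region\<close>).

  Planarity enters both halves through one statement, obtained from Euler's formula with a pair
  of dual spanning trees: a closed form on the edges of the diagram is exact
  (\<open>closed_form_is_exact\<close>).
\<close>
section \<open>Permutations and their orbits\<close>

text \<open>
  Multiplying by the transposition of \<open>a\<close> and \<open>p a\<close> removes \<open>a\<close> from its cycle, which changes the
  sign and the number of points but not the number of cycles, unless \<open>a\<close> is a fixed point.
\<close>

lemma sign_eq_card_orbits:
  assumes "finite S" "p permutes S"
  shows "sign p = (-1) ^ (card S + card (orbit p ` S))"
  using assms
proof (induction S arbitrary: p rule: finite_psubset_induct)
  case (psubset S)
  have perm: "permutation p"
    using psubset.prems psubset.hyps by (auto simp: permutation_permutes)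
  have bij: "inj p" using psubset.prems by (rule permutes_inj)
  have self: "s \<in> orbit p s" for s
    using perm by (rule permutation_self_in_orbit)
  show ?case
  proof (cases "S = {}")
    case True
    then have "p = id" using psubset.prems by simp
    then show ?thesis using True by simp
  next
    case False
    then obtain a where a: "a \<in> S" by auto
    define q where "q = transpose a (p a) \<circ> p"
    have pa: "p a \<in> S" using a psubset.prems by (simp add: permutes_in_image)
    have qa: "q a = a" by (simp add: q_def)
    have qS: "q permutes S"
      unfolding q_def using psubset.prems a pa by (intro permutes_compose permutes_swap_id) auto
    have q: "q permutes (S - {a})"
    proof (rule permutes_superset[OF qS])
      fix x assume "x \<in> S - (S - {a})" then show "q x = x" using qa by auto
    qed
    have pa_ne: "p a \<noteq> a" if "p x = a" "x \<noteq> a" for x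
      using injD[OF bij, of a x] that by metis
    have q_eq: "q x = (if p x = a then p a else p x)" if "x \<noteq> a" for x
    proof -
      have "p x \<noteq> p a" using bij that by (auto dest: injD)
      then show ?thesis by (simp add: q_def transpose_def)
    qed
    have orb: "orbit q s = orbit p s - {a}" if "s \<noteq> a" for s
    proof (intro equalityI subsetI)
      fix y assume "y \<in> orbit q s"
      then show "y \<in> orbit p s - {a}"
      proof induction
        case base
        show ?case
          using q_eq[OF that] orbit.base[of p s] orbit.step[of "p s" p s] pa_ne[of s] that
          by (cases "p s = a") auto
      next
        case (step y)
        then have "p y \<in> orbit p s" "y \<noteq> a" by (auto intro: orbit.step)
        moreover have "p (p y) \<in> orbit p s" using step by (auto intro: orbit.step)
        ultimately show ?case using q_eq[of y] pa_ne by (cases "p y = a") auto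
      qed
    next
      fix y assume "y \<in> orbit p s - {a}"
      then have y: "y \<in> orbit p s" "y \<noteq> a" by auto
      have "(y \<noteq> a \<longrightarrow> y \<in> orbit q s) \<and> (y = a \<longrightarrow> p a \<in> orbit q s)"
        using y(1)
      proof induction
        case base
        show ?case using q_eq[OF that] orbit.base[of q s] by auto
      next
        case (step z)
        show ?case
        proof (cases "z = a")
          case True
          then show ?thesis using step.IH by auto
        next
          case False
          then have "q z \<in> orbit q s" using step.IH by (auto intro: orbit.step)
          then show ?thesis using q_eq[OF False] by auto
        qed
      qed
      then show "y \<in> orbit q s" using y by auto
    qed
    have im: "orbit q ` (S - {a}) = (\<lambda>C. C - {a}) ` orbit p ` (S - {a})"
      unfolding image_image by (rule image_cong) (auto simp: orb)
    have IH: "sign q = (-1) ^ (card (S - {a}) + card (orbit q ` (S - {a})))"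
      using psubset.IH[of "S - {a}" q] q a by auto
    have cS: "card S = Suc (card (S - {a}))" using a psubset.hyps
      by (metis card_Suc_Diff1)
    have eqorb: "orbit p s = orbit p t" if "t \<in> orbit p s" for s t
      using orbit_cyclic_eq3[OF cyclic_on_orbit'[OF perm] that] by simp
    have inj: "inj_on (\<lambda>C. C - {a}) (orbit p ` (S - {a}))"
    proof (rule inj_onI)
      fix C1 C2 assume "C1 \<in> orbit p ` (S - {a})" "C2 \<in> orbit p ` (S - {a})"
        and eq: "C1 - {a} = C2 - {a}"
      then obtain s t where st: "s \<noteq> a" "C1 = orbit p s" "C2 = orbit p t" by auto
      then have "s \<in> orbit p t" using self[of s] eq by blast
      from eqorb[OF this] show "C1 = C2" using st by simp
    qed
    have c1: "card (orbit q ` (S - {a})) = card (orbit p ` (S - {a}))"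
      unfolding im using inj by (rule card_image)
    have perm2: "permutation (transpose a (p a))" by (rule permutation_swap_id)
    have p_eq: "p = transpose a (p a) \<circ> q" by (rule ext) (simp add: q_def)
    have pq: "permutation q" using q psubset.hyps by (auto simp: permutation_permutes)
    have sp: "sign p = (if a = p a then 1 else -1) * sign q"
    proof -
      have "sign p = sign (transpose a (p a) \<circ> q)" using p_eq by (rule arg_cong)
      also have "\<dots> = sign (transpose a (p a)) * sign q" using perm2 pq by (rule sign_compose)
      finally show ?thesis by (simp only: sign_swap_id)
    qed
    show ?thesis
    proof (cases "p a = a")
      case True
      then have oa: "orbit p a = {a}" by (simp add: orbit_eq_singleton_iff)
      have "orbit p ` S = insert {a} (orbit p ` (S - {a}))"
        using a oa by (metis image_insert insert_Diff)
      moreover have "{a} \<notin> orbit p ` (S - {a})"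
      proof
        assume "{a} \<in> orbit p ` (S - {a})"
        then obtain s where "s \<noteq> a" "orbit p s = {a}" by auto
        then show False using self[of s] by simp
      qed
      moreover have "finite (orbit p ` (S - {a}))" using psubset.hyps by auto
      ultimately have "card (orbit p ` S) = Suc (card (orbit p ` (S - {a})))" by simp
      then show ?thesis using sp True IH c1 cS by simp
    next
      case False
      have "orbit p (p a) = orbit p a" using perm by (rule permutation_orbit_step)
      moreover have "orbit p (p a) \<in> orbit p ` (S - {a})" using pa False by (intro imageI) auto
      ultimately have "orbit p ` S = orbit p ` (S - {a})"
        using a by (metis image_insert insert_Diff insert_absorb)
      then show ?thesis using sp False IH c1 cS by simp
    qed
  qed
qed

lemma sign_on_eq_card_orbits:
  assumes "finite S" "bij_betw p S S"
  shows "sign_on S p = (-1) ^ (card S + card (orbit p ` S))"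
proof -
  have perm: "restrict_id p S permutes S" using assms by (intro permutes_restrict_id)
  have "orbit (restrict_id p S) s = orbit p s" if "s \<in> S" for s
    by (rule orbit_cong0[of _ S]) (use that assms in \<open>auto simp: bij_betw_def\<close>)
  then have "orbit (restrict_id p S) ` S = orbit p ` S" by auto
  then show ?thesis
    unfolding sign_on_def using sign_eq_card_orbits[OF assms(1) perm] by simp
qed

text \<open>
  An involution without fixed points is a product of disjoint transpositions, and each of them
  is accounted for by a factor \<open>-1\<close> of the product.
\<close>

lemma sign_on_fixfree_involution:
  assumes "finite S" "\<And>d. d \<in> S \<Longrightarrow> \<iota> d \<in> S \<and> \<iota> d \<noteq> d \<and> \<iota> (\<iota> d) = d"
    and "\<And>d. d \<in> S \<Longrightarrow> g d * g (\<iota> d) = (-1 :: int)"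
  shows "sign_on S \<iota> = prod g S"
  using assms
proof (induction S rule: finite_psubset_induct)
  case (psubset S)
  show ?case
  proof (cases "S = {}")
    case True
    then show ?thesis by (simp add: sign_on_def restrict_id_def)
  next
    case False
    then obtain a where a: "a \<in> S" by auto
    define b where "b = \<iota> a"
    define T where "T = S - {a, b}"
    have b: "b \<in> S" "b \<noteq> a" "\<iota> b = a" "\<iota> a = b"
      using psubset.prems(1)[OF a] by (auto simp: b_def)
    have T: "\<iota> d \<in> T \<and> \<iota> d \<noteq> d \<and> \<iota> (\<iota> d) = d" if "d \<in> T" for d
      using psubset.prems(1)[of d] that b by (auto simp: T_def)
    have bijT: "bij_betw \<iota> T T"
      using T by (intro bij_betw_byWitness[of _ \<iota>]) auto
    have "sign_on T \<iota> = prod g T"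
      using psubset.IH[of T] T psubset.prems(2) a unfolding T_def by blast
    moreover have "restrict_id \<iota> S = transpose a b \<circ> restrict_id \<iota> T"
      
    proof
      fix x show "restrict_id \<iota> S x = (transpose a b \<circ> restrict_id \<iota> T) x"
        using b T[of x] a by (auto simp: restrict_id_def T_def transpose_def)
    qed
    moreover have "permutation (restrict_id \<iota> T)"
      using bijT psubset.hyps by (intro permutes_imp_permutation[of T] permutes_restrict_id)
        (auto simp: T_def)
    ultimately have "sign_on S \<iota> = - prod g T"
      using b(2) by (simp add: sign_on_def sign_compose permutation_swap_id sign_swap_id)
    moreover have "prod g S = g a * g b * prod g T"
    proof -
      have "prod g S = prod g ({a, b} \<union> T)" using a b by (intro arg_cong[of _ _ "prod g"]) (auto simp: T_def)
      also have "\<dots> = prod g {a, b} * prod g T"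
        using psubset.hyps by (intro prod.union_disjoint) (auto simp: T_def)
      finally show ?thesis using b(2) by simp
    qed
    ultimately show ?thesis using psubset.prems(2)[OF a] b_def by simp
  qed
qed

text \<open>
  Going once around a cycle, one enters \<open>S\<close> as often as one leaves it.
\<close>

lemma cut_points_separated:
  assumes r: "permutation r" and c: "c1 \<in> orbit r x" "c2 \<in> orbit r x"
    and change: "\<And>d. d \<in> orbit r x \<Longrightarrow> (d \<in> S) \<noteq> (r d \<in> S) \<longleftrightarrow> c1 \<noteq> c2 \<and> d \<in> {c1, c2}"
    and "c1 \<noteq> c2"
  shows "(c1 \<in> S) \<noteq> (c2 \<in> S)"
proof -
  define C where "C = orbit r x"
  have self: "y \<in> orbit r y" for y
    using r by (auto intro: permutation_self_in_orbit)
  have rO: "r d \<in> C" if "d \<in> C" for d using that by (auto simp: C_def intro: orbit.step)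
  have finO: "finite C" unfolding C_def using self by (intro finite_orbit)
  have injr: "inj r" using r by (auto simp: permutation_bijective bij_is_inj)
  have bijO: "bij_betw r C C"
    unfolding bij_betw_def
    using endo_inj_surj[OF finO, of r] inj_on_subset[OF injr, of C] rO by auto
  have count: "(\<Sum>d\<in>C. of_bool (r d \<in> S) - of_bool (d \<in> S) :: int) = 0"
    using sum.reindex_bij_betw[OF bijO, of "\<lambda>d. of_bool (d \<in> S) :: int"] by (simp add: sum_subtractf)
  show ?thesis
  proof -
    have "(\<Sum>d\<in>C. of_bool (r d \<in> S) - of_bool (d \<in> S) :: int) = (\<Sum>d\<in>{c1,c2}. of_bool (r d \<in> S) - of_bool (d \<in> S))"
      using c change finO by (intro sum.mono_neutral_right) (auto simp: C_def)
    also have "\<dots> = (if c1 \<in> S then -1 else 1) + (if c2 \<in> S then -1 else 1)"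
    proof -
      have "r c1 \<in> S \<longleftrightarrow> c1 \<notin> S" "r c2 \<in> S \<longleftrightarrow> c2 \<notin> S"
        using change[of c1] change[of c2] c assms(5) by blast+
      then show ?thesis using assms(5) by simp
    qed
    finally have "(if c1 \<in> S then -1 else 1) + (if c2 \<in> S then -1 else 1) = (0 :: int)"
      unfolding count by (rule sym)
    then show ?thesis by (cases "c1 \<in> S"; cases "c2 \<in> S") simp_all
  qed
qed

text \<open>
  Composing a cycle with a transposition of two of its points cuts it into two arcs.  If membership
  in \<open>S\<close> changes exactly at these two points, the arcs are the parts of the cycle inside and outside
  \<open>S\<close>.  The case \<open>c1 = c2\<close>, where nothing is cut and the cycle lies on one side of \<open>S\<close>, is included
  so that nodes where two matchings agree need no separate treatment.
\<close>

lemma orbit_cut_in_two: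
  assumes r: "permutation r" and r': "permutation r'"
    and r'_eq: "\<And>d. d \<in> orbit r x \<Longrightarrow> d \<noteq> c1 \<Longrightarrow> d \<noteq> c2 \<Longrightarrow> r' d = r d"
    and swap: "r' c1 = r c2" "r' c2 = r c1"
    and c: "c1 \<in> orbit r x" "c2 \<in> orbit r x"
    and change: "\<And>d. d \<in> orbit r x \<Longrightarrow> (d \<in> S) \<noteq> (r d \<in> S) \<longleftrightarrow> c1 \<noteq> c2 \<and> d \<in> {c1, c2}"
    and s: "s \<in> S" "s \<in> orbit r x"
  shows "orbit r' s = S \<inter> orbit r x"
proof -
  define C where "C = orbit r x"
  have self: "y \<in> orbit r y" "y \<in> orbit r' y" for y
    using r r' by (auto intro: permutation_self_in_orbit)
  have rO: "r d \<in> C" if "d \<in> C" for d using that by (auto simp: C_def intro: orbit.step)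
  have Oeq: "C = orbit r y" if "y \<in> C" for y
    using orbit_cyclic_eq3[OF cyclic_on_orbit'[OF r]] that by (simp add: C_def)
  have whole: "C \<subseteq> Z" if Z: "\<And>d. d \<in> Z \<Longrightarrow> r d \<in> Z" and z: "z \<in> Z" "z \<in> C" for Z z
  proof
    fix y assume "y \<in> C"
    then have "y \<in> orbit r z" using Oeq[OF z(2)] by simp
    then show "y \<in> Z" by induction (use Z z in auto)
  qed
  note one = cut_points_separated[OF r c change]
  have r'S: "r' d \<in> S \<inter> C" if d: "d \<in> S \<inter> C" for d
  proof (cases "c1 = c2 \<or> d \<notin> {c1, c2}")
    case True
    then have "r' d = r d" using r'_eq[of d] swap d by (auto simp: C_def)
    then show ?thesis using change[of d] d True rO by (auto simp: C_def)
  next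
    case False
    then have "c1 \<noteq> c2" "d = c1 \<or> d = c2" by auto
    moreover have "r c1 \<in> S \<longleftrightarrow> c1 \<notin> S" "r c2 \<in> S \<longleftrightarrow> c2 \<notin> S"
      using change[of c1] change[of c2] c \<open>c1 \<noteq> c2\<close> by blast+
    ultimately show ?thesis using one d c rO swap by (auto simp: C_def)
  qed
  define U where "U = orbit r' s"
  have U_sub: "U \<subseteq> S \<inter> C"
  proof
    fix y assume "y \<in> U"
    then show "y \<in> S \<inter> C" unfolding U_def by induction (use r'S s in \<open>auto simp: C_def\<close>)
  qed
  define V where "V = S \<inter> C - U"
  have r'U: "r' d \<in> U \<longleftrightarrow> d \<in> U" for d
  proof
    assume "r' d \<in> U"
    then show "d \<in> U" unfolding U_def
      using orbit_cyclic_eq3[OF cyclic_on_orbit'[OF r'], of "r' d" s]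
        permutation_orbit_step[OF r', of d] self(2)[of d] by simp
  qed (auto simp: U_def intro: orbit.step)
  then have r'V: "r' d \<in> V" if "d \<in> V" for d
    using that r'S by (auto simp: V_def)
  have "V = {}"
  proof (rule ccontr)
    assume "V \<noteq> {}"
    \<comment> \<open>If \<open>S\<close> contained a second orbit, one of the two would avoid the cut points and be
      invariant under \<open>r\<close>.\<close>
    define e where "e = (if c1 \<in> S then c1 else c2)"
    define Z where "Z = (if e \<in> U then V else U)"
    have Zr': "r' d \<in> Z" if "d \<in> Z" for d using r'V r'U that by (auto simp: Z_def split: if_splits)
    have ZS: "Z \<subseteq> S \<inter> C" using U_sub by (auto simp: Z_def V_def)
    have eZ: "e \<notin> Z" by (auto simp: Z_def V_def)
    have "Z \<noteq> {}" using \<open>V \<noteq> {}\<close> self(2)[of s] by (auto simp: Z_def U_def)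
    then obtain z where z: "z \<in> Z" by auto
    have "r d \<in> Z" if d: "d \<in> Z" for d
    proof -
      have "r' d = r d"
      proof (cases "c1 = c2")
        case True
        then show ?thesis using r'_eq[of d] swap d ZS by (auto simp: C_def)
      next
        case False
        then have "d \<notin> {c1, c2}" using one eZ ZS d by (auto simp: e_def split: if_splits)
        then show ?thesis using r'_eq[of d] ZS d by (auto simp: C_def)
      qed
      then show ?thesis using Zr'[OF d] by simp
    qed
    then have "C \<subseteq> Z" using whole[of Z z] z ZS by auto
    moreover have "e \<in> C" using c by (auto simp: e_def C_def)
    ultimately show False using eZ by auto
  qed
  then show ?thesis using U_sub by (auto simp: V_def U_def C_def)
qed

section \<open>Cutting cycles along two matchings\<close>

text \<open>
  In the application \<open>M1\<close> and \<open>M2\<close> are sets of corners, each with at most one corner at a node, at the same nodes;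
  the involution exchanges the corners of the two sets at a node.
\<close>

definition swap_along :: "('d \<Rightarrow> 'v) \<Rightarrow> 'd set \<Rightarrow> 'd set \<Rightarrow> 'd \<Rightarrow> 'd" where
  "swap_along \<nu> M1 M2 d =
    (if d \<in> M1 then the_inv_into M2 \<nu> (\<nu> d) else if d \<in> M2 then the_inv_into M1 \<nu> (\<nu> d) else d)"

locale two_matchings =
  fixes \<nu> :: "'d \<Rightarrow> 'v" and M1 M2 :: "'d set"
  assumes inj: "inj_on \<nu> M1" "inj_on \<nu> M2" and same_nodes: "\<nu> ` M1 = \<nu> ` M2"
begin

abbreviation \<tau> where "\<tau> \<equiv> swap_along \<nu> M1 M2"

lemma swap_pair:
  assumes "a \<in> M1" "b \<in> M2" "\<nu> a = \<nu> b"
  shows "\<tau> a = b" "\<tau> b = a"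
proof -
  have b: "the_inv_into M2 \<nu> (\<nu> b) = b" using inj(2) assms(2) by (rule the_inv_into_f_f)
  have a: "the_inv_into M1 \<nu> (\<nu> a) = a" using inj(1) assms(1) by (rule the_inv_into_f_f)
  show "\<tau> a = b" using assms b by (simp add: swap_along_def)
  show "\<tau> b = a"
  proof (cases "b \<in> M1")
    case True
    then have "b = a" using inj(1) assms by (metis inj_onD)
    then show ?thesis using \<open>\<tau> a = b\<close> by simp
  next
    case False
    then show ?thesis using assms a by (simp add: swap_along_def)
  qed
qed

lemma swap_other: "d \<notin> M1 \<Longrightarrow> d \<notin> M2 \<Longrightarrow> \<tau> d = d"
  by (simp add: swap_along_def)

lemma partner:
  assumes "d \<in> M1 \<or> d \<in> M2"
  obtains a b where "a \<in> M1" "b \<in> M2" "\<nu> a = \<nu> d" "\<nu> b = \<nu> d" "d = a \<or> d = b"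
proof (cases "d \<in> M1")
  case True
  then have "\<nu> d \<in> \<nu> ` M2" unfolding same_nodes[symmetric] by (rule imageI)
  then obtain b where b: "\<nu> d = \<nu> b" "b \<in> M2" by (rule imageE)
  show ?thesis by (rule that[OF True b(2) refl b(1)[symmetric]]) simp
next
  case False
  then have d: "d \<in> M2" using assms by simp
  then have "\<nu> d \<in> \<nu> ` M1" unfolding same_nodes by (rule imageI)
  then obtain a where a: "\<nu> d = \<nu> a" "a \<in> M1" by (rule imageE)
  show ?thesis by (rule that[OF a(2) d a(1)[symmetric] refl]) simp
qed

lemma swap_swap: "\<tau> (\<tau> d) = d"
proof (cases "d \<in> M1 \<or> d \<in> M2")
  case True
  then obtain a b where "a \<in> M1" "b \<in> M2" "\<nu> a = \<nu> d" "\<nu> b = \<nu> d" "d = a \<or> d = b" by (rule partner)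
  then show ?thesis using swap_pair[of a b] by auto
next
  case False
  then show ?thesis using swap_other by simp
qed

lemma swap_permutes:
  assumes "M1 \<subseteq> E" "M2 \<subseteq> E"
  shows "\<tau> permutes E"
proof (rule bij_imp_permutes)
  have "\<tau> d \<in> E" if "d \<in> E" for d
  proof (cases "d \<in> M1 \<or> d \<in> M2")
    case True
    then obtain a b where "a \<in> M1" "b \<in> M2" "\<nu> a = \<nu> d" "\<nu> b = \<nu> d" "d = a \<or> d = b" by (rule partner)
    then show ?thesis using swap_pair[of a b] assms by auto
  next
    case False
    then show ?thesis using swap_other that by simp
  qed
  then show "bij_betw \<tau> E E" using swap_swap by (intro bij_betw_byWitness[of _ \<tau>]) auto
  show "\<tau> x = x" if "x \<notin> E" for x using swap_other assms that by blast
qed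

end

text \<open>
  The cycles of \<open>r\<close> are the nodes of a map, and the boundary of the region \<open>S\<close> is the symmetric
  difference of two matchings.  This is used once for the crossings and once for the faces.
\<close>

locale cut_along = two_matchings \<nu> M1 M2 for \<nu> :: "'d \<Rightarrow> 'v" and M1 M2 :: "'d set" +
  fixes r :: "'d \<Rightarrow> 'd" and E S :: "'d set"
  assumes finite_E: "finite E" and r_permutes: "r permutes E"
    and orbit_r: "\<And>d. d \<in> E \<Longrightarrow> orbit r d = {e \<in> E. \<nu> e = \<nu> d}"
    and M_sub: "M1 \<subseteq> E" "M2 \<subseteq> E" and S_sub: "S \<subseteq> E" and S_nodes: "\<nu> ` S \<subseteq> \<nu> ` M1"
    and change: "\<And>d. d \<in> E \<Longrightarrow> (d \<in> S) \<noteq> (r d \<in> S) \<longleftrightarrow> (d \<in> M1) \<noteq> (d \<in> M2)"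
begin

lemma change_on_orbit:
  assumes "a \<in> M1" "b \<in> M2" "\<nu> a = \<nu> b" "x \<in> E" "\<nu> x = \<nu> a" "d \<in> orbit r x"
  shows "(d \<in> S) \<noteq> (r d \<in> S) \<longleftrightarrow> a \<noteq> b \<and> d \<in> {a, b}"
proof -
  have d: "d \<in> E" "\<nu> d = \<nu> a" using assms orbit_r by auto
  have "d \<in> M1 \<longleftrightarrow> d = a" using d(2) assms(1) inj(1) by (metis inj_onD)
  moreover have "d \<in> M2 \<longleftrightarrow> d = b" using d(2) assms(2,3) inj(2) by (metis inj_onD)
  ultimately show ?thesis using change[OF d(1)] by auto
qed

lemma permutation_r: "permutation r"
  using r_permutes finite_E by (auto simp: permutation_permutes)

lemma separated:
  assumes "a \<in> M1" "b \<in> M2" "\<nu> a = \<nu> b" "a \<noteq> b"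
  shows "(a \<in> S) \<noteq> (b \<in> S)"
proof (rule cut_points_separated[OF permutation_r, of a a b])
  have "a \<in> E" "b \<in> E" using assms M_sub by auto
  then show "a \<in> orbit r a" "b \<in> orbit r a" using orbit_r[of a] assms(3) by auto
  show "(d \<in> S) \<noteq> (r d \<in> S) \<longleftrightarrow> a \<noteq> b \<and> d \<in> {a, b}" if "d \<in> orbit r a" for d
    using change_on_orbit[OF assms(1-3) \<open>a \<in> E\<close> refl that] .
qed (rule assms(4))

lemma nodes_of_S:
  assumes "s \<in> S"
  obtains a b where "a \<in> M1" "b \<in> M2" "\<nu> a = \<nu> s" "\<nu> b = \<nu> s"
proof -
  have "\<nu> s \<in> \<nu> ` M1" using S_nodes assms by blast
  then obtain a where a: "a \<in> M1" "\<nu> s = \<nu> a" by auto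
  have "\<nu> s \<in> \<nu> ` M2" using S_nodes assms same_nodes by blast
  then obtain b where b: "b \<in> M2" "\<nu> s = \<nu> b" by auto
  show ?thesis by (rule that[OF a(1) b(1) a(2)[symmetric] b(2)[symmetric]])
qed

lemma r\<tau>_permutes: "(r \<circ> \<tau>) permutes E"
  using permutes_compose[OF swap_permutes[OF M_sub] r_permutes] .

lemma orbit_cut:
  assumes s: "s \<in> S"
  shows "orbit (r \<circ> \<tau>) s = {e \<in> S. \<nu> e = \<nu> s}"
proof -
  obtain a b where ab: "a \<in> M1" "b \<in> M2" "\<nu> a = \<nu> s" "\<nu> b = \<nu> s" using nodes_of_S[OF s] .
  have E: "s \<in> E" "a \<in> E" "b \<in> E" using s ab S_sub M_sub by auto
  have "orbit (r \<circ> \<tau>) s = S \<inter> orbit r s"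
  proof (rule orbit_cut_in_two[OF permutation_r, of _ s a b])
    show "permutation (r \<circ> \<tau>)" using r\<tau>_permutes finite_E by (auto simp: permutation_permutes)
    show "(r \<circ> \<tau>) d = r d" if "d \<in> orbit r s" "d \<noteq> a" "d \<noteq> b" for d
    proof -
      have "\<nu> d = \<nu> s" using that(1) orbit_r[OF E(1)] by simp
      then have "d \<notin> M1" "d \<notin> M2" using that ab inj by (metis inj_onD)+
      then show ?thesis using swap_other by simp
    qed
    show "(r \<circ> \<tau>) a = r b" "(r \<circ> \<tau>) b = r a" using swap_pair[of a b] ab by simp_all
    show "a \<in> orbit r s" "b \<in> orbit r s" using orbit_r[OF E(1)] E ab by simp_all
    show "(d \<in> S) \<noteq> (r d \<in> S) \<longleftrightarrow> a \<noteq> b \<and> d \<in> {a, b}" if "d \<in> orbit r s" for d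
      by (rule change_on_orbit[OF ab(1,2) trans[OF ab(3) ab(4)[symmetric]] E(1) ab(3)[symmetric] that])
    show "s \<in> S" "s \<in> orbit r s" using s orbit_r[OF E(1)] E by simp_all
  qed
  then show ?thesis using orbit_r[OF E(1)] S_sub by auto
qed

lemma bij_cut: "bij_betw (r \<circ> \<tau>) S S"
proof -
  have fin: "finite S" using S_sub finite_E by (rule finite_subset)
  have "(r \<circ> \<tau>) ` S \<subseteq> S"
  proof
    fix y assume "y \<in> (r \<circ> \<tau>) ` S"
    then obtain s where "s \<in> S" "y = (r \<circ> \<tau>) s" by auto
    then show "y \<in> S" using orbit_cut[of s] orbit.base[of "r \<circ> \<tau>" s] by simp
  qed
  moreover have "inj_on (r \<circ> \<tau>) S" using permutes_inj[OF r\<tau>_permutes] by (rule inj_on_subset) simp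
  ultimately show ?thesis using endo_inj_surj[OF fin] unfolding bij_betw_def by blast
qed

text \<open>
  The nodes that meet \<open>S\<close> are counted by the corners of \<open>M1\<close> that lie in \<open>S\<close> or on its boundary.
  If \<open>S\<close> is closed under reversal of darts, this count is the same for the crossings and the faces.
\<close>

lemma card_cut_nodes: "card (\<nu> ` S) = card {c \<in> M1. c \<in> S \<or> r c \<in> S}"
proof -
  let ?T = "{c \<in> M1. c \<in> S \<or> r c \<in> S}"
  have "\<nu> ` S = \<nu> ` ?T"
  proof (intro equalityI subsetI)
    fix y assume "y \<in> \<nu> ` S"
    then obtain s where s: "s \<in> S" "y = \<nu> s" by auto
    obtain a b where ab: "a \<in> M1" "b \<in> M2" "\<nu> a = \<nu> s" "\<nu> b = \<nu> s" using nodes_of_S[OF s(1)] .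
    have E: "s \<in> E" "a \<in> E" using s ab S_sub M_sub by auto
    have ch: "(d \<in> S) \<noteq> (r d \<in> S) \<longleftrightarrow> a \<noteq> b \<and> d \<in> {a, b}" if "d \<in> orbit r s" for d
      by (rule change_on_orbit[OF ab(1,2) trans[OF ab(3) ab(4)[symmetric]] E(1) ab(3)[symmetric] that])
    have "a \<in> S \<or> r a \<in> S"
    proof (rule ccontr)
      assume no: "\<not> (a \<in> S \<or> r a \<in> S)"
      have a_orb: "a \<in> orbit r s" using orbit_r[OF E(1)] E ab by simp
      then have "a = b" using ch[of a] no by auto
      then have step: "d \<in> S \<longleftrightarrow> r d \<in> S" if "d \<in> orbit r s" for d using ch[OF that] by simp
      have "s \<in> orbit r s" using orbit_r[OF E(1)] E by simp
      from a_orb have "a \<in> orbit r s \<and> a \<in> S"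
        by induction (use step s \<open>s \<in> orbit r s\<close> in \<open>auto intro: orbit.intros\<close>)
      then show False using no by simp
    qed
    then have "a \<in> ?T" using ab by simp
    then show "y \<in> \<nu> ` ?T" using s ab by (intro image_eqI[of _ _ a]) auto
  next
    fix y assume "y \<in> \<nu> ` ?T"
    then obtain c where c: "c \<in> M1" "c \<in> S \<or> r c \<in> S" "y = \<nu> c" by auto
    have cE: "c \<in> E" using c M_sub by auto
    have "\<nu> (r c) = \<nu> c" using orbit.base[of r c] orbit_r[OF cE] by simp
    then show "y \<in> \<nu> ` S" using c(2,3) by (metis image_eqI)
  qed
  moreover have "inj_on \<nu> ?T" using inj(1) by (rule inj_on_subset) auto
  ultimately show ?thesis using card_image by metis
qed

lemma sign_cut:
  "sign_on S (r \<circ> \<tau>) = (-1) ^ (card S + card {c \<in> M1. c \<in> S \<or> r c \<in> S})"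
proof -
  have fin: "finite S" using S_sub finite_E by (rule finite_subset)
  have "orbit (r \<circ> \<tau>) ` S = (\<lambda>k. {e \<in> S. \<nu> e = k}) ` \<nu> ` S"
    unfolding image_image using orbit_cut by (intro image_cong refl)
  moreover have "inj_on (\<lambda>k. {e \<in> S. \<nu> e = k}) (\<nu> ` S)"
  proof (rule inj_onI)
    fix k l assume "k \<in> \<nu> ` S" "l \<in> \<nu> ` S" and eq: "{e \<in> S. \<nu> e = k} = {e \<in> S. \<nu> e = l}"
    then obtain s where "s \<in> S" "\<nu> s = k" by auto
    then have "s \<in> {e \<in> S. \<nu> e = l}" unfolding eq[symmetric] by simp
    then show "k = l" using \<open>\<nu> s = k\<close> by simp
  qed
  ultimately have "card (orbit (r \<circ> \<tau>) ` S) = card (\<nu> ` S)" by (simp only: card_image)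
  then show ?thesis using sign_on_eq_card_orbits[OF fin bij_cut] card_cut_nodes by simp
qed

end

section \<open>The index of a sublattice\<close>

text \<open>
  Matrices are functions here, so that the induction on the size can pass to the upper left block
  without changing the matrix.
\<close>

definition fun_det :: "nat \<Rightarrow> (nat \<Rightarrow> nat \<Rightarrow> int) \<Rightarrow> int" where
  "fun_det n A = det (mat n n (\<lambda>(i, j). A i j))"

definition in_row_span :: "nat \<Rightarrow> (nat \<Rightarrow> nat \<Rightarrow> int) \<Rightarrow> (nat \<Rightarrow> int) \<Rightarrow> bool" where
  "in_row_span n A v \<longleftrightarrow> (\<exists>c. \<forall>j<n. v j = (\<Sum>i<n. c i * A i j))"

definition row_equivalent :: "nat \<Rightarrow> (nat \<Rightarrow> nat \<Rightarrow> int) \<Rightarrow> (nat \<Rightarrow> nat \<Rightarrow> int) \<Rightarrow> bool" where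
  "row_equivalent n A B \<longleftrightarrow> fun_det n A = fun_det n B \<and> in_row_span n A = in_row_span n B"

lemma row_equivalent_refl: "row_equivalent n A A"
  by (simp add: row_equivalent_def)

lemma row_equivalent_trans: "row_equivalent n A B \<Longrightarrow> row_equivalent n B C \<Longrightarrow> row_equivalent n A C"
  by (simp add: row_equivalent_def)

definition add_row :: "int \<Rightarrow> nat \<Rightarrow> nat \<Rightarrow> (nat \<Rightarrow> nat \<Rightarrow> int) \<Rightarrow> nat \<Rightarrow> nat \<Rightarrow> int" where
  "add_row a k l A = A(k := \<lambda>j. A k j + a * A l j)"

lemma in_row_span_add_rowD:
  assumes "k < n" "l < n" "k \<noteq> l" "in_row_span n (add_row a k l A) v"
  shows "in_row_span n A v"
proof -
  obtain c where c: "\<forall>j<n. v j = (\<Sum>i<n. c i * add_row a k l A i j)"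
    using assms(4) by (auto simp: in_row_span_def)
  have "(\<Sum>i<n. c i * add_row a k l A i j) = (\<Sum>i<n. (c(l := c l + a * c k)) i * A i j)" for j
  proof -
    have "(\<Sum>i<n. c i * add_row a k l A i j)
        = (\<Sum>i<n. c i * A i j + (if i = k then a * c k * A l j else 0))"
      by (intro sum.cong) (auto simp: add_row_def algebra_simps)
    also have "\<dots> = (\<Sum>i<n. c i * A i j + (if i = l then a * c k * A l j else 0))"
      using assms(1,2) by (simp add: sum.distrib)
    also have "\<dots> = (\<Sum>i<n. (c(l := c l + a * c k)) i * A i j)"
      by (intro sum.cong) (auto simp: algebra_simps)
    finally show ?thesis .
  qed
  then show ?thesis using c unfolding in_row_span_def by metis
qed

lemma row_equivalent_add_row:
  assumes "k < n" "l < n" "k \<noteq> l"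
  shows "row_equivalent n A (add_row a k l A)"
proof -
  have "mat n n (\<lambda>(i, j). add_row a k l A i j) = addrow a k l (mat n n (\<lambda>(i, j). A i j))"
    using assms by (intro eq_matI) (auto simp: add_row_def mat_addrow_def algebra_simps)
  then have "fun_det n A = fun_det n (add_row a k l A)"
    unfolding fun_det_def using assms by (simp add: det_addrow)
  moreover have "A = add_row (-a) k l (add_row a k l A)"
    using assms by (auto simp: add_row_def fun_eq_iff)
  then have "in_row_span n A v \<longleftrightarrow> in_row_span n (add_row a k l A) v" for v
    using in_row_span_add_rowD[OF assms] by metis
  ultimately show ?thesis by (auto simp: row_equivalent_def)
qed

text \<open>
  Euclid's algorithm on the entries of the last column: as long as two of them are nonzero, adding
  or subtracting the row of the smaller one decreases the sum of the absolute values.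
\<close>

lemma clear_last_column:
  "\<exists>B. row_equivalent (Suc n) A B \<and> (\<forall>i<n. B i n = 0)"
proof (induction "\<Sum>i\<le>n. nat \<bar>A i n\<bar>" arbitrary: A rule: less_induct)
  case less
  show ?case
  proof (cases "\<exists>i j. i \<le> n \<and> j \<le> n \<and> i \<noteq> j \<and> A i n \<noteq> 0 \<and> A j n \<noteq> 0")
    case True
    then obtain p q where pq: "p \<le> n" "q \<le> n" "p \<noteq> q" "A p n \<noteq> 0" "A q n \<noteq> 0" by blast
    obtain i j where ij: "i \<le> n" "j \<le> n" "i \<noteq> j" "A i n \<noteq> 0" "A j n \<noteq> 0"
      and le: "\<bar>A i n\<bar> \<le> \<bar>A j n\<bar>"
    proof (cases "\<bar>A p n\<bar> \<le> \<bar>A q n\<bar>")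
      case True then show ?thesis using that[of p q] pq by simp
    next
      case False then show ?thesis using that[of q p] pq by simp
    qed
    define A' where "A' = add_row (- (sgn (A i n) * sgn (A j n))) j i A"
    have "\<bar>A' j n\<bar> < \<bar>A j n\<bar>"
      using ij le by (auto simp: A'_def add_row_def sgn_if)
    moreover have "A' k n = A k n" if "k \<noteq> j" for k using that by (simp add: A'_def add_row_def)
    ultimately have "(\<Sum>i\<le>n. nat \<bar>A' i n\<bar>) < (\<Sum>i\<le>n. nat \<bar>A i n\<bar>)"
      using ij(2) by (intro sum_strict_mono_ex1 ballI bexI[of _ j])
        (auto intro!: nat_mono, metis order_refl less_imp_le)
    from less[of A', OF this] obtain B where "row_equivalent (Suc n) A' B" "\<forall>i<n. B i n = 0" by blast
    moreover have "row_equivalent (Suc n) A A'"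
      unfolding A'_def using ij by (intro row_equivalent_add_row) auto
    ultimately show ?thesis by (blast intro: row_equivalent_trans)
  next
    case False
    show ?thesis
    proof (cases "\<exists>i<n. A i n \<noteq> 0")
      case True
      then obtain i where i: "i < n" "A i n \<noteq> 0" by blast
      have zero: "A k n = 0" if "k \<le> n" "k \<noteq> i" for k
        using False i that by (metis less_imp_le)
      \<comment> \<open>Move the remaining entry into the last row without a swap, which would change the sign.\<close>
      define A' where "A' = add_row 1 n i A"
      define B where "B = add_row (-1) i n A'"
      have "row_equivalent (Suc n) A A'" "row_equivalent (Suc n) A' B"
        unfolding A'_def B_def using i by (auto intro!: row_equivalent_add_row)
      moreover have "\<forall>k<n. B k n = 0"
        using i zero by (auto simp: B_def A'_def add_row_def)
      ultimately show ?thesis by (blast intro: row_equivalent_trans)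
    next
      case False
      then show ?thesis using row_equivalent_refl by blast
    qed
  qed
qed

lemma fun_det_clear_column:
  assumes "\<And>i. i < n \<Longrightarrow> A i n = 0"
  shows "fun_det (Suc n) A = A n n * fun_det n A"
proof -
  define M where "M = mat (Suc n) (Suc n) (\<lambda>(i, j). A i j)"
  have "det M = (\<Sum>i<Suc n. M $$ (i, n) * cofactor M i n)"
    by (rule laplace_expansion_column) (auto simp: M_def)
  also have "\<dots> = A n n * cofactor M n n"
    using assms by (simp add: M_def)
  also have "mat_delete M n n = mat n n (\<lambda>(i, j). A i j)"
    by (rule eq_matI) (auto simp: mat_delete_def M_def)
  then have "cofactor M n n = fun_det n A"
    by (simp add: cofactor_def fun_det_def)
  finally show ?thesis by (simp add: fun_det_def M_def)
qed

lemma in_row_span_clear_column: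
  assumes "\<And>i. i < n \<Longrightarrow> A i n = 0"
  shows "in_row_span (Suc n) A v \<longleftrightarrow> (\<exists>c. v n = c * A n n \<and> in_row_span n A (\<lambda>j. v j - c * A n j))"
proof
  assume "in_row_span (Suc n) A v"
  then obtain c where c: "\<forall>j<Suc n. v j = (\<Sum>i<Suc n. c i * A i j)" by (auto simp: in_row_span_def)
  have "v n = c n * A n n" using c assms by simp
  moreover have "in_row_span n A (\<lambda>j. v j - c n * A n j)"
    unfolding in_row_span_def using c by (intro exI[of _ c]) auto
  ultimately show "\<exists>c. v n = c * A n n \<and> in_row_span n A (\<lambda>j. v j - c * A n j)" by blast
next
  assume "\<exists>c. v n = c * A n n \<and> in_row_span n A (\<lambda>j. v j - c * A n j)"
  then obtain c b where c: "v n = c * A n n" "\<forall>j<n. v j - c * A n j = (\<Sum>i<n. b i * A i j)"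
    by (auto simp: in_row_span_def)
  show "in_row_span (Suc n) A v"
    unfolding in_row_span_def
  proof (intro exI[of _ "b(n := c)"] allI impI)
    fix j assume "j < Suc n"
    then consider "j = n" | "j < n" by linarith
    then show "v j = (\<Sum>i<Suc n. (b(n := c)) i * A i j)"
    proof cases
      case 1 then show ?thesis using c(1) assms by simp
    next
      case 2 then show ?thesis using c(2) by (simp add: algebra_simps)
    qed
  qed
qed

text \<open>
  The quotient of the integer lattice by the row span has \<open>\<bar>det A\<bar>\<close> elements.  Once only the last
  entry \<open>g\<close> of the last column is nonzero, a vector is reduced by fixing its last coordinate modulo
  \<open>g\<close> and then reducing the others with the upper left block.
\<close>

lemma row_span_transversal:
  assumes "fun_det n A \<noteq> 0"
  shows "\<exists>T. finite T \<and> int (card T) = \<bar>fun_det n A\<bar> \<and>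
    (\<forall>v. \<exists>!t. t \<in> T \<and> in_row_span n A (\<lambda>j. v j - t j))"
proof -
  have "\<exists>T. finite T \<and> int (card T) = \<bar>fun_det n A\<bar> \<and> (\<forall>t\<in>T. \<forall>j\<ge>n. t j = 0) \<and>
    (\<forall>v. \<exists>!t. t \<in> T \<and> in_row_span n A (\<lambda>j. v j - t j))"
    using assms
  proof (induction n arbitrary: A)
    case 0
    have "fun_det 0 A = 1" unfolding fun_det_def by (rule det_dim_zero) simp
    then show ?case
      by (intro exI[of _ "{\<lambda>_. 0}"]) (auto simp: in_row_span_def)
  next
    case (Suc n)
    obtain B where B: "row_equivalent (Suc n) A B" and B0: "\<And>i. i < n \<Longrightarrow> B i n = 0"
      using clear_last_column[of n A] by blast
    define g where "g = B n n"
    have det: "fun_det (Suc n) A = g * fun_det n B"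
      using B fun_det_clear_column[of n B] B0 by (simp add: row_equivalent_def g_def)
    have g: "g \<noteq> 0" and detB: "fun_det n B \<noteq> 0" using det Suc.prems by auto
    obtain T where finT: "finite T" and cT: "int (card T) = \<bar>fun_det n B\<bar>"
      and T0: "\<forall>t\<in>T. \<forall>j\<ge>n. t j = 0"
      and T: "\<And>v. \<exists>!t. t \<in> T \<and> in_row_span n B (\<lambda>j. v j - t j)"
      using Suc.IH[OF detB] by blast
    define ext where "ext = (\<lambda>(t :: nat \<Rightarrow> int, x :: int). t(n := x))"
    define U where "U = ext ` (T \<times> {0..<\<bar>g\<bar>})"
    have inj: "inj_on ext (T \<times> {0..<\<bar>g\<bar>})"
    proof (rule inj_onI, clarify)
      fix s x t y assume "s \<in> T" "t \<in> T" and eq: "ext (s, x) = ext (t, y)"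
      then have n0: "s n = 0" "t n = 0" using T0 by auto
      have "s(n := x) = t(n := y)" using eq by (simp add: ext_def)
      then have xy: "x = y" by (metis fun_upd_same)
      have "s j = t j" for j using fun_cong[OF \<open>s(n := x) = t(n := y)\<close>, of j] n0 by (cases "j = n") auto
      then show "s = t \<and> x = y" using xy by auto
    qed
    have "int (card U) = \<bar>fun_det (Suc n) A\<bar>"
      unfolding U_def card_image[OF inj] det by (simp add: card_cartesian_product cT abs_mult)
    moreover have "finite U" unfolding U_def using finT by auto
    moreover have "\<forall>u\<in>U. \<forall>j\<ge>Suc n. u j = 0"
      using T0 by (auto simp: U_def ext_def)
    moreover have "\<exists>!u. u \<in> U \<and> in_row_span (Suc n) A (\<lambda>j. v j - u j)" for v
    proof -
      define x where "x = v n mod \<bar>g\<bar>"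
      have x: "0 \<le> x" "x < \<bar>g\<bar>" using g by (auto simp: x_def)
      have "g dvd v n - x" unfolding x_def by (simp add: minus_mod_eq_mult_div)
      then obtain c where c: "v n - x = c * g" by (metis dvdE mult.commute)
      obtain t where t: "t \<in> T" "in_row_span n B (\<lambda>j. (v j - c * B n j) - t j)"
        and uniq: "\<And>s. s \<in> T \<Longrightarrow> in_row_span n B (\<lambda>j. (v j - c * B n j) - s j) \<Longrightarrow> s = t"
        using T[of "\<lambda>j. v j - c * B n j"] by blast
      have span_cong: "in_row_span n B u \<longleftrightarrow> in_row_span n B w" if "\<And>j. j < n \<Longrightarrow> u j = w j" for u w
        using that by (simp add: in_row_span_def)
      have span: "in_row_span (Suc n) A (\<lambda>j. v j - (s(n := y)) j) \<longleftrightarrow>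
          (\<exists>b. v n - y = b * g \<and> in_row_span n B (\<lambda>j. (v j - b * B n j) - s j))" for s y
      proof -
        have "in_row_span n B (\<lambda>j. (v j - (s(n := y)) j) - b * B n j) \<longleftrightarrow>
            in_row_span n B (\<lambda>j. (v j - b * B n j) - s j)" for b
          by (rule span_cong) auto
        moreover have "in_row_span (Suc n) A = in_row_span (Suc n) B" using B by (simp add: row_equivalent_def)
        ultimately show ?thesis
          using in_row_span_clear_column[of n B "\<lambda>j. v j - (s(n := y)) j", OF B0] by (simp add: g_def)
      qed
      show ?thesis
      proof (rule ex1I[of _ "t(n := x)"])
        show "t(n := x) \<in> U \<and> in_row_span (Suc n) A (\<lambda>j. v j - (t(n := x)) j)"
        proof
          show "t(n := x) \<in> U" using t x by (auto simp: U_def ext_def image_iff intro!: bexI[of _ t] bexI[of _ x])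
          show "in_row_span (Suc n) A (\<lambda>j. v j - (t(n := x)) j)" using span c t by blast
        qed
        fix u assume u: "u \<in> U \<and> in_row_span (Suc n) A (\<lambda>j. v j - u j)"
        then obtain s y where s: "s \<in> T" "0 \<le> y" "y < \<bar>g\<bar>" "u = s(n := y)"
          by (auto simp: U_def ext_def)
        with u span obtain b where b: "v n - y = b * g" "in_row_span n B (\<lambda>j. (v j - b * B n j) - s j)"
          by blast
        have "v n = y + b * g" using b(1) by simp
        then have "v n mod \<bar>g\<bar> = (y + (b * sgn g) * \<bar>g\<bar>) mod \<bar>g\<bar>" by (simp add: mult.assoc sgn_mult_abs)
        also have "\<dots> = y" using s by simp
        finally have "y = x" by (simp add: x_def)
        then have "b = c" using b(1) c g by simp
        then show "u = t(n := x)" using uniq[OF s(1)] b s \<open>y = x\<close> by simp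
      qed
    qed
    ultimately show ?case by blast
  qed
  then show ?thesis by blast
qed

section \<open>Closed forms on a sphere are exact\<close>

text \<open>
  \<open>U\<close> is the node set of a tree and \<open>B\<close> contains one dart of each of its edges, pointing from the
  node attached last towards the older part.  A record of the growth, instead of a spanning tree as
  a graph, gives an induction that builds potentials and, run backwards, removes leaves.
\<close>

inductive tree_grows :: "('d \<Rightarrow> 'v) \<Rightarrow> ('d \<Rightarrow> 'd) \<Rightarrow> 'd set \<Rightarrow> 'v set \<Rightarrow> 'd set \<Rightarrow> bool"
  for node \<iota> K where
  root: "tree_grows node \<iota> K {v} {}"
| attach: "tree_grows node \<iota> K U B \<Longrightarrow> b \<in> K \<Longrightarrow> node b \<notin> U \<Longrightarrow> node (\<iota> b) \<in> U \<Longrightarrow>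
    tree_grows node \<iota> K (insert (node b) U) (insert b B)"

definition edge_connected :: "('d \<Rightarrow> 'v) \<Rightarrow> ('d \<Rightarrow> 'd) \<Rightarrow> 'd set \<Rightarrow> 'v set \<Rightarrow> bool" where
  "edge_connected node \<iota> K N \<longleftrightarrow>
    (\<forall>U. U \<subseteq> N \<longrightarrow> U \<noteq> {} \<longrightarrow> (\<forall>d\<in>K. node d \<in> U \<longrightarrow> node (\<iota> d) \<in> U) \<longrightarrow> U = N)"

lemma tree_grows_props:
  assumes "tree_grows node \<iota> K U B" "\<And>d. d \<in> K \<Longrightarrow> \<iota> (\<iota> d) = d"
  shows "finite U \<and> finite B \<and> card U = card B + 1 \<and> B \<subseteq> K \<and> node ` B \<subseteq> U \<and> node ` \<iota> ` B \<subseteq> U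
    \<and> B \<inter> \<iota> ` B = {}"
  using assms(1)
proof induction
  case (attach U B b)
  have "b \<notin> B" using attach by auto
  moreover have "b \<notin> \<iota> ` B" using attach unfolding image_subset_iff by blast
  moreover have "\<iota> b \<notin> B"
  proof
    assume "\<iota> b \<in> B"
    then have "node (\<iota> (\<iota> b)) \<in> U" using attach by blast
    then show False using attach assms(2) by simp
  qed
  moreover have "\<iota> b \<noteq> b" using attach by auto
  ultimately show ?case using attach by (auto simp: image_subset_iff)
qed auto

lemma spanning_tree_exists:
  assumes conn: "edge_connected node \<iota> K N" and N: "finite N" "N \<noteq> {}" and KN: "node ` K \<subseteq> N"
    and \<iota>: "\<And>d. d \<in> K \<Longrightarrow> \<iota> d \<in> K \<and> \<iota> (\<iota> d) = d"
  shows "\<exists>B. tree_grows node \<iota> K N B"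
proof -
  have grow: "\<exists>U B. tree_grows node \<iota> K U B \<and> U \<subseteq> N \<and> card U = Suc k" if "k < card N" for k
    using that
  proof (induction k)
    case 0
    obtain v where "v \<in> N" using N by auto
    then show ?case using tree_grows.root[of node \<iota> K v] by (intro exI[of _ "{v}"] exI[of _ "{}"]) auto
  next
    case (Suc k)
    then obtain U B where UB: "tree_grows node \<iota> K U B" "U \<subseteq> N" "card U = Suc k" by auto
    have "U \<noteq> {}" "U \<noteq> N" using UB Suc.prems by auto
    then obtain d where d: "d \<in> K" "node d \<in> U" "node (\<iota> d) \<notin> U"
      using conn UB(2) unfolding edge_connected_def by blast
    have "tree_grows node \<iota> K (insert (node (\<iota> d)) U) (insert (\<iota> d) B)"
      using tree_grows.attach[OF UB(1), of "\<iota> d"] d \<iota>[of d] by simp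
    moreover have "insert (node (\<iota> d)) U \<subseteq> N" using UB(2) KN \<iota>[OF d(1)] by auto
    moreover have "card (insert (node (\<iota> d)) U) = Suc (Suc k)"
      using UB d(3) finite_subset[OF UB(2) N(1)] by simp
    ultimately show ?case by blast
  qed
  have "card N > 0" using N by (simp add: card_gt_0_iff)
  then have "card N - 1 < card N" "Suc (card N - 1) = card N" by simp_all
  then obtain U B where UB: "tree_grows node \<iota> K U B" "U \<subseteq> N" "card U = card N"
    using grow[of "card N - 1"] by auto
  then have "U = N" using card_subset_eq[OF N(1)] by simp
  then show ?thesis using UB(1) by blast
qed

text \<open>
  The node attached last has only one tree edge, so the form vanishes on that edge; continue with the
  rest of the tree.
\<close>

lemma closed_form_on_tree_vanishes:
  fixes g :: "'d \<Rightarrow> 'a::ab_group_add"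
  assumes "tree_grows node \<iota> K U B" and K: "K \<subseteq> E" "finite E"
    and \<iota>: "\<And>d. d \<in> E \<Longrightarrow> \<iota> d \<in> E \<and> \<iota> (\<iota> d) = d"
    and anti: "\<And>d. d \<in> E \<Longrightarrow> g (\<iota> d) = - g d"
    and closed: "\<And>v. v \<in> U \<Longrightarrow> (\<Sum>d\<in>{d \<in> E. node d = v}. g d) = 0"
    and supp: "\<And>d. d \<in> E \<Longrightarrow> d \<notin> B \<Longrightarrow> d \<notin> \<iota> ` B \<Longrightarrow> g d = 0"
    and d: "d \<in> E"
  shows "g d = 0"
proof -
  have "(\<forall>v\<in>U. (\<Sum>d\<in>{d \<in> E. node d = v}. g d) = 0) \<longrightarrow>
      (\<forall>d\<in>E. d \<notin> B \<longrightarrow> d \<notin> \<iota> ` B \<longrightarrow> g d = 0) \<longrightarrow> (\<forall>d\<in>E. g d = 0)"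
    using assms(1)
  proof induction
    case (attach U B b)
    have UB: "node ` B \<subseteq> U" "node ` \<iota> ` B \<subseteq> U" "B \<subseteq> K"
      using tree_grows_props[OF attach.hyps(1)] \<iota> K by blast+
    have bE: "b \<in> E" "\<iota> b \<in> E" using attach.hyps K \<iota> by auto
    show ?case
    proof (intro impI)
      assume cl: "\<forall>v\<in>insert (node b) U. (\<Sum>d\<in>{d \<in> E. node d = v}. g d) = 0"
        and su: "\<forall>d\<in>E. d \<notin> insert b B \<longrightarrow> d \<notin> \<iota> ` insert b B \<longrightarrow> g d = 0"
      have "(\<Sum>d\<in>{d \<in> E. node d = node b}. g d) = (\<Sum>d\<in>{b}. g d)"
      proof (rule sum.mono_neutral_right)
        show "\<forall>i\<in>{d \<in> E. node d = node b} - {b}. g i = 0"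
        proof
          fix i assume i: "i \<in> {d \<in> E. node d = node b} - {b}"
          from i have i': "i \<in> E" "i \<noteq> b" "node i = node b" by auto
          have B: "node x \<noteq> node b \<and> node (\<iota> x) \<noteq> node b" if "x \<in> B" for x
          proof -
            have "node x \<in> U" "node (\<iota> x) \<in> U" using UB that by auto
            then show ?thesis using attach.hyps(3) by metis
          qed
          have "i \<notin> insert b B" using B[of i] i' by auto
          moreover have "i \<notin> \<iota> ` insert b B"
          proof
            assume "i \<in> \<iota> ` insert b B"
            then obtain x where "x = b \<or> x \<in> B" "i = \<iota> x" by auto
            then show False using B[of x] i'(3) attach.hyps(3,4) by metis
          qed
          ultimately have "i \<notin> insert b B" "i \<notin> \<iota> ` insert b B" by auto
          then show "g i = 0" using su i by auto
        qed
      qed (use K bE in auto)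
      then have gb: "g b = 0" using cl by auto
      then have "g (\<iota> b) = 0" using anti[OF bE(1)] by simp
      then have "\<forall>d\<in>E. d \<notin> B \<longrightarrow> d \<notin> \<iota> ` B \<longrightarrow> g d = 0" using su gb by auto
      then show "\<forall>d\<in>E. g d = 0" using attach.IH cl by auto
    qed
  qed auto
  then show ?thesis using closed supp d by blast
qed

lemma tree_potential:
  fixes q :: "'d \<Rightarrow> 'a::ab_group_add"
  assumes "tree_grows node \<iota> K U B" and \<iota>: "\<And>d. d \<in> K \<Longrightarrow> \<iota> (\<iota> d) = d"
  shows "\<exists>h. \<forall>d\<in>B. q d = h (node d) - h (node (\<iota> d))"
  using assms(1)
proof induction
  case (attach U B b)
  then obtain h where h: "\<forall>d\<in>B. q d = h (node d) - h (node (\<iota> d))" by blast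
  have UB: "node ` B \<subseteq> U" "node ` \<iota> ` B \<subseteq> U"
    using tree_grows_props[OF attach.hyps(1)] \<iota> by blast+
  define h' where "h' = h(node b := q b + h (node (\<iota> b)))"
  have eq: "h' v = h v" if "v \<in> U" for v using that attach.hyps by (auto simp: h'_def)
  have "q d = h' (node d) - h' (node (\<iota> d))" if "d \<in> B" for d
    using that h UB eq unfolding image_subset_iff by simp
  moreover have "q b = h' (node b) - h' (node (\<iota> b))"
    using eq[of "node (\<iota> b)"] attach.hyps by (simp add: h'_def)
  ultimately show ?case by (intro exI[of _ h']) auto
qed auto

text \<open>
  The boundary of a face is a closed walk.
\<close>

lemma exact_form_is_closed:
  fixes h :: "'v \<Rightarrow> 'a::ab_group_add"
  assumes fin: "finite E" 
    and \<phi>: "bij_betw \<phi> E E" "\<And>d. d \<in> E \<Longrightarrow> fc (\<phi> d) = fc d" "\<And>d. d \<in> E \<Longrightarrow> vx (\<phi> d) = vx (\<iota> d)"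
  shows "(\<Sum>e\<in>{e \<in> E. fc e = y}. h (vx e) - h (vx (\<iota> e))) = 0"
proof -
  let ?F = "{e \<in> E. fc e = y}"
  have "\<phi> ` ?F \<subseteq> ?F" using \<phi> by (auto dest: bij_betwE)
  moreover have "inj_on \<phi> ?F" using \<phi>(1) by (auto simp: bij_betw_def intro: inj_on_subset)
  moreover have "finite ?F" using fin by auto
  ultimately have bij: "bij_betw \<phi> ?F ?F" unfolding bij_betw_def using endo_inj_surj by blast
  have "(\<Sum>e\<in>?F. h (vx (\<iota> e))) = (\<Sum>e\<in>?F. h (vx (\<phi> e)))"
    using \<phi>(3) by (intro sum.cong) auto
  also have "\<dots> = (\<Sum>e\<in>?F. h (vx e))" using sum.reindex_bij_betw[OF bij] .
  finally show ?thesis by (simp add: sum_subtractf)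
qed

text \<open>
  Choose a spanning tree \<open>B\<close> of the faces.  The edges outside \<open>B\<close> connect all vertices:
  otherwise the cut form of a component would be a closed form supported on \<open>B\<close>, hence zero.  By
  Euler's formula their number is that of a spanning tree, so they are one, and \<open>q\<close> has a potential
  on them.  The difference of \<open>q\<close> and the coboundary of the potential is again closed and supported
  on \<open>B\<close>.  Here \<open>fc d\<close> and \<open>vx d\<close> are the face on the left and the origin of \<open>d\<close>.
\<close>

lemma closed_form_is_exact:
  fixes q :: "'d \<Rightarrow> 'a::ab_group_add"
  assumes fin: "finite E" "E \<noteq> {}"
    and \<iota>: "\<And>d. d \<in> E \<Longrightarrow> \<iota> d \<in> E \<and> \<iota> (\<iota> d) = d"
    and \<phi>: "bij_betw \<phi> E E" "\<And>d. d \<in> E \<Longrightarrow> fc (\<phi> d) = fc d" "\<And>d. d \<in> E \<Longrightarrow> vx (\<phi> d) = vx (\<iota> d)"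
    and conn: "edge_connected vx \<iota> E (vx ` E)" "edge_connected fc \<iota> E (fc ` E)"
    and euler: "2 * (card (vx ` E) + card (fc ` E)) = card E + 4"
    and anti: "\<And>d. d \<in> E \<Longrightarrow> q (\<iota> d) = - q d"
    and closed: "\<And>d. d \<in> E \<Longrightarrow> (\<Sum>e\<in>{e \<in> E. fc e = fc d}. q e) = 0"
  shows "\<exists>h. \<forall>d\<in>E. q d = h (vx d) - h (vx (\<iota> d))"
proof -
  obtain B where B: "tree_grows fc \<iota> E (fc ` E) B"
    using spanning_tree_exists[OF conn(2)] fin \<iota> by auto
  note Bp = tree_grows_props[OF B]
  have Bprops: "finite B" "card (fc ` E) = card B + 1" "B \<subseteq> E" "B \<inter> \<iota> ` B = {}"
    using Bp \<iota> by auto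
  note coboundary_closed = exact_form_is_closed[of E \<phi> fc vx \<iota>, OF fin(1) \<phi>]
  define K where "K = E - B - \<iota> ` B"
  have KE: "K \<subseteq> E" by (auto simp: K_def)
  have K\<iota>: "\<iota> d \<in> K \<and> \<iota> (\<iota> d) = d" if "d \<in> K" for d
  proof -
    have d: "d \<in> E" "d \<notin> B" "d \<notin> \<iota> ` B" using that by (auto simp: K_def)
    have "\<iota> d \<notin> B" using d \<iota>[of d] by (metis image_eqI)
    moreover have "\<iota> d \<notin> \<iota> ` B" using d \<iota> Bprops(3) by (metis (no_types, lifting) imageE subsetD)
    ultimately show ?thesis using d \<iota> by (auto simp: K_def)
  qed
  have inj\<iota>: "inj_on \<iota> E" using \<iota> by (metis inj_onI)
  have c\<iota>: "card (A \<union> \<iota> ` A) = 2 * card A" if "A \<subseteq> E" "A \<inter> \<iota> ` A = {}" for A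
  proof -
    have "finite A" using that(1) fin(1) by (rule finite_subset)
    moreover have "card (\<iota> ` A) = card A" using inj\<iota> that(1) by (meson card_image inj_on_subset)
    ultimately show ?thesis using that(2) by (simp add: card_Un_disjoint)
  qed
  have "card K = card E - 2 * card B"
  proof -
    have "K = E - (B \<union> \<iota> ` B)" by (auto simp: K_def)
    moreover have "B \<union> \<iota> ` B \<subseteq> E" using Bprops \<iota> by auto
    ultimately show ?thesis
      using c\<iota>[of B] Bprops by (simp add: card_Diff_subset)
  qed
  then have cK: "card K + 2 = 2 * card (vx ` E)" using euler Bprops(2) fin card_gt_0_iff[of "vx ` E"] by simp
  have connK: "edge_connected vx \<iota> K (vx ` E)"
    unfolding edge_connected_def
  proof (intro allI impI)
    fix U assume U: "U \<subseteq> vx ` E" "U \<noteq> {}" "\<forall>d\<in>K. vx d \<in> U \<longrightarrow> vx (\<iota> d) \<in> U"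
    \<comment> \<open>The cut form of \<open>U\<close>.\<close>
    define g where "g = (\<lambda>d. of_bool (vx d \<in> U) - of_bool (vx (\<iota> d) \<in> U) :: int)"
    have "g d = 0" if "d \<in> E" for d
    proof (rule closed_form_on_tree_vanishes[OF B, of E])
      show "g e = 0" if "e \<in> E" "e \<notin> B" "e \<notin> \<iota> ` B" for e
      proof -
        have "e \<in> K" using that by (auto simp: K_def)
        then show ?thesis using U(3) K\<iota>[of e] by (auto simp: g_def)
      qed
      show "(\<Sum>d\<in>{d \<in> E. fc d = v}. g d) = 0" if "v \<in> fc ` E" for v
        using coboundary_closed[where y = v and h = "\<lambda>v. of_bool (v \<in> U)"] unfolding g_def by simp
    qed (use that \<iota> fin in \<open>auto simp: g_def\<close>)
    then have "of_bool (vx d \<in> U) = (of_bool (vx (\<iota> d) \<in> U) :: int)" if "d \<in> E" for d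
      using that by (simp add: g_def)
    then have "\<forall>d\<in>E. vx d \<in> U \<longrightarrow> vx (\<iota> d) \<in> U" by (metis of_bool_eq_iff)
    then show "U = vx ` E" using conn(1) U by (auto simp: edge_connected_def)
  qed
  obtain T where T: "tree_grows vx \<iota> K (vx ` E) T"
    using spanning_tree_exists[OF connK] fin KE K\<iota> by blast
  have Tprops: "card (vx ` E) = card T + 1" "T \<subseteq> K" "T \<inter> \<iota> ` T = {}"
    using tree_grows_props[OF T] K\<iota> by auto
  have "card (T \<union> \<iota> ` T) = card K" using c\<iota>[of T] Tprops KE cK by auto
  moreover have "T \<union> \<iota> ` T \<subseteq> K" using Tprops K\<iota> by auto
  moreover have "finite K" using KE fin finite_subset by auto
  ultimately have KT: "K = T \<union> \<iota> ` T" by (metis card_subset_eq)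
  obtain h where h: "\<forall>d\<in>T. q d = h (vx d) - h (vx (\<iota> d))"
    using tree_potential[OF T, of q] K\<iota> by auto
  define g where "g = (\<lambda>d. q d - (h (vx d) - h (vx (\<iota> d))))"
  have g_anti: "g (\<iota> d) = - g d" if "d \<in> E" for d
    using that anti \<iota> by (simp add: g_def)
  have "g d = 0" if "d \<in> E" for d
  proof (rule closed_form_on_tree_vanishes[OF B, of E])
    show "g e = 0" if e: "e \<in> E" "e \<notin> B" "e \<notin> \<iota> ` B" for e
    proof -
      have "e \<in> T \<union> \<iota> ` T" using e KT by (auto simp: K_def)
      then show ?thesis
      proof
        assume "e \<in> T" then show ?thesis using h by (simp add: g_def)
      next
        assume "e \<in> \<iota> ` T"
        then obtain t where t: "t \<in> T" "e = \<iota> t" by auto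
        then have "t \<in> E" "g t = 0" using h Tprops KE by (auto simp: g_def)
        then show ?thesis using g_anti t by simp
      qed
    qed
    show "(\<Sum>d\<in>{d \<in> E. fc d = v}. g d) = 0" if v: "v \<in> fc ` E" for v
    proof -
      obtain d where "d \<in> E" "v = fc d" using v by auto
      then show ?thesis
        using closed[of d] coboundary_closed[where y = "fc d" and h = h] by (simp add: g_def sum_subtractf)
    qed
  qed (use that \<iota> fin g_anti in auto)
  then show ?thesis unfolding g_def by (intro exI[of _ h]) simp
qed

section \<open>Knot diagrams\<close>

text \<open>
  The diagrams with at least one crossing.
\<close>

locale knot_map =
  fixes D :: "'d diagram"
  assumes knot: "knot_diagram D" and four_valent: "vertices D = crossings D"
begin

abbreviation E where "E \<equiv> darts D"
abbreviation r where "r \<equiv> rot D"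
abbreviation \<iota> where "\<iota> \<equiv> drev D"
abbreviation \<phi> where "\<phi> \<equiv> face_step D"
abbreviation V where "V \<equiv> vertex_at D"
abbreviation L where "L \<equiv> face_left D"

lemma finite_E: "finite E" and E_nonempty: "E \<noteq> {}"
  and r_permutes: "r permutes E" and \<iota>_permutes: "\<iota> permutes E"
  using knot by (auto simp: knot_diagram_def)

lemma \<iota>_\<iota> [simp]: "\<iota> (\<iota> d) = d"
  using knot \<iota>_permutes by (cases "d \<in> E") (auto simp: knot_diagram_def permutes_not_in)

lemma \<iota>_neq: "d \<in> E \<Longrightarrow> \<iota> d \<noteq> d"
  using knot by (auto simp: knot_diagram_def)

lemma in_E_iff [simp]: "r d \<in> E \<longleftrightarrow> d \<in> E" "\<iota> d \<in> E \<longleftrightarrow> d \<in> E"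
  using r_permutes \<iota>_permutes by (auto simp: permutes_in_image)

lemma r_rot_back [simp]: "r (rot_back D d) = d" "rot_back D (r d) = d"
  using r_permutes by (simp_all add: rot_back_def permutes_inverses)

lemma rot_back_permutes: "rot_back D permutes E"
  using r_permutes by (simp add: rot_back_def permutes_inv)

lemma \<phi>_permutes: "\<phi> permutes E"
proof -
  have "\<phi> = rot_back D \<circ> \<iota>" by (auto simp: face_step_def)
  then show ?thesis using rot_back_permutes \<iota>_permutes by (simp add: permutes_compose)
qed

lemma r_\<phi> [simp]: "r (\<phi> d) = \<iota> d"
  by (simp add: face_step_def)

lemma \<phi>_\<iota> [simp]: "\<phi> (\<iota> d) = rot_back D d"
  by (simp add: face_step_def)

lemma rot_back_in_E [simp]: "rot_back D d \<in> E \<longleftrightarrow> d \<in> E" "\<phi> d \<in> E \<longleftrightarrow> d \<in> E"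
  using rot_back_permutes \<phi>_permutes by (auto simp: permutes_in_image)

lemma permutations: "permutation r" "permutation \<iota>" "permutation \<phi>"
  using r_permutes \<iota>_permutes \<phi>_permutes finite_E by (auto simp: permutation_permutes)

lemma self_in [simp]: "d \<in> V d" "d \<in> L d"
  using permutations by (auto simp: vertex_at_def face_left_def intro: permutation_self_in_orbit)

lemma in_V_iff: "e \<in> V d \<longleftrightarrow> V e = V d"
  using orbit_cyclic_eq3[OF cyclic_on_orbit'[OF permutations(1)], of e d] self_in(1)[of e]
  unfolding vertex_at_def by metis

lemma in_L_iff: "e \<in> L d \<longleftrightarrow> L e = L d"
  using orbit_cyclic_eq3[OF cyclic_on_orbit'[OF permutations(3)], of e d] self_in(2)[of e]
  unfolding face_left_def by metis

lemma V_r [simp]: "V (r d) = V d"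
  using permutation_orbit_step[OF permutations(1)] by (simp add: vertex_at_def)

lemma V_rot_back [simp]: "V (rot_back D d) = V d"
  by (metis V_r r_rot_back(1))

lemma L_\<phi> [simp]: "L (\<phi> d) = L d"
  using permutation_orbit_step[OF permutations(3)] by (simp add: face_left_def)

lemma L_\<iota>_r [simp]: "L (\<iota> (r d)) = L d"
  by (metis L_\<phi> \<phi>_\<iota> r_rot_back(2))

lemma L_rot_back: "L (rot_back D d) = L (\<iota> d)"
  by (metis L_\<phi> \<phi>_\<iota>)

lemma V_\<phi>: "V (\<phi> d) = V (\<iota> d)"
  by (simp add: face_step_def)

lemma V_subset: "d \<in> E \<Longrightarrow> V d \<subseteq> E" and L_subset: "d \<in> E \<Longrightarrow> L d \<subseteq> E"
  using permutes_orbit_subset r_permutes \<phi>_permutes by (fastforce simp: vertex_at_def face_left_def)+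

lemma V_eq_Collect: "d \<in> E \<Longrightarrow> V d = {e \<in> E. V e = V d}"
  and L_eq_Collect: "d \<in> E \<Longrightarrow> L d = {e \<in> E. L e = L d}"
  using V_subset[of d] L_subset[of d] in_V_iff in_L_iff by (auto simp: subset_iff)

lemma crossings_eq: "crossings D = V ` E" and faces_eq: "faces D = L ` E"
  using four_valent by (auto simp: vertices_def faces_def)

lemma finite_crossings [simp]: "finite (crossings D)" and finite_faces [simp]: "finite (faces D)"
  using finite_E by (auto simp: crossings_eq faces_eq)

lemma card_V: "d \<in> E \<Longrightarrow> card (V d) = 4"
  using crossings_eq by (auto simp: crossings_def)

lemma vertex_darts:
  assumes "d \<in> E"
  shows "V d = {d, r d, r (r d), r (r (r d))}" "r (r (r (r d))) = d"
    "distinct [d, r d, r (r d), r (r (r d))]"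
proof -
  have c: "card (orbit r d) = 4" using card_V[OF assms] by (simp add: vertex_at_def)
  have self: "d \<in> orbit r d" using self_in(1) by (simp add: vertex_at_def)
  have "orbit r d = (\<lambda>n. (r ^^ n) d) ` {0..<funpow_dist1 r d d}"
    using orbit_conv_funpow_dist1[OF self] .
  moreover have "inj_on (\<lambda>n. (r ^^ n) d) {0..<funpow_dist1 r d d}"
    using inj_on_funpow_dist1[OF self] .
  ultimately have n: "funpow_dist1 r d d = 4" using c card_image by fastforce
  have "{0..<4} = {0, 1, 2, 3 :: nat}" by auto
  then have orb: "orbit r d = {d, r d, r (r d), r (r (r d))}"
    using orbit_conv_funpow_dist1[OF self] n by (simp add: numeral_eq_Suc)
  then show "V d = {d, r d, r (r d), r (r (r d))}" by (simp add: vertex_at_def)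
  show "r (r (r (r d))) = d"
    using funpow_dist1_prop[OF self] n by (simp add: numeral_eq_Suc)
  show "distinct [d, r d, r (r d), r (r (r d))]"
    using c unfolding orb by (intro card_distinct) simp
qed

lemma rot_back_eq: "d \<in> E \<Longrightarrow> rot_back D d = r (r (r d))"
  using vertex_darts(2)[of d] by (metis r_rot_back(2))

lemma straight_eq: "straight D d = r (r d)"
  by (simp add: straight_def)

lemma sum_vertex:
  fixes g :: "'d \<Rightarrow> 'a::comm_monoid_add"
  assumes "d \<in> E"
  shows "(\<Sum>e\<in>V d. g e) = g d + (g (r d) + (g (r (r d)) + g (r (r (r d)))))"
  using vertex_darts(3)[OF assms] unfolding vertex_darts(1)[OF assms] by (simp add: add.assoc)

lemma knot_traversal [consumes 2, case_names start rev straight]: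
  assumes e: "e \<in> E" and d: "d \<in> E" and P: "P d"
    and step: "\<And>c. c \<in> E \<Longrightarrow> P c \<Longrightarrow> P (\<iota> c)" "\<And>c. c \<in> E \<Longrightarrow> P c \<Longrightarrow> P (r (r c))"
  shows "P e"
proof -
  let ?R = "{(e, \<iota> e) | e. e \<in> E} \<union> {(e, straight D e) | e. e \<in> E}"
  have "linked_class ?R d = E" using knot d by (auto simp: knot_diagram_def)
  then have "(d, e) \<in> (?R \<union> ?R\<inverse>)\<^sup>*" using e by (auto simp: linked_class_def)
  then have "e \<in> E \<and> P e"
  proof induction
    case base then show ?case using d P by simp
  next
    case (step a b)
    have "b \<in> {\<iota> a, r (r a)} \<or> a \<in> {\<iota> b, r (r b)}" "a \<in> E" "b \<in> E"
      using step by (auto simp: straight_eq)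
    then have "b \<in> {\<iota> a, r (r a)}" using vertex_darts(2)[of b] by auto
    then show ?case using step assms(4,5) \<open>b \<in> E\<close> by auto
  qed
  then show ?thesis ..
qed

lemma vertices_connected: "edge_connected V \<iota> E (V ` E)"
  unfolding edge_connected_def
proof (intro allI impI)
  fix U assume U: "U \<subseteq> V ` E" "U \<noteq> {}" "\<forall>d\<in>E. V d \<in> U \<longrightarrow> V (\<iota> d) \<in> U"
  then obtain d where d: "d \<in> E" "V d \<in> U" by auto
  have "V e \<in> U" if "e \<in> E" for e
    using that d(1,2) by (induction rule: knot_traversal) (use U in auto)
  then show "U = V ` E" using U(1) by auto
qed

lemma faces_connected: "edge_connected L \<iota> E (L ` E)"
  unfolding edge_connected_def
proof (intro allI impI)
  fix U assume U: "U \<subseteq> L ` E" "U \<noteq> {}" "\<forall>d\<in>E. L d \<in> U \<longrightarrow> L (\<iota> d) \<in> U"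
  have step: "L (r c) \<in> U" if "c \<in> E" "L c \<in> U" for c
    using U(3)[rule_format, of "\<iota> (r c)"] that by simp
  obtain d where d: "d \<in> E" "L d \<in> U" using U by auto
  have "L e \<in> U" if "e \<in> E" for e
    using that d(1,2) by (induction rule: knot_traversal) (use U step in auto)
  then show "U = L ` E" using U(1) by auto
qed

lemma face_induct [consumes 2, case_names start step]:
  assumes e: "e \<in> E" and d: "d \<in> E" and P: "P (L d)"
    and step: "\<And>c. c \<in> E \<Longrightarrow> P (L c) \<Longrightarrow> P (L (\<iota> c))"
  shows "P (L e)"
proof -
  have "{y \<in> L ` E. P y} = L ` E"
    using faces_connected d P step unfolding edge_connected_def
    by (elim allE[of _ "{y \<in> L ` E. P y}"]) auto
  then show ?thesis using e by blast
qed

lemma card_E: "card E = 4 * card (crossings D)"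
proof -
  have "card E = (\<Sum>x\<in>V ` E. card {d \<in> E. V d = x})"
    using sum.image_gen[OF finite_E, of "\<lambda>_. 1::nat" V] by simp
  also have "\<dots> = (\<Sum>x\<in>V ` E. 4)"
  proof (intro sum.cong refl)
    fix x assume "x \<in> V ` E"
    then obtain d where "d \<in> E" "x = V d" by auto
    then show "card {d \<in> E. V d = x} = 4" using card_V V_eq_Collect[of d] by simp
  qed
  finally show ?thesis by (simp add: crossings_eq)
qed

lemma card_edges: "2 * card (edges D) = card E"
proof -
  have ed: "edges D = (\<lambda>d. {d, \<iota> d}) ` E" by (auto simp: edges_def)
  have "card E = (\<Sum>x\<in>(\<lambda>d. {d, \<iota> d}) ` E. card {d \<in> E. {d, \<iota> d} = x})"
    using sum.image_gen[OF finite_E, of "\<lambda>_. 1::nat" "\<lambda>d. {d, \<iota> d}"] by simp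
  also have "\<dots> = (\<Sum>x\<in>(\<lambda>d. {d, \<iota> d}) ` E. 2)"
  proof (intro sum.cong refl)
    fix x assume "x \<in> (\<lambda>d. {d, \<iota> d}) ` E"
    then obtain e where e: "e \<in> E" "x = {e, \<iota> e}" by auto
    then have "{d \<in> E. {d, \<iota> d} = x} = {e, \<iota> e}" by (auto simp: doubleton_eq_iff)
    then show "card {d \<in> E. {d, \<iota> d} = x} = 2" using \<iota>_neq[OF e(1)] by simp
  qed
  finally show ?thesis by (simp add: ed)
qed

lemma euler: "card (crossings D) + card (faces D) = card (edges D) + 2"
  using knot four_valent by (simp add: knot_diagram_def)

lemma card_faces: "card (faces D) = card (crossings D) + 2"
  using euler card_edges card_E by simp

lemma closed_form_exact:
  fixes q :: "'d \<Rightarrow> 'a::ab_group_add"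
  assumes "\<And>d. d \<in> E \<Longrightarrow> q (\<iota> d) = - q d" "\<And>d. d \<in> E \<Longrightarrow> (\<Sum>e\<in>L d. q e) = 0"
  shows "\<exists>h. \<forall>d\<in>E. q d = h (V d) - h (V (\<iota> d))"
proof (rule closed_form_is_exact[of E \<iota> \<phi> L V q])
  show "bij_betw \<phi> E E" using \<phi>_permutes by (rule permutes_imp_bij)
  show "2 * (card (V ` E) + card (L ` E)) = card E + 4"
    using euler card_edges crossings_eq faces_eq by simp
  show "(\<Sum>e\<in>{e \<in> E. L e = L d}. q e) = 0" if "d \<in> E" for d
    using assms(2)[OF that] L_eq_Collect[OF that] by simp
qed (use finite_E E_nonempty vertices_connected faces_connected V_\<phi> assms in auto)

text \<open>
  Summing around the four darts of a crossing from an arbitrary first one.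
\<close>

lemma vertex_primitive:
  fixes g :: "'d \<Rightarrow> 'a::ab_group_add"
  assumes "\<And>d. d \<in> E \<Longrightarrow> (\<Sum>e\<in>V d. g e) = 0"
  shows "\<exists>p. \<forall>d\<in>E. g d = p (r d) - p d"
proof -
  define p where "p = (\<lambda>d. let c = (SOME e. e \<in> V d) in
    if d = c then 0 else if d = r c then g c else if d = r (r c) then g c + g (r c)
    else g c + g (r c) + g (r (r c)))"
  have "g d = p (r d) - p d" if d: "d \<in> E" for d
  proof -
    define c where "c = (SOME e. e \<in> V d)"
    have cd: "c \<in> V d" unfolding c_def using self_in(1) by (rule someI)
    then have c: "c \<in> E" "V c = V d" using V_subset[OF d] in_V_iff by auto
    have pe: "p e = (if e = c then 0 else if e = r c then g c else if e = r (r c) then g c + g (r c)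
        else g c + g (r c) + g (r (r c)))" if "V e = V d" for e
      unfolding p_def Let_def that c_def[symmetric] ..
    have sum0: "g c + (g (r c) + (g (r (r c)) + g (r (r (r c))))) = 0"
      using assms[OF c(1)] sum_vertex[OF c(1), of g] by simp
    have "d \<in> {c, r c, r (r c), r (r (r c))}"
      using vertex_darts(1)[OF c(1)] c(2) self_in(1)[of d] by simp
    then show ?thesis
      using pe[of d] pe[of "r d"] vertex_darts(2,3)[OF c(1)] sum0
      by (auto simp: algebra_simps eq_neg_iff_add_eq_0)
  qed
  then show ?thesis by blast
qed

lemma sum_face_shift:
  fixes p :: "'d \<Rightarrow> 'a::ab_group_add"
  assumes "d \<in> E"
  shows "(\<Sum>e\<in>L d. p (\<iota> e)) = (\<Sum>e\<in>L d. p (r e))"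
proof -
  have "inj_on \<phi> (L d)" using \<phi>_permutes by (metis inj_on_subset permutes_inj subset_UNIV)
  moreover have "\<phi> ` L d \<subseteq> L d" using in_L_iff by auto
  moreover have "finite (L d)" using L_subset[OF assms] finite_E by (rule finite_subset)
  ultimately have "bij_betw \<phi> (L d) (L d)" unfolding bij_betw_def using endo_inj_surj by blast
  from sum.reindex_bij_betw[OF this, of "\<lambda>e. p (r e)"] show ?thesis by simp
qed

text \<open>
  The quadrilaterals around the edges of the diagram tile the sphere, and their sides are the corners.
  The lemma says that a cycle formed by corners bounds a combination \<open>s\<close> of quadrilaterals.  A
  primitive \<open>p\<close> around each crossing fails to be defined on edges by a form that is closed, hence
  exact; its potential corrects \<open>p\<close>.
\<close>

lemma corner_form_exact:
  fixes g :: "'d \<Rightarrow> 'a::ab_group_add"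
  assumes V0: "\<And>d. d \<in> E \<Longrightarrow> (\<Sum>e\<in>V d. g e) = 0" and L0: "\<And>d. d \<in> E \<Longrightarrow> (\<Sum>e\<in>L d. g e) = 0"
  shows "\<exists>s. \<forall>d\<in>E. g d = s (r d) - s d \<and> s (\<iota> d) = s d"
proof -
  obtain p where p: "\<forall>d\<in>E. g d = p (r d) - p d" using vertex_primitive[of g, OF V0] ..
  define q where "q = (\<lambda>d. p d - p (\<iota> d))"
  have "(\<Sum>e\<in>L d. q e) = 0" if d: "d \<in> E" for d
  proof -
    have "(\<Sum>e\<in>L d. q e) = (\<Sum>e\<in>L d. p e) - (\<Sum>e\<in>L d. p (r e))"
      unfolding q_def sum_subtractf sum_face_shift[OF d, of p] ..
    also have "\<dots> = - (\<Sum>e\<in>L d. g e)"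
    proof -
      have "(\<Sum>e\<in>L d. g e) = (\<Sum>e\<in>L d. p (r e) - p e)"
        using p L_subset[OF d] by (intro sum.cong refl) blast
      then show ?thesis by (simp add: sum_subtractf)
    qed
    finally show ?thesis using L0[OF d] by simp
  qed
  moreover have "q (\<iota> d) = - q d" for d by (simp add: q_def)
  ultimately obtain h where h: "\<forall>d\<in>E. q d = h (V d) - h (V (\<iota> d))"
    using closed_form_exact[of q] by metis
  have "g d = (p (r d) - h (V (r d))) - (p d - h (V d)) \<and> p (\<iota> d) - h (V (\<iota> d)) = p d - h (V d)"
    if "d \<in> E" for d
  proof -
    have "p d - p (\<iota> d) = h (V d) - h (V (\<iota> d))" using h that by (simp add: q_def)
    then have "p (\<iota> d) - h (V (\<iota> d)) = p d - h (V d)" by (simp add: algebra_simps)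
    then show ?thesis using p that by simp
  qed
  then show ?thesis by (intro exI[of _ "\<lambda>d. p d - h (V d)"]) blast
qed

text \<open>
  The sign \<open>\<sigma>\<close> tells whether the face on the left is black.  The argument of \<open>corner_form_exact\<close>
  applies modulo \<open>2\<close>: alternate the signs around each crossing, and correct the disagreements along
  the edges by a potential.
\<close>

lemma checkerboard:
  "\<exists>\<sigma> :: 'd \<Rightarrow> int. \<forall>d\<in>E. \<sigma> d \<in> {1, -1} \<and> \<sigma> (r d) = - \<sigma> d \<and> \<sigma> (\<iota> d) = - \<sigma> d"
proof -
  have V0: "(\<Sum>e\<in>V d. 1 :: bit) = 0" if "d \<in> E" for d
    using sum_vertex[OF that, of "\<lambda>_. 1 :: bit"] by simp
  obtain p :: "'d \<Rightarrow> bit" where p: "\<forall>d\<in>E. 1 = p (r d) - p d"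
    using vertex_primitive[of "\<lambda>_. 1 :: bit", OF V0] ..
  have pr: "p (r d) = p d + 1" if "d \<in> E" for d
    using p that by (cases "p d"; cases "p (r d)") auto
  define q where "q = (\<lambda>d. p d + p (\<iota> d) + 1)"
  have "(\<Sum>e\<in>L d. q e) = 0" if d: "d \<in> E" for d
  proof -
    have "(\<Sum>e\<in>L d. q e) = (\<Sum>e\<in>L d. (p e + 1) + p (\<iota> e))"
      by (simp only: q_def add_ac)
    also have "\<dots> = (\<Sum>e\<in>L d. p e + 1) + (\<Sum>e\<in>L d. p (r e))"
      unfolding sum.distrib sum_face_shift[OF d, of p] ..
    also have "(\<Sum>e\<in>L d. p (r e)) = (\<Sum>e\<in>L d. p e + 1)"
      using pr L_subset[OF d] by (intro sum.cong refl) blast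
    also have "x + x = 0" for x :: bit by (cases x) simp_all
    finally show ?thesis .
  qed
  moreover have "q (\<iota> d) = - q d" if "d \<in> E" for d
  proof -
    have "q (\<iota> d) = q d" by (simp only: q_def \<iota>_\<iota> add.commute[of "p (\<iota> d)"])
    moreover have "x = - x" for x :: bit by (cases x) simp_all
    ultimately show ?thesis by metis
  qed
  ultimately obtain h where h: "\<forall>d\<in>E. q d = h (V d) - h (V (\<iota> d))"
    using closed_form_exact[of q] by metis
  \<comment> \<open>Subtraction and addition agree modulo \<open>2\<close>.\<close>
  define t where "t = (\<lambda>d. p d + h (V d))"
  have tr: "t (r d) = t d + 1" if "d \<in> E" for d using pr[OF that] by (simp only: t_def V_r add_ac)
  have ti: "t (\<iota> d) = t d + 1" if "d \<in> E" for d
    using h[rule_format, OF that]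
    by (cases "p d"; cases "p (\<iota> d)"; cases "h (V d)"; cases "h (V (\<iota> d))") (simp_all add: t_def q_def)
  have flip: "(if x + 1 = 0 then 1 else -1 :: int) = - (if x = 0 then 1 else -1)" for x :: bit
    by (cases x) simp_all
  show ?thesis
  proof (intro exI[of _ "\<lambda>d. if t d = 0 then 1 else -1"] ballI)
    fix d assume d: "d \<in> E"
    show "(if t d = 0 then 1 else -1 :: int) \<in> {1, -1} \<and>
        (if t (r d) = 0 then 1 else -1 :: int) = - (if t d = 0 then 1 else -1) \<and>
        (if t (\<iota> d) = 0 then 1 else -1 :: int) = - (if t d = 0 then 1 else -1)"
      unfolding tr[OF d] ti[OF d] flip by simp
  qed
qed

end

section \<open>Fox colorings and Dehn colorings\<close>

lemma linked_class_cong: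
  assumes "(a, b) \<in> R"
  shows "linked_class R a = linked_class R b"
proof -
  have ab: "(a, b) \<in> R \<union> R\<inverse>" "(b, a) \<in> R \<union> R\<inverse>" using assms by auto
  show ?thesis unfolding linked_class_def
    using converse_rtrancl_into_rtrancl[OF ab(1)] converse_rtrancl_into_rtrancl[OF ab(2)] by auto
qed

locale bot_diagram = knot_map D for D :: "'d diagram" +
  fixes f :: "'d set"
  assumes omissible: "omissible_face D f"
begin

lemma base_dart: obtains d0 where "d0 \<in> E" "L d0 = outer D" "L (\<iota> d0) = f" "f \<noteq> outer D"
  using omissible by (auto simp: omissible_face_def)

lemma L_in_faces [simp]: "d \<in> E \<Longrightarrow> L d \<in> faces D"
  by (simp add: faces_eq)

lemma finite_bot [simp]: "finite (bot_faces D f)"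
  by (simp add: bot_faces_def)

end

text \<open>
  \<open>w\<close> directs the over strand at each crossing.  The choice changes rows of the relation matrix by a
  sign; it has to be the one behind the given Dehn weighting.
\<close>

locale fox_setup = bot_diagram D f for D :: "'d diagram" and f :: "'d set" +
  fixes w :: "'d set \<Rightarrow> 'd"
  assumes w: "x \<in> crossings D \<Longrightarrow> w x \<in> x \<inter> over D"
begin

abbreviation A where "A \<equiv> arc_of D"

definition sides :: "'d \<Rightarrow> 'd set \<Rightarrow> int" where
  "sides d y = of_bool (L d = y) + of_bool (L (\<iota> d) = y)"

text \<open>
  The sum of the two faces beside the over strand after the crossing minus the sum before it, which
  is the Dehn relation of the crossing.
\<close>

definition dehn_rel :: "'d set \<Rightarrow> 'd set \<Rightarrow> int" where
  "dehn_rel x y = sides (w x) y - sides (r (r (w x))) y"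

text \<open>
  \<open>Y\<close> is either the set of all faces or the set of faces that are vertices of the graph.
\<close>

definition in_span :: "'d set set \<Rightarrow> ('d set \<Rightarrow> int) \<Rightarrow> bool" where
  "in_span Y t \<longleftrightarrow> (\<exists>n. \<forall>y\<in>Y. t y = (\<Sum>x\<in>crossings D. n x * dehn_rel x y))"

lemma w_in_E: "x \<in> crossings D \<Longrightarrow> w x \<in> E" and V_w: "x \<in> crossings D \<Longrightarrow> V (w x) = x"
  and w_over: "x \<in> crossings D \<Longrightarrow> w x \<in> over D"
proof -
  assume x: "x \<in> crossings D"
  then obtain d where "d \<in> E" "x = V d" by (auto simp: crossings_eq)
  then show "w x \<in> E" "V (w x) = x" using w[OF x] V_subset in_V_iff by auto
  show "w x \<in> over D" using w[OF x] by auto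
qed

lemma over_r: "d \<in> E \<Longrightarrow> r d \<in> over D \<longleftrightarrow> d \<notin> over D"
  using knot crossings_eq self_in(1)[of d] by (auto simp: knot_diagram_def)

lemma over_at_crossing:
  assumes "d \<in> E" "d \<in> over D"
  shows "d = w (V d) \<or> d = r (r (w (V d)))"
proof -
  have x: "V d \<in> crossings D" using assms crossings_eq by auto
  have "d \<in> V (w (V d))" using V_w[OF x] in_V_iff by simp
  then have "d \<in> {w (V d), r (w (V d)), r (r (w (V d))), r (r (r (w (V d))))}"
    using vertex_darts(1)[OF w_in_E[OF x]] by simp
  moreover have "r (w (V d)) \<notin> over D" "r (r (r (w (V d)))) \<notin> over D"
    using over_r w_over[OF x] w_in_E[OF x] by simp_all
  ultimately show ?thesis using assms(2) by auto
qed

lemma in_span_dehn_rel: "x \<in> crossings D \<Longrightarrow> in_span Y (dehn_rel x)"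
  unfolding in_span_def by (intro exI[of _ "\<lambda>z. of_bool (z = x)"]) (simp add: if_distrib cong: if_cong)

lemma in_span_zero: "in_span Y (\<lambda>y. 0)"
  unfolding in_span_def by (intro exI[of _ "\<lambda>z. 0"]) simp

lemma in_span_add: "in_span Y s \<Longrightarrow> in_span Y t \<Longrightarrow> in_span Y (\<lambda>y. s y + t y)"
  unfolding in_span_def
proof (elim exE)
  fix m n assume "\<forall>y\<in>Y. s y = (\<Sum>x\<in>crossings D. m x * dehn_rel x y)" "\<forall>y\<in>Y. t y = (\<Sum>x\<in>crossings D. n x * dehn_rel x y)"
  then show "\<exists>n. \<forall>y\<in>Y. s y + t y = (\<Sum>x\<in>crossings D. n x * dehn_rel x y)"
    by (intro exI[of _ "\<lambda>x. m x + n x"]) (simp add: sum.distrib algebra_simps)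
qed

lemma in_span_scale: "in_span Y s \<Longrightarrow> in_span Y (\<lambda>y. k * s y)"
  unfolding in_span_def
proof (elim exE)
  fix m assume "\<forall>y\<in>Y. s y = (\<Sum>x\<in>crossings D. m x * dehn_rel x y)"
  then show "\<exists>n. \<forall>y\<in>Y. k * s y = (\<Sum>x\<in>crossings D. n x * dehn_rel x y)"
    by (intro exI[of _ "\<lambda>x. k * m x"]) (simp add: sum_distrib_left algebra_simps)
qed

lemma in_span_minus: "in_span Y s \<Longrightarrow> in_span Y (\<lambda>y. - s y)"
  using in_span_scale[of Y s "-1"] by simp

lemma in_span_diff: "in_span Y s \<Longrightarrow> in_span Y t \<Longrightarrow> in_span Y (\<lambda>y. s y - t y)"
  using in_span_add[of Y s "\<lambda>y. - t y"] in_span_minus[of Y t] by simp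

lemma in_span_sum:
  assumes "\<And>i. i \<in> I \<Longrightarrow> in_span Y (s i)"
  shows "in_span Y (\<lambda>y. \<Sum>i\<in>I. s i y)"
  using assms by (induction I rule: infinite_finite_induct) (auto intro: in_span_zero in_span_add)

lemma in_span_cong: "in_span Y s \<Longrightarrow> (\<And>y. y \<in> Y \<Longrightarrow> s y = t y) \<Longrightarrow> in_span Y t"
  unfolding in_span_def by auto

lemma in_span_mono: "in_span Y s \<Longrightarrow> Z \<subseteq> Y \<Longrightarrow> in_span Z s"
  unfolding in_span_def by blast

lemma sides_\<iota> [simp]: "sides (\<iota> d) = sides d"
  by (auto simp: sides_def fun_eq_iff)

lemma L_corners:
  assumes "d \<in> E"
  shows "L (\<iota> d) = L (r (r (r d)))" "L (\<iota> (r (r (r d)))) = L (r (r d))"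
  using L_rot_back[of d] rot_back_eq[OF assms] by simp_all

text \<open>
  Both sums run over the four faces around the crossing.
\<close>

lemma sides_opposite:
  assumes "d \<in> E"
  shows "sides (r d) y + sides (r (r (r d))) y = sides d y + sides (r (r d)) y"
  using L_corners[OF assms] by (simp add: sides_def)

lemma in_span_over:
  assumes "d \<in> E" "d \<in> over D"
  shows "in_span Y (\<lambda>y. sides d y - sides (r (r d)) y)"
proof -
  have x: "V d \<in> crossings D" using assms crossings_eq by auto
  from over_at_crossing[OF assms] show ?thesis
  proof
    assume "d = w (V d)"
    then have "(\<lambda>y. sides d y - sides (r (r d)) y) = dehn_rel (V d)"
      by (auto simp: dehn_rel_def)
    then show ?thesis using in_span_dehn_rel[OF x] by simp
  next
    assume d: "d = r (r (w (V d)))"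
    then have "r (r d) = w (V d)" using vertex_darts(2)[OF w_in_E[OF x]] by metis
    then have "(\<lambda>y. sides d y - sides (r (r d)) y) = (\<lambda>y. - dehn_rel (V d) y)"
      using d by (auto simp: dehn_rel_def)
    then show ?thesis using in_span_minus[OF in_span_dehn_rel[OF x]] by simp
  qed
qed

lemma A_\<iota> [simp]: "d \<in> E \<Longrightarrow> A (\<iota> d) = A d"
  unfolding arc_of_def by (rule sym, rule linked_class_cong) auto

lemma A_straight:
  assumes "d \<in> E" "d \<in> over D"
  shows "A (r (r d)) = A d"
proof -
  have "\<exists>x\<in>crossings D. d \<in> x \<inter> over D"
    using assms by (intro bexI[of _ "V d"]) (auto simp: crossings_eq)
  then show ?thesis unfolding arc_of_def by (intro sym[OF linked_class_cong]) (auto simp: straight_eq)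
qed

lemma in_span_same_arc:
  assumes "d \<in> E" "A d = A e"
  shows "in_span Y (\<lambda>y. sides d y - sides e y)"
proof -
  let ?R = "{(d, \<iota> d) | d. d \<in> E} \<union> {(d, straight D d) | d. \<exists>x\<in>crossings D. d \<in> x \<inter> over D}"
  have "e \<in> A e" by (simp add: arc_of_def linked_class_def)
  then have "e \<in> A d" using assms(2) by simp
  then have "(d, e) \<in> (?R \<union> ?R\<inverse>)\<^sup>*" unfolding arc_of_def linked_class_def by (rule ImageE) blast
  then have "e \<in> E \<and> in_span Y (\<lambda>y. sides d y - sides e y)"
  proof induction
    case base then show ?case using assms in_span_zero by simp
  next
    case (step b c)
    have sub: "x \<subseteq> E" if "x \<in> crossings D" for x using that V_subset by (auto simp: crossings_eq)
    from step(2) consider "c = \<iota> b" | "b = \<iota> c" | "b \<in> E" "b \<in> over D" "c = r (r b)"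
      | "c \<in> E" "c \<in> over D" "b = r (r c)"
      using sub by (auto simp: straight_eq)
    then show ?case
    proof cases
      case 1 then show ?thesis using step by simp
    next
      case 2 then show ?thesis using step by simp
    next
      case 3
      from in_span_add[OF _ in_span_over[OF 3(1,2)], of Y] step(3) 3 show ?thesis by fastforce
    next
      case 4
      from in_span_diff[OF _ in_span_over[OF 4(1,2)], of Y] step(3) 4 show ?thesis by fastforce
    qed
  qed
  then show ?thesis ..
qed

text \<open>
  The faces beside an arc change along the arc, but only by Dehn relations, so any dart will do.
\<close>

definition rep :: "'d set \<Rightarrow> 'd" where
  "rep a = (SOME d. d \<in> E \<and> A d = a)"

lemma rep: assumes "a \<in> arcs D" shows "rep a \<in> E" "A (rep a) = a"
proof -
  have "\<exists>d. d \<in> E \<and> A d = a" using assms by (auto simp: arcs_def)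
  from someI_ex[OF this] show "rep a \<in> E" "A (rep a) = a" by (auto simp: rep_def)
qed

lemma finite_arcs [simp]: "finite (arcs D)" using finite_E by (simp add: arcs_def)

lemma A_in_arcs [simp]: "d \<in> E \<Longrightarrow> A d \<in> arcs D" by (simp add: arcs_def)

definition face_sum :: "('d set \<Rightarrow>\<^sub>0 int) \<Rightarrow> 'd set \<Rightarrow> int" where
  "face_sum v y = (\<Sum>a\<in>arcs D. Poly_Mapping.lookup v a * sides (rep a) y)"

definition deg :: "('d set \<Rightarrow>\<^sub>0 int) \<Rightarrow> int" where
  "deg v = (\<Sum>a\<in>arcs D. Poly_Mapping.lookup v a)"

lemma face_sum_simps [simp]:
  "face_sum 0 y = 0" "face_sum (u + v) y = face_sum u y + face_sum v y"
  "face_sum (- v) y = - face_sum v y" "face_sum (u - v) y = face_sum u y - face_sum v y"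
  "face_sum (frag_cmul k v) y = k * face_sum v y"
  by (simp_all add: face_sum_def lookup_add lookup_minus algebra_simps sum.distrib sum_negf
      sum_subtractf sum_distrib_left)

lemma deg_simps [simp]:
  "deg 0 = 0" "deg (u + v) = deg u + deg v"
  "deg (- v) = - deg v" "deg (u - v) = deg u - deg v"
  "deg (frag_cmul k v) = k * deg v"
  by (simp_all add: deg_def lookup_add lookup_minus sum.distrib sum_negf sum_subtractf sum_distrib_left)

lemma face_sum_sum: "face_sum (\<Sum>i\<in>I. u i) y = (\<Sum>i\<in>I. face_sum (u i) y)"
  by (induction I rule: infinite_finite_induct) auto

lemma face_sum_frag_of: "a \<in> arcs D \<Longrightarrow> face_sum (frag_of a) y = sides (rep a) y"
  by (simp add: face_sum_def if_distrib[of "\<lambda>x. x * _"] cong: if_cong)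

lemma deg_frag_of: "a \<in> arcs D \<Longrightarrow> deg (frag_of a) = 1"
  by (simp add: deg_def)

lemma in_span_arc: "d \<in> E \<Longrightarrow> in_span Y (\<lambda>y. face_sum (frag_of (A d)) y - sides d y)"
  using in_span_same_arc[of "rep (A d)" d] rep[of "A d"] by (simp add: face_sum_frag_of)

definition fox_rel :: "'d \<Rightarrow> 'd set \<Rightarrow>\<^sub>0 int" where
  "fox_rel d = frag_cmul 2 (frag_of (A d)) - frag_of (A (r d)) - frag_of (A (rot_back D d))"

lemma fox_relations_eq: "fox_relations D = fox_rel ` {d \<in> E. d \<in> over D}"
proof -
  have "(\<exists>x\<in>crossings D. d \<in> x \<inter> over D) \<longleftrightarrow> d \<in> E \<and> d \<in> over D" for d
  proof
    assume "\<exists>x\<in>crossings D. d \<in> x \<inter> over D"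
    then obtain e where "e \<in> E" "d \<in> V e" "d \<in> over D" by (auto simp: crossings_eq)
    then show "d \<in> E \<and> d \<in> over D" using V_subset by blast
  next
    assume "d \<in> E \<and> d \<in> over D"
    then show "\<exists>x\<in>crossings D. d \<in> x \<inter> over D"
      by (intro bexI[of _ "V d"]) (auto simp: crossings_eq)
  qed
  then have "fox_relations D = {fox_rel d | d. d \<in> E \<and> d \<in> over D}"
    unfolding fox_relations_def fox_rel_def by simp
  then show ?thesis by auto
qed

lemma keys_fox_rel:
  assumes "d \<in> E"
  shows "Poly_Mapping.keys (fox_rel d) \<subseteq> arcs D"
proof -
  have "Poly_Mapping.lookup (fox_rel d) a = 0" if "a \<notin> arcs D" for a
  proof -
    have "a \<noteq> A d" "a \<noteq> A (r d)" "a \<noteq> A (rot_back D d)"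
      using that A_in_arcs assms in_E_iff(1) rot_back_in_E(1) by blast+
    then show ?thesis unfolding fox_rel_def lookup_minus lookup_frag_cmul lookup_frag_of by simp
  qed
  then show ?thesis using in_keys_iff by blast
qed

lemma deg_fox_rel: "d \<in> E \<Longrightarrow> deg (fox_rel d) = 0"
  by (simp add: fox_rel_def deg_frag_of)

text \<open>
  The two under strands together are beside the same four faces as the two halves of the over strand, so
  up to Dehn relations the image of the Fox relation is the difference of these halves.
\<close>

lemma in_span_fox_rel:
  assumes "d \<in> E" "d \<in> over D"
  shows "in_span Y (face_sum (fox_rel d))"
proof -
  let ?a = "\<lambda>d y. face_sum (frag_of (A d)) y - sides d y"
  have "in_span Y (\<lambda>y. 2 * ?a d y - ?a (r d) y - ?a (r (r (r d))) y + (sides d y - sides (r (r d)) y))"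
    using in_span_add[OF in_span_diff[OF in_span_diff[OF in_span_scale[OF in_span_arc[of d], where k = 2]
      in_span_arc[of "r d"]] in_span_arc[of "r (r (r d))"]] in_span_over[of d]] assms by simp
  then show ?thesis
  proof (rule in_span_cong)
    fix y
    show "2 * ?a d y - ?a (r d) y - ?a (r (r (r d))) y + (sides d y - sides (r (r d)) y) = face_sum (fox_rel d) y"
      using sides_opposite[OF assms(1), of y] by (simp add: fox_rel_def rot_back_eq[OF assms(1)])
  qed
qed

abbreviation FA where "FA \<equiv> free_Abelian_group (arcs D)"

definition R where "R = generate FA (fox_relations D)"

lemma fox_relations_subset: "fox_relations D \<subseteq> carrier FA"
  using keys_fox_rel by (auto simp: fox_relations_eq)

lemma R_subgroup: "subgroup R FA"
  unfolding R_def by (rule group.generate_is_subgroup[OF group_free_Abelian_group fox_relations_subset])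

lemma R_keys: "v \<in> R \<Longrightarrow> Poly_Mapping.keys v \<subseteq> arcs D"
  using subsetD[OF subgroup.subset[OF R_subgroup]] by (simp only: carrier_free_Abelian_group_iff)

lemma R_add: "u \<in> R \<Longrightarrow> v \<in> R \<Longrightarrow> u + v \<in> R"
  using subgroup.m_closed[OF R_subgroup] by simp

lemma R_zero: "0 \<in> R"
  using subgroup.one_closed[OF R_subgroup] by simp

lemma R_minus: "v \<in> R \<Longrightarrow> - v \<in> R"
  using subgroup.m_inv_closed[OF R_subgroup, of v] R_keys[of v] by simp

lemma R_cmul: assumes "v \<in> R" shows "frag_cmul k v \<in> R"
proof -
  have nat: "frag_cmul (int n) v \<in> R" for n
    by (induction n) (use assms R_add R_zero in \<open>auto simp: frag_cmul_distrib\<close>)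
  show ?thesis
  proof (cases "k \<ge> 0")
    case True then show ?thesis using nat[of "nat k"] by simp
  next
    case False
    then have "frag_cmul k v = - frag_cmul (int (nat (- k))) v" by simp
    then show ?thesis using R_minus[OF nat] by metis
  qed
qed

lemma R_sum: "(\<And>i. i \<in> I \<Longrightarrow> u i \<in> R) \<Longrightarrow> (\<Sum>i\<in>I. u i) \<in> R"
  by (induction I rule: infinite_finite_induct) (auto intro: R_zero R_add)

lemma R_fox_rel: "d \<in> E \<Longrightarrow> d \<in> over D \<Longrightarrow> fox_rel d \<in> R"
  unfolding R_def by (rule generate.incl) (auto simp: fox_relations_eq)

lemma R_imp_span: "v \<in> R \<Longrightarrow> in_span Y (face_sum v) \<and> deg v = 0"
  unfolding R_def
proof (induction rule: generate.induct)
  case one then show ?case using in_span_zero by simp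
next
  case (incl h) then show ?case using in_span_fox_rel deg_fox_rel by (auto simp: fox_relations_eq)
next
  case (inv h)
  then have "Poly_Mapping.keys h \<subseteq> arcs D"
    using subsetD[OF fox_relations_subset] by (simp only: carrier_free_Abelian_group_iff)
  moreover have "in_span Y (face_sum h)" "deg h = 0"
    using inv in_span_fox_rel deg_fox_rel by (auto simp: fox_relations_eq)
  ultimately show ?case using in_span_minus[of Y "face_sum h"] by (simp add: face_sum_simps(3)[abs_def])
next
  case (eng h1 h2)
  then show ?case using in_span_add[of Y "face_sum h1" "face_sum h2"] by (simp add: face_sum_simps(2)[abs_def])
qed

end

lemma sum_of_bool_mult:
  fixes G :: "'b \<Rightarrow> int"
  assumes "finite S" "z \<in> S"
  shows "(\<Sum>y\<in>S. of_bool (z = y) * G y) = G z"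
proof -
  have "(\<Sum>y\<in>S. of_bool (z = y) * G y) = (\<Sum>y\<in>S. if z = y then G y else 0)"
    by (intro sum.cong) auto
  then show ?thesis using assms by simp
qed

context knot_map begin

lemma sum_flip: "(\<Sum>d\<in>E. g (\<iota> d)) = (\<Sum>d\<in>E. g d)"
  using sum.reindex_bij_betw[OF permutes_imp_bij[OF \<iota>_permutes], of g] .

lemma sum_face_eq:
  fixes g :: "'d \<Rightarrow> int"
  assumes "d \<in> E"
  shows "(\<Sum>e\<in>L d. g e) = (\<Sum>e\<in>E. of_bool (L e = L d) * g e)"
proof -
  have "(\<Sum>e\<in>L d. g e) = (\<Sum>e\<in>E \<inter> {e. L e = L d}. g e)"
    using L_eq_Collect[OF assms] by (intro sum.cong) auto
  also have "\<dots> = (\<Sum>e\<in>E. if e \<in> {e. L e = L d} then g e else 0)"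
    using finite_E by (rule sum.inter_restrict)
  finally show ?thesis by (simp add: of_bool_def if_distrib[of "\<lambda>x. x * _"] cong: if_cong)
qed

lemma sum_by_crossing:
  fixes g :: "'d \<Rightarrow> int"
  shows "(\<Sum>d\<in>E. g d) = (\<Sum>x\<in>crossings D. \<Sum>d\<in>x. g d)"
proof -
  have "(\<Sum>d\<in>E. g d) = (\<Sum>x\<in>V ` E. \<Sum>d\<in>{d \<in> E. V d = x}. g d)"
    using sum.image_gen[OF finite_E] .
  also have "\<dots> = (\<Sum>x\<in>V ` E. \<Sum>d\<in>x. g d)"
    using V_eq_Collect by (intro sum.cong) auto
  finally show ?thesis by (simp add: crossings_eq)
qed

lemma two_colouring_faces:
  fixes \<sigma> :: "'d \<Rightarrow> int"
  assumes \<sigma>: "\<forall>d\<in>E. \<sigma> d \<in> {1, -1} \<and> \<sigma> (r d) = - \<sigma> d \<and> \<sigma> (\<iota> d) = - \<sigma> d"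
    and "d \<in> E" "e \<in> L d"
  shows "\<sigma> e = \<sigma> d"
proof -
  have step: "\<sigma> (\<phi> c) = \<sigma> c" if "c \<in> E" for c
  proof -
    have "\<sigma> (\<iota> c) = - \<sigma> (\<phi> c)" "\<sigma> (\<iota> c) = - \<sigma> c"
      using bspec[OF \<sigma>, of "\<phi> c"] bspec[OF \<sigma>, of c] that by simp_all
    then show ?thesis by simp
  qed
  have "e \<in> orbit \<phi> d" using assms(3) by (simp add: face_left_def)
  then have "e \<in> E \<and> \<sigma> e = \<sigma> d"
    by induction (use assms(2) step in auto)
  then show ?thesis ..
qed

end

context fox_setup begin

text \<open>
  A vector in the image of degree \<open>0\<close> has total \<open>0\<close> on the black faces and on the white faces, since
  every edge has one face of each color beside it, and so do the Dehn relations.  The two omitted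
  faces have different colors, so their coordinates are determined by the others.
\<close>

lemma span_extends_to_omitted_faces:
  assumes n: "\<And>y. y \<in> bot_faces D f \<Longrightarrow> face_sum v y = (\<Sum>x\<in>crossings D. n x * dehn_rel x y)"
    and deg0: "deg v = 0" and y: "y \<in> faces D"
  shows "face_sum v y = (\<Sum>x\<in>crossings D. n x * dehn_rel x y)"
proof -
  obtain \<sigma> :: "'d \<Rightarrow> int" where \<sigma>: "\<forall>d\<in>E. \<sigma> d \<in> {1, -1} \<and> \<sigma> (r d) = - \<sigma> d \<and> \<sigma> (\<iota> d) = - \<sigma> d"
    using checkerboard ..
  define col where "col = (\<lambda>y. \<sigma> (SOME d. d \<in> E \<and> L d = y))"
  have col: "col (L d) = \<sigma> d" if "d \<in> E" for d
  proof -
    have "\<exists>e. e \<in> E \<and> L e = L d" using that by blast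
    from someI_ex[OF this] have "(SOME e. e \<in> E \<and> L e = L d) \<in> L d" using in_L_iff by blast
    then show ?thesis unfolding col_def using two_colouring_faces[OF \<sigma> that] by blast
  qed
  define t where "t = (\<lambda>y. face_sum v y - (\<Sum>x\<in>crossings D. n x * dehn_rel x y))"
  have sides_one: "(\<Sum>y\<in>faces D. of_bool (col y = c) * sides d y) = 1" if d: "d \<in> E" and c: "c \<in> {1, -1}" for d c
  proof -
    have "(\<Sum>y\<in>faces D. of_bool (col y = c) * sides d y)
        = (\<Sum>y\<in>faces D. of_bool (L d = y) * of_bool (col y = c)) + (\<Sum>y\<in>faces D. of_bool (L (\<iota> d) = y) * of_bool (col y = c))"
      by (simp add: sides_def algebra_simps sum.distrib)
    also have "\<dots> = of_bool (col (L d) = c) + of_bool (col (L (\<iota> d)) = c)"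
      using d by (simp only: sum_of_bool_mult finite_faces L_in_faces in_E_iff)
    also have "\<dots> = 1"
    proof -
      have "col (L d) = \<sigma> d" "col (L (\<iota> d)) = - \<sigma> d" "\<sigma> d \<in> {1, -1}"
        using col d \<sigma> in_E_iff by metis+
      then show ?thesis using c by auto
    qed
    finally show ?thesis .
  qed
  have rel0: "(\<Sum>y\<in>faces D. of_bool (col y = c) * dehn_rel x y) = 0" if "x \<in> crossings D" "c \<in> {1, -1}" for x c
    using sides_one[of "w x" c] sides_one[of "r (r (w x))" c] w_in_E[OF that(1)] that(2)
    by (simp add: dehn_rel_def right_diff_distrib sum_subtractf)
  have sum_t: "(\<Sum>y\<in>faces D. of_bool (col y = c) * t y) = 0" if c: "c \<in> {1, -1}" for c
  proof -
    have "(\<Sum>y\<in>faces D. of_bool (col y = c) * face_sum v y)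
        = (\<Sum>y\<in>faces D. \<Sum>a\<in>arcs D. Poly_Mapping.lookup v a * (of_bool (col y = c) * sides (rep a) y))"
      by (simp add: face_sum_def sum_distrib_left mult.left_commute)
    also have "\<dots> = (\<Sum>a\<in>arcs D. \<Sum>y\<in>faces D. Poly_Mapping.lookup v a * (of_bool (col y = c) * sides (rep a) y))"
      by (rule sum.swap)
    also have "\<dots> = (\<Sum>a\<in>arcs D. Poly_Mapping.lookup v a * 1)"
      using sides_one[OF rep(1) c] by (simp only: sum_distrib_left[symmetric] cong: sum.cong)
    also have "\<dots> = 0" using deg0 by (simp add: deg_def)
    finally have 1: "(\<Sum>y\<in>faces D. of_bool (col y = c) * face_sum v y) = 0" .
    have "(\<Sum>y\<in>faces D. of_bool (col y = c) * (\<Sum>x\<in>crossings D. n x * dehn_rel x y))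
        = (\<Sum>y\<in>faces D. \<Sum>x\<in>crossings D. n x * (of_bool (col y = c) * dehn_rel x y))"
      by (simp add: sum_distrib_left mult.left_commute)
    also have "\<dots> = (\<Sum>x\<in>crossings D. \<Sum>y\<in>faces D. n x * (of_bool (col y = c) * dehn_rel x y))"
      by (rule sum.swap)
    also have "\<dots> = (\<Sum>x\<in>crossings D. n x * 0)"
      using rel0[OF _ c] by (simp only: sum_distrib_left[symmetric] cong: sum.cong)
    finally show ?thesis using 1 by (simp add: t_def right_diff_distrib sum_subtractf)
  qed
  obtain d0 where d0: "d0 \<in> E" "L d0 = outer D" "L (\<iota> d0) = f" "f \<noteq> outer D" by (rule base_dart)
  have cols: "col (outer D) \<in> {1, -1}" "col f = - col (outer D)"
    using col[of d0] col[of "\<iota> d0"] d0 \<sigma> by auto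
  have bot: "t z = 0" if "z \<in> faces D" "z \<noteq> outer D" "z \<noteq> f" for z
    using n that by (simp add: bot_faces_def t_def)
  have "t y = 0"
  proof (cases "y = outer D \<or> y = f")
    case True
    then have c: "col y \<in> {1, -1}" using cols by auto
    have "(\<Sum>z\<in>faces D. of_bool (col z = col y) * t z) = (\<Sum>z\<in>{y}. of_bool (col z = col y) * t z)"
    proof (rule sum.mono_neutral_right)
      show "\<forall>z\<in>faces D - {y}. of_bool (col z = col y) * t z = 0"
      proof
        fix z assume z: "z \<in> faces D - {y}"
        show "of_bool (col z = col y) * t z = 0"
        proof (cases "z = outer D \<or> z = f")
          case True
          then have "col z = - col y" using z \<open>y = outer D \<or> y = f\<close> cols by auto
          then show ?thesis using c by auto
        next
          case False
          then show ?thesis using bot[of z] z by simp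
        qed
      qed
    qed (use y in auto)
    then show ?thesis using sum_t[OF c] by simp
  next
    case False
    then show ?thesis using bot y by blast
  qed
  then show ?thesis by (simp add: t_def)
qed

text \<open>
  Lift \<open>v\<close> and the Dehn relations to a weight \<open>W\<close> on the darts whose sum around every face is \<open>0\<close>.  With
  the checkerboard signs the weight on the edges is a closed form, hence the coboundary of some \<open>h\<close> on
  the crossings.  Collecting the terms at each crossing \<open>x\<close>, the alternating sum of the four arcs
  around \<open>x\<close> is the Fox relation, so \<open>v\<close> is the combination of Fox relations with coefficients
  \<open>\<sigma> (w x) * h x\<close>.
\<close>

lemma face_relation_imp_R:
  assumes n: "\<And>y. y \<in> faces D \<Longrightarrow> face_sum v y = (\<Sum>x\<in>crossings D. n x * dehn_rel x y)"
    and keys: "Poly_Mapping.keys v \<subseteq> arcs D"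
  shows "v \<in> R"
proof -
  obtain \<sigma> :: "'d \<Rightarrow> int" where \<sigma>: "\<forall>d\<in>E. \<sigma> d \<in> {1, -1} \<and> \<sigma> (r d) = - \<sigma> d \<and> \<sigma> (\<iota> d) = - \<sigma> d"
    using checkerboard ..
  have \<sigma>2: "\<sigma> d * (\<sigma> d * k) = k" if "d \<in> E" for d k using \<sigma> that by (cases "\<sigma> d = 1") auto
  let ?l = "Poly_Mapping.lookup v"
  define W where "W = (\<lambda>d. (\<Sum>a\<in>arcs D. ?l a * of_bool (rep a = d))
    - (\<Sum>x\<in>crossings D. n x * (of_bool (w x = d) - of_bool (r (r (w x)) = d))))"
  have W: "(\<Sum>d\<in>E. W d * G d) = (\<Sum>a\<in>arcs D. ?l a * G (rep a))
      - (\<Sum>x\<in>crossings D. n x * (G (w x) - G (r (r (w x)))))" for G :: "'d \<Rightarrow> int"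
  proof -
    have "(\<Sum>d\<in>E. W d * G d) = (\<Sum>d\<in>E. \<Sum>a\<in>arcs D. ?l a * (of_bool (rep a = d) * G d))
        - (\<Sum>d\<in>E. \<Sum>x\<in>crossings D. n x * (of_bool (w x = d) * G d - of_bool (r (r (w x)) = d) * G d))"
      unfolding W_def left_diff_distrib sum_distrib_right sum_subtractf mult.assoc ..
    also have "(\<Sum>d\<in>E. \<Sum>a\<in>arcs D. ?l a * (of_bool (rep a = d) * G d)) = (\<Sum>a\<in>arcs D. \<Sum>d\<in>E. ?l a * (of_bool (rep a = d) * G d))"
      by (rule sum.swap)
    also have "\<dots> = (\<Sum>a\<in>arcs D. ?l a * G (rep a))"
      using sum_of_bool_mult[OF finite_E rep(1), of _ G] by (simp only: sum_distrib_left[symmetric] cong: sum.cong)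
    also have "(\<Sum>d\<in>E. \<Sum>x\<in>crossings D. n x * (of_bool (w x = d) * G d - of_bool (r (r (w x)) = d) * G d))
        = (\<Sum>x\<in>crossings D. \<Sum>d\<in>E. n x * (of_bool (w x = d) * G d - of_bool (r (r (w x)) = d) * G d))"
      by (rule sum.swap)
    also have "\<dots> = (\<Sum>x\<in>crossings D. n x * (G (w x) - G (r (r (w x)))))"
    proof (intro sum.cong refl)
      fix x assume x: "x \<in> crossings D"
      have "r (r (w x)) \<in> E" using w_in_E[OF x] by simp
      then show "(\<Sum>d\<in>E. n x * (of_bool (w x = d) * G d - of_bool (r (r (w x)) = d) * G d)) = n x * (G (w x) - G (r (r (w x))))"
        using sum_of_bool_mult[OF finite_E w_in_E[OF x], of G] sum_of_bool_mult[OF finite_E, of "r (r (w x))" G]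
        by (simp only: sum_distrib_left[symmetric] sum_subtractf)
    qed
    finally show ?thesis .
  qed
  have face0: "(\<Sum>d\<in>E. W d * sides d y) = 0" if "y \<in> faces D" for y
    using W[of "\<lambda>d. sides d y"] n[OF that] by (simp add: face_sum_def dehn_rel_def)
  define u where "u = (\<lambda>d. W d + W (\<iota> d))"
  have u0: "(\<Sum>e\<in>L d. u e) = 0" if d: "d \<in> E" for d
  proof -
    have "(\<Sum>e\<in>L d. u e) = (\<Sum>e\<in>E. of_bool (L e = L d) * W e) + (\<Sum>e\<in>E. of_bool (L e = L d) * W (\<iota> e))"
      unfolding sum_face_eq[OF d] u_def distrib_left sum.distrib ..
    also have "(\<Sum>e\<in>E. of_bool (L e = L d) * W (\<iota> e)) = (\<Sum>e\<in>E. of_bool (L (\<iota> e) = L d) * W e)"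
      using sum_flip[of "\<lambda>e. of_bool (L (\<iota> e) = L d) * W e"] by simp
    also have "(\<Sum>e\<in>E. of_bool (L e = L d) * W e) + \<dots> = (\<Sum>e\<in>E. W e * sides e (L d))"
      unfolding sum.distrib[symmetric] sides_def by (intro sum.cong refl) (simp add: distrib_left mult.commute)
    finally show ?thesis using face0 d by simp
  qed
  define q where "q = (\<lambda>d. \<sigma> d * u d)"
  have "(\<Sum>e\<in>L d. q e) = 0" if d: "d \<in> E" for d
  proof -
    have "(\<Sum>e\<in>L d. q e) = (\<Sum>e\<in>L d. \<sigma> d * u e)"
    proof (intro sum.cong refl)
      fix e assume "e \<in> L d"
      from two_colouring_faces[OF \<sigma> d this] show "q e = \<sigma> d * u e" by (simp add: q_def)
    qed
    then show ?thesis using u0[OF d] by (simp add: sum_distrib_left[symmetric])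
  qed
  moreover have "q (\<iota> d) = - q d" if "d \<in> E" for d
    using \<sigma> that by (simp add: q_def u_def add.commute)
  ultimately obtain h where h: "\<forall>d\<in>E. q d = h (V d) - h (V (\<iota> d))"
    using closed_form_exact[of q] by metis
  \<comment> \<open>Summation by parts; both darts of an edge occur, hence the factor \<open>2\<close>.\<close>
  have key: "(\<Sum>d\<in>E. W d * G d) = (\<Sum>d\<in>E. \<sigma> d * h (V d) * G d)"
    if G: "\<And>d. d \<in> E \<Longrightarrow> G (\<iota> d) = G d" for G :: "'d \<Rightarrow> int"
  proof -
    have "(\<Sum>d\<in>E. W d * G d) = (\<Sum>d\<in>E. W (\<iota> d) * G d)"
      using sum_flip[of "\<lambda>d. W d * G d"] G by (simp cong: sum.cong)
    then have "2 * (\<Sum>d\<in>E. W d * G d) = (\<Sum>d\<in>E. u d * G d)"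
      by (simp add: u_def distrib_right sum.distrib)
    also have "\<dots> = (\<Sum>d\<in>E. \<sigma> d * h (V d) * G d - \<sigma> d * h (V (\<iota> d)) * G d)"
    proof (intro sum.cong refl)
      fix d assume d: "d \<in> E"
      have ueq: "u d = \<sigma> d * (h (V d) - h (V (\<iota> d)))"
        using \<sigma>2[OF d, of "u d"] bspec[OF h d] unfolding q_def by metis
      then show "u d * G d = \<sigma> d * h (V d) * G d - \<sigma> d * h (V (\<iota> d)) * G d"
        unfolding ueq by (simp add: algebra_simps)
    qed
    also have "\<dots> = (\<Sum>d\<in>E. \<sigma> d * h (V d) * G d) - (\<Sum>d\<in>E. \<sigma> d * h (V (\<iota> d)) * G d)"
      by (rule sum_subtractf)
    also have "(\<Sum>d\<in>E. \<sigma> d * h (V (\<iota> d)) * G d) = (\<Sum>d\<in>E. - (\<sigma> d * h (V d) * G d))"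
      using sum_flip[of "\<lambda>d. \<sigma> d * h (V (\<iota> d)) * G d"] \<sigma> G by (simp cong: sum.cong)
    finally show ?thesis by (simp add: sum_negf)
  qed
  have "v = (\<Sum>x\<in>crossings D. frag_cmul (\<sigma> (w x) * h x) (fox_rel (w x)))"
  proof (rule poly_mapping_eqI)
    fix b
    let ?G = "\<lambda>d. of_bool (A d = b) :: int"
    have "(\<Sum>d\<in>E. W d * ?G d) = (\<Sum>a\<in>arcs D. of_bool (b = a) * ?l a)"
    proof -
      have "(\<Sum>a\<in>arcs D. ?l a * ?G (rep a)) = (\<Sum>a\<in>arcs D. of_bool (b = a) * ?l a)"
        using rep(2) by (intro sum.cong) auto
      moreover have "(\<Sum>x\<in>crossings D. n x * (?G (w x) - ?G (r (r (w x))))) = 0"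
        using A_straight[OF w_in_E w_over] by (intro sum.neutral) simp
      ultimately show ?thesis using W[of ?G] by simp
    qed
    also have "\<dots> = ?l b"
    proof (cases "b \<in> arcs D")
      case True then show ?thesis by (rule sum_of_bool_mult[OF finite_arcs])
    next
      case False
      then have "?l b = 0" using keys by (meson in_keys_iff subsetD)
      moreover have "(\<Sum>a\<in>arcs D. of_bool (b = a) * ?l a) = 0" using False by (intro sum.neutral) auto
      ultimately show ?thesis by simp
    qed
    finally have "?l b = (\<Sum>d\<in>E. \<sigma> d * h (V d) * ?G d)" using key[of ?G] by simp
    also have "\<dots> = (\<Sum>x\<in>crossings D. \<Sum>d\<in>x. \<sigma> d * h (V d) * ?G d)" by (rule sum_by_crossing)
    also have "\<dots> = (\<Sum>x\<in>crossings D. Poly_Mapping.lookup (frag_cmul (\<sigma> (w x) * h x) (fox_rel (w x))) b)"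
    proof (intro sum.cong refl)
      fix x assume x: "x \<in> crossings D"
      define d where "d = w x"
      have d: "d \<in> E" "V d = x" "d \<in> over D" using w_in_E V_w w_over x by (simp_all add: d_def)
      have s: "\<sigma> (r d) = - \<sigma> d" "\<sigma> (r (r d)) = \<sigma> d" "\<sigma> (r (r (r d))) = - \<sigma> d"
        using \<sigma> d(1) by simp_all
      have "(\<Sum>e\<in>x. \<sigma> e * h (V e) * ?G e)
          = \<sigma> d * h x * (2 * ?G d - ?G (r d) - ?G (r (r (r d))))"
        using sum_vertex[OF d(1), of "\<lambda>e. \<sigma> e * h (V e) * ?G e"] A_straight[OF d(1,3)]
        by (simp add: s d(2) algebra_simps)
      also have "\<dots> = Poly_Mapping.lookup (frag_cmul (\<sigma> d * h x) (fox_rel d)) b"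
        by (simp add: fox_rel_def rot_back_eq[OF d(1)] lookup_minus of_bool_def eq_commute[of _ b])
      finally show "(\<Sum>e\<in>x. \<sigma> e * h (V e) * ?G e) = Poly_Mapping.lookup (frag_cmul (\<sigma> (w x) * h x) (fox_rel (w x))) b"
        by (simp add: d_def)
    qed
    finally show "?l b = Poly_Mapping.lookup (\<Sum>x\<in>crossings D. frag_cmul (\<sigma> (w x) * h x) (fox_rel (w x))) b"
      by (simp add: lookup_sum)
  qed
  also have "\<dots> \<in> R" by (intro R_sum R_cmul R_fox_rel w_in_E w_over)
  finally show ?thesis .
qed

lemma R_iff:
  assumes "Poly_Mapping.keys v \<subseteq> arcs D"
  shows "v \<in> R \<longleftrightarrow> deg v = 0 \<and> in_span (bot_faces D f) (face_sum v)"
proof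
  assume "v \<in> R" then show "deg v = 0 \<and> in_span (bot_faces D f) (face_sum v)"
    using R_imp_span by blast
next
  assume a: "deg v = 0 \<and> in_span (bot_faces D f) (face_sum v)"
  then obtain n where "\<forall>y\<in>bot_faces D f. face_sum v y = (\<Sum>x\<in>crossings D. n x * dehn_rel x y)"
    by (auto simp: in_span_def)
  then have "face_sum v y = (\<Sum>x\<in>crossings D. n x * dehn_rel x y)" if "y \<in> faces D" for y
    using span_extends_to_omitted_faces[of v n y] a that by blast
  then show "v \<in> R" using face_relation_imp_R[of v n] assms by blast
qed

lemma keys_diff_arcs: "Poly_Mapping.keys u \<subseteq> arcs D \<Longrightarrow> Poly_Mapping.keys v \<subseteq> arcs D \<Longrightarrow> Poly_Mapping.keys (u - v) \<subseteq> arcs D"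
  using keys_diff[of u v] by blast

lemma keys_cmul_arcs: "Poly_Mapping.keys u \<subseteq> arcs D \<Longrightarrow> Poly_Mapping.keys (frag_cmul k u) \<subseteq> arcs D"
  using keys_cmul[of k u] by blast

lemma keys_sum_arcs: "(\<And>i. i \<in> I \<Longrightarrow> Poly_Mapping.keys (u i) \<subseteq> arcs D) \<Longrightarrow> Poly_Mapping.keys (\<Sum>i\<in>I. u i) \<subseteq> arcs D"
  using keys_sum[of u I] by blast

text \<open>
  Walking from the outer face to \<open>y\<close>, each edge that is crossed expresses the next face by the
  previous one.
\<close>

lemma face_generator:
  assumes "y \<in> faces D"
  shows "\<exists>v k. Poly_Mapping.keys v \<subseteq> arcs D \<and>
    in_span (faces D) (\<lambda>z. face_sum v z + k * of_bool (z = outer D) - of_bool (z = y))"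
proof -
  obtain d0 where d0: "d0 \<in> E" "L d0 = outer D" by (rule base_dart)
  obtain e where e: "e \<in> E" "y = L e" using assms by (auto simp: faces_eq)
  show ?thesis unfolding e(2) using e(1) d0(1)
  proof (induction rule: face_induct)
    case start
    show ?case using in_span_zero[of "faces D"] d0(2)
      by (intro exI[of _ 0] exI[of _ 1]) simp
  next
    case (step c)
    then obtain v k where v: "Poly_Mapping.keys v \<subseteq> arcs D"
      "in_span (faces D) (\<lambda>z. face_sum v z + k * of_bool (z = outer D) - of_bool (z = L c))" by blast
    have "in_span (faces D) (\<lambda>z. (face_sum (frag_of (A c)) z - sides c z)
        - (face_sum v z + k * of_bool (z = outer D) - of_bool (z = L c)))"
      by (rule in_span_diff[OF in_span_arc[OF step(1)] v(2)])
    then have "in_span (faces D) (\<lambda>z. face_sum (frag_of (A c) - v) z + (- k) * of_bool (z = outer D) - of_bool (z = L (\<iota> c)))"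
      by (rule in_span_cong) (simp add: sides_def eq_commute[of "L _"])
    moreover have "Poly_Mapping.keys (frag_of (A c) - v) \<subseteq> arcs D"
      using v(1) step(1) by (intro keys_diff_arcs) auto
    ultimately show ?case by blast
  qed
qed

text \<open>
  The degree is corrected with the arc between the two omitted faces, which is invisible on the
  remaining ones.
\<close>

lemma face_sum_onto:
  "\<exists>v. Poly_Mapping.keys v \<subseteq> arcs D \<and> deg v = 0 \<and> in_span (bot_faces D f) (\<lambda>y. face_sum v y - t y)"
proof -
  let ?B = "bot_faces D f"
  have finB: "finite ?B" by (simp add: bot_faces_def)
  have "\<exists>v. Poly_Mapping.keys v \<subseteq> arcs D \<and> in_span ?B (\<lambda>z. face_sum v z - of_bool (z = y))" if y: "y \<in> ?B" for y
  proof -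
    obtain v k where v: "Poly_Mapping.keys v \<subseteq> arcs D"
      "in_span (faces D) (\<lambda>z. face_sum v z + k * of_bool (z = outer D) - of_bool (z = y))"
      using face_generator[of y] y by (auto simp: bot_faces_def)
    have "in_span ?B (\<lambda>z. face_sum v z + k * of_bool (z = outer D) - of_bool (z = y))"
      using in_span_mono[OF v(2), of ?B] by (simp add: bot_faces_def)
    then have "in_span ?B (\<lambda>z. face_sum v z - of_bool (z = y))"
      by (rule in_span_cong) (simp add: bot_faces_def)
    then show ?thesis using v(1) by blast
  qed
  then obtain g where g: "\<And>y. y \<in> ?B \<Longrightarrow> Poly_Mapping.keys (g y) \<subseteq> arcs D"
      "\<And>y. y \<in> ?B \<Longrightarrow> in_span ?B (\<lambda>z. face_sum (g y) z - of_bool (z = y))" by metis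
  obtain d0 where d0: "d0 \<in> E" "L d0 = outer D" "L (\<iota> d0) = f" by (rule base_dart)
  define u where "u = (\<Sum>y\<in>?B. frag_cmul (t y) (g y))"
  define v where "v = u - frag_cmul (deg u) (frag_of (A d0))"
  have ku: "Poly_Mapping.keys u \<subseteq> arcs D" unfolding u_def using g(1) by (intro keys_sum_arcs keys_cmul_arcs)
  have kv: "Poly_Mapping.keys v \<subseteq> arcs D" unfolding v_def using ku d0(1) by (intro keys_diff_arcs keys_cmul_arcs) auto
  have dv: "deg v = 0" using d0(1) by (simp add: v_def deg_frag_of)
  have "in_span ?B (\<lambda>z. (\<Sum>y\<in>?B. t y * (face_sum (g y) z - of_bool (z = y)))
      - deg u * (face_sum (frag_of (A d0)) z - sides d0 z))"
    by (rule in_span_diff[OF in_span_sum[OF in_span_scale[OF g(2)]] in_span_scale[OF in_span_arc[OF d0(1)]]])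
  then have "in_span ?B (\<lambda>y. face_sum v y - t y)"
  proof (rule in_span_cong)
    fix z assume z: "z \<in> ?B"
    have "sides d0 z = 0" using z d0 by (auto simp: sides_def bot_faces_def)
    moreover have "(\<Sum>y\<in>?B. t y * (face_sum (g y) z - of_bool (z = y)))
        = (\<Sum>y\<in>?B. t y * face_sum (g y) z) - (\<Sum>y\<in>?B. of_bool (z = y) * t y)"
      by (simp add: algebra_simps sum_subtractf)
    moreover have "(\<Sum>y\<in>?B. of_bool (z = y) * t y) = t z" using finB z by (rule sum_of_bool_mult)
    ultimately show "(\<Sum>y\<in>?B. t y * (face_sum (g y) z - of_bool (z = y)))
      - deg u * (face_sum (frag_of (A d0)) z - sides d0 z) = face_sum v z - t z"
      by (simp add: v_def u_def face_sum_sum)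
  qed
  then show ?thesis using kv dv by blast
qed

definition dehn_matrix :: "(nat \<Rightarrow> 'd set) \<Rightarrow> (nat \<Rightarrow> 'd set) \<Rightarrow> nat \<Rightarrow> nat \<Rightarrow> int" where
  "dehn_matrix xs ys i j = dehn_rel (xs i) (ys j)"

lemma in_row_span_dehn_matrix:
  assumes xs: "bij_betw xs {..<n} (crossings D)" and ys: "bij_betw ys {..<n} (bot_faces D f)"
  shows "in_row_span n (dehn_matrix xs ys) (\<lambda>j. t (ys j)) \<longleftrightarrow> in_span (bot_faces D f) t"
proof
  assume "in_span (bot_faces D f) t"
  then obtain m where m: "\<forall>y\<in>bot_faces D f. t y = (\<Sum>x\<in>crossings D. m x * dehn_rel x y)"
    by (auto simp: in_span_def)
  have "t (ys j) = (\<Sum>i<n. m (xs i) * dehn_matrix xs ys i j)" if "j < n" for j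
  proof -
    have "ys j \<in> bot_faces D f" using ys that by (auto simp: bij_betw_def)
    then show ?thesis
      using m sum.reindex_bij_betw[OF xs, of "\<lambda>x. m x * dehn_rel x (ys j)"] by (simp add: dehn_matrix_def)
  qed
  then show "in_row_span n (dehn_matrix xs ys) (\<lambda>j. t (ys j))"
    unfolding in_row_span_def by (intro exI[of _ "\<lambda>i. m (xs i)"]) blast
next
  assume "in_row_span n (dehn_matrix xs ys) (\<lambda>j. t (ys j))"
  then obtain c where c: "\<forall>j<n. t (ys j) = (\<Sum>i<n. c i * dehn_rel (xs i) (ys j))"
    by (auto simp: in_row_span_def dehn_matrix_def)
  define m where "m = (\<lambda>x. c (the_inv_into {..<n} xs x))"
  have mc: "m (xs i) = c i" if "i < n" for i
    using xs that by (simp add: m_def bij_betw_def the_inv_into_f_f)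
  have "t y = (\<Sum>x\<in>crossings D. m x * dehn_rel x y)" if y: "y \<in> bot_faces D f" for y
  proof -
    obtain j where j: "j < n" "y = ys j" using ys y by (auto simp: bij_betw_def)
    have "(\<Sum>x\<in>crossings D. m x * dehn_rel x y) = (\<Sum>i<n. m (xs i) * dehn_rel (xs i) y)"
      using sum.reindex_bij_betw[OF xs, of "\<lambda>x. m x * dehn_rel x y"] by simp
    also have "\<dots> = (\<Sum>i<n. c i * dehn_rel (xs i) y)" using mc by (intro sum.cong) auto
    finally show ?thesis using c j by simp
  qed
  then show "in_span (bot_faces D f) t" unfolding in_span_def by blast
qed

text \<open>
  Modulo \<open>2\<close> the sum \<open>e\<close> of the two faces beside an edge is unchanged at a crossing, on the over strand
  by the relation and then on the under strand because all four faces add up to \<open>0\<close>.  As the knot has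
  one component, \<open>e\<close> is constant, and it is \<open>0\<close> between the two omitted faces.  So adjacent faces have
  equal colors.
\<close>

lemma no_mod_2_colouring:
  fixes c :: "'d set \<Rightarrow> bit"
  assumes c: "\<And>x. x \<in> crossings D \<Longrightarrow> (\<Sum>y\<in>faces D. of_int (dehn_rel x y) * c y) = 0"
    and c0: "c (outer D) = 0" "c f = 0" and y: "y \<in> faces D"
  shows "c y = 0"
proof -
  obtain d0 where d0: "d0 \<in> E" "L d0 = outer D" "L (\<iota> d0) = f" by (rule base_dart)
  define e where "e = (\<lambda>d. c (L d) + c (L (\<iota> d)))"
  have bit2: "a - b = 0 \<longleftrightarrow> a = b" for a b :: bit by (cases a; cases b) simp_all
  have delta: "(\<Sum>y\<in>faces D. of_bool (z = y) * c y) = c z" if "z \<in> faces D" for z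
  proof -
    have "(\<Sum>y\<in>faces D. of_bool (z = y) * c y) = (\<Sum>y\<in>faces D. if z = y then c y else 0)"
      by (intro sum.cong refl) (simp only: of_bool_def if_distrib[of "\<lambda>x. x * _"] mult_1 mult_zero_left cong: if_cong)
    then show ?thesis using that by simp
  qed
  have sides_e: "(\<Sum>y\<in>faces D. of_int (sides d y) * c y) = e d" if d: "d \<in> E" for d
  proof -
    have "(\<Sum>y\<in>faces D. of_int (sides d y) * c y) = (\<Sum>y\<in>faces D. of_bool (L d = y) * c y + of_bool (L (\<iota> d) = y) * c y)"
      unfolding sides_def of_int_add of_int_of_bool distrib_right ..
    also have "\<dots> = e d" unfolding sum.distrib e_def using delta d by simp
    finally show ?thesis .
  qed
  have ew: "e (w x) = e (r (r (w x)))" if x: "x \<in> crossings D" for x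
  proof -
    have "0 = (\<Sum>y\<in>faces D. of_int (dehn_rel x y) * c y)" using c[OF x] by simp
    also have "\<dots> = (\<Sum>y\<in>faces D. of_int (sides (w x) y) * c y - of_int (sides (r (r (w x))) y) * c y)"
      unfolding dehn_rel_def of_int_diff left_diff_distrib ..
    also have "\<dots> = e (w x) - e (r (r (w x)))"
      unfolding sum_subtractf using sides_e w_in_E[OF x] by (simp only: in_E_iff)
    finally show ?thesis using bit2 by metis
  qed
  have over: "e (r (r d)) = e d" if d: "d \<in> E" "d \<in> over D" for d
  proof -
    have x: "V d \<in> crossings D" using d crossings_eq by auto
    have "r (r (r (r (w (V d))))) = w (V d)" using vertex_darts(2) w_in_E[OF x] by blast
    then show ?thesis using over_at_crossing[OF d] ew[OF x] by metis
  qed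
  have opp: "e (r d) + e (r (r (r d))) = e d + e (r (r d))" if "d \<in> E" for d
    using L_corners[OF that] by (simp only: e_def L_\<iota>_r add_ac)
  have opposite: "e (r (r d)) = e d" if d: "d \<in> E" for d
  proof (cases "d \<in> over D")
    case True then show ?thesis using over d by blast
  next
    case False
    then have "r d \<in> over D" using over_r[OF d] by simp
    then have "e (r (r (r d))) = e (r d)" using over d by simp
    then have "e d + e (r (r d)) = e (r d) + e (r d)" using opp[OF d] by simp
    also have "\<dots> = 0" by (cases "e (r d)") simp_all
    finally show ?thesis using bit2[of "e d" "e (r (r d))"] by (metis minus_bit_def)
  qed
  have e0: "e d = 0" if "d \<in> E" for d
    using that d0(1)
  proof (induction rule: knot_traversal)
    case start show ?case using d0 c0 by (simp add: e_def)
  next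
    case (rev d) then show ?case by (simp only: e_def \<iota>_\<iota> add.commute)
  next
    case (straight d) then show ?case using opposite by simp
  qed
  obtain d where d: "d \<in> E" "y = L d" using y by (auto simp: faces_eq)
  show ?thesis unfolding d(2) using d(1) d0(1)
  proof (induction rule: face_induct)
    case start show ?case using d0 c0 by simp
  next
    case (step b)
    then show ?case using e0[OF step(1)] by (simp add: e_def)
  qed
qed

lemma dehn_matrix_det_nonzero:
  assumes xs: "bij_betw xs {..<n} (crossings D)" and ys: "bij_betw ys {..<n} (bot_faces D f)"
  shows "fun_det n (dehn_matrix xs ys) \<noteq> 0"
proof
  assume det0: "fun_det n (dehn_matrix xs ys) = 0"
  define M where "M = mat n n (\<lambda>(i, j). dehn_matrix xs ys i j)"
  define B where "B = map_mat (of_int :: int \<Rightarrow> bit) M"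
  have B: "B \<in> carrier_mat n n" by (simp add: B_def M_def)
  have "det B = of_int (det M)" unfolding B_def by (rule of_int_hom.hom_det)
  then have "det B = 0" using det0 by (simp add: M_def fun_det_def)
  then obtain v where v: "v \<in> carrier_vec n" "v \<noteq> 0\<^sub>v n" "B *\<^sub>v v = 0\<^sub>v n"
    using det_0_iff_vec_prod_zero_field[OF B] by blast
  define c where "c = (\<lambda>y. if y \<in> bot_faces D f then v $ (the_inv_into {..<n} ys y) else 0)"
  have cy: "c (ys j) = v $ j" if "j < n" for j
  proof -
    have "ys j \<in> bot_faces D f" using ys that by (auto simp: bij_betw_def)
    moreover have "the_inv_into {..<n} ys (ys j) = j" using ys that by (simp add: bij_betw_def the_inv_into_f_f)
    ultimately show ?thesis by (simp add: c_def)
  qed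
  have c_zero: "c y = 0" if "y \<in> faces D" for y
  proof (rule no_mod_2_colouring[OF _ _ _ that])
    show "c (outer D) = 0" "c f = 0" by (simp_all add: c_def bot_faces_def)
    fix x assume "x \<in> crossings D"
    then obtain i where i: "i < n" "x = xs i" using xs by (auto simp: bij_betw_def)
    have "(\<Sum>y\<in>faces D. of_int (dehn_rel x y) * c y) = (\<Sum>y\<in>bot_faces D f. of_int (dehn_rel x y) * c y)"
    proof (rule sum.mono_neutral_right)
      show "\<forall>y\<in>faces D - bot_faces D f. of_int (dehn_rel x y) * c y = 0" by (simp add: c_def)
    qed (auto simp: bot_faces_def)
    also have "\<dots> = (\<Sum>j<n. of_int (dehn_rel x (ys j)) * c (ys j))"
      using sum.reindex_bij_betw[OF ys, of "\<lambda>y. of_int (dehn_rel x y) * c y"] by simp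
    also have "\<dots> = (\<Sum>j<n. B $$ (i, j) * v $ j)"
      using i cy by (intro sum.cong) (simp_all add: B_def M_def dehn_matrix_def)
    also have "\<dots> = (B *\<^sub>v v) $ i"
      using B v(1) i by (simp add: scalar_prod_def lessThan_atLeast0)
    also have "\<dots> = 0" using v(3) i by simp
    finally show "(\<Sum>y\<in>faces D. of_int (dehn_rel x y) * c y) = 0" .
  qed
  have "v $ j = 0" if j: "j < n" for j
  proof -
    have "ys j \<in> bot_faces D f" using bij_betwE[OF ys] j by blast
    then have "ys j \<in> faces D" by (simp add: bot_faces_def)
    then show ?thesis using c_zero cy[OF j] by metis
  qed
  then have "v = 0\<^sub>v n" using v(1) by (intro eq_vecI) auto
  then show False using v(2) by simp
qed

lemma R_coset_eq_iff:
  "R #>\<^bsub>FA\<^esub> a = R #>\<^bsub>FA\<^esub> b \<longleftrightarrow> a - b \<in> R"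
proof
  assume "R #>\<^bsub>FA\<^esub> a = R #>\<^bsub>FA\<^esub> b"
  then have "0 + a \<in> R #>\<^bsub>FA\<^esub> b" using R_zero by (auto simp: r_coset_def)
  then obtain h where "h \<in> R" "a = h + b" by (auto simp: r_coset_def)
  then show "a - b \<in> R" by simp
next
  have sub: "R #>\<^bsub>FA\<^esub> a \<subseteq> R #>\<^bsub>FA\<^esub> b" if "a - b \<in> R" for a b
  proof
    fix z assume "z \<in> R #>\<^bsub>FA\<^esub> a"
    then obtain h where "h \<in> R" "z = h + a" by (auto simp: r_coset_def)
    then have "z = (h + (a - b)) \<otimes>\<^bsub>FA\<^esub> b" "h + (a - b) \<in> R" using that R_add by auto
    then show "z \<in> R #>\<^bsub>FA\<^esub> b" unfolding r_coset_def by blast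
  qed
  assume ab: "a - b \<in> R"
  then have "b - a \<in> R" using R_minus[OF ab] by simp
  then show "R #>\<^bsub>FA\<^esub> a = R #>\<^bsub>FA\<^esub> b" using sub ab by blast
qed

lemma torsion_eq:
  "torsion (fox_module D) =
    {R #>\<^bsub>FA\<^esub> a | a. Poly_Mapping.keys a \<subseteq> arcs D \<and> (\<exists>n>0. frag_cmul (int n) a \<in> R)}"
proof -
  interpret N: normal R FA
    using comm_group.subgroup_imp_normal[OF abelian_free_Abelian_group R_subgroup] .
  have R0: "R #>\<^bsub>FA\<^esub> b = R \<longleftrightarrow> b \<in> R" for b
    using R_coset_eq_iff[of b 0] by (simp add: r_coset_def)
  have pow: "(R #>\<^bsub>FA\<^esub> a) [^]\<^bsub>FA Mod R\<^esub> n = \<one>\<^bsub>FA Mod R\<^esub> \<longleftrightarrow> frag_cmul (int n) a \<in> R"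
    if "Poly_Mapping.keys a \<subseteq> arcs D" for a and n :: nat
    using N.FactGroup_pow[of a n] that R0 by simp
  have carr: "g \<in> carrier (FA Mod R) \<longleftrightarrow> (\<exists>a. g = R #>\<^bsub>FA\<^esub> a \<and> Poly_Mapping.keys a \<subseteq> arcs D)" for g
    unfolding carrier_FactGroup image_iff Bex_def carrier_free_Abelian_group_iff
    by (rule iff_exI) (rule conj_commute)
  have "torsion (FA Mod R) = {R #>\<^bsub>FA\<^esub> a | a. Poly_Mapping.keys a \<subseteq> arcs D \<and> (\<exists>n>0. frag_cmul (int n) a \<in> R)}"
  proof (intro equalityI subsetI)
    fix g assume "g \<in> torsion (FA Mod R)"
    then obtain n :: nat where n: "n > 0" "g [^]\<^bsub>FA Mod R\<^esub> n = \<one>\<^bsub>FA Mod R\<^esub>" and g: "g \<in> carrier (FA Mod R)"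
      unfolding torsion_def mem_Collect_eq by (elim conjE exE)
    obtain a where a: "g = R #>\<^bsub>FA\<^esub> a" "Poly_Mapping.keys a \<subseteq> arcs D"
      using g unfolding carr by (elim conjE exE)
    have "frag_cmul (int n) a \<in> R" using n(2) pow[OF a(2), of n] unfolding a(1) by (rule iffD1[rotated])
    then show "g \<in> {R #>\<^bsub>FA\<^esub> a | a. Poly_Mapping.keys a \<subseteq> arcs D \<and> (\<exists>n>0. frag_cmul (int n) a \<in> R)}"
      using a n(1) by blast
  next
    fix g assume "g \<in> {R #>\<^bsub>FA\<^esub> a | a. Poly_Mapping.keys a \<subseteq> arcs D \<and> (\<exists>n>0. frag_cmul (int n) a \<in> R)}"
    then obtain a and n :: nat where a: "g = R #>\<^bsub>FA\<^esub> a" "Poly_Mapping.keys a \<subseteq> arcs D"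
      and n: "n > 0" "frag_cmul (int n) a \<in> R"
      unfolding mem_Collect_eq by (elim conjE exE)
    have "g [^]\<^bsub>FA Mod R\<^esub> n = \<one>\<^bsub>FA Mod R\<^esub>" using n(2) pow[OF a(2), of n] unfolding a(1) by (rule iffD2[rotated])
    moreover have "g \<in> carrier (FA Mod R)" unfolding carr using a by blast
    ultimately show "g \<in> torsion (FA Mod R)" unfolding torsion_def mem_Collect_eq using n(1) by blast
  qed
  then show ?thesis by (simp add: fox_module_def R_def)
qed

text \<open>
  The finite transversal of the row span indexes the degree \<open>0\<close> cosets of the Fox relations.  Its
  finiteness also shows, by the pigeonhole principle, that these cosets have finite order.
\<close>

theorem knot_det_eq_det:
  assumes xs: "bij_betw xs {..<n} (crossings D)" and ys: "bij_betw ys {..<n} (bot_faces D f)"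
  shows "int (knot_det D) = \<bar>fun_det n (dehn_matrix xs ys)\<bar>"
proof -
  let ?M = "dehn_matrix xs ys" and ?B = "bot_faces D f"
  obtain T where T: "finite T" "int (card T) = \<bar>fun_det n ?M\<bar>"
    and uniq: "\<And>v. \<exists>!t. t \<in> T \<and> in_row_span n ?M (\<lambda>j. v j - t j)"
    using row_span_transversal[OF dehn_matrix_det_nonzero[OF xs ys]] by blast
  define lift where "lift = (\<lambda>(t :: nat \<Rightarrow> int) y. t (the_inv_into {..<n} ys y))"
  have lift: "lift t (ys j) = t j" if "j < n" for t j
    using ys that by (simp add: bij_betw_def the_inv_into_f_f lift_def)
  have span_lift: "in_row_span n ?M (\<lambda>j. g (ys j) - t j) \<longleftrightarrow> in_span ?B (\<lambda>y. g y - lift t y)" for g t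
  proof -
    have "in_row_span n ?M (\<lambda>j. g (ys j) - t j) \<longleftrightarrow> in_row_span n ?M (\<lambda>j. g (ys j) - lift t (ys j))"
      using lift by (simp add: in_row_span_def)
    then show ?thesis using in_row_span_dehn_matrix[OF xs ys, of "\<lambda>y. g y - lift t y"] by simp
  qed
  define cls where "cls = (\<lambda>v t. in_span ?B (\<lambda>y. face_sum v y - lift t y))"
  have ex1: "\<exists>!t. t \<in> T \<and> cls v t" for v
    using uniq[of "\<lambda>j. face_sum v (ys j)"] unfolding cls_def span_lift .
  have cls_diff: "in_span ?B (face_sum (u - v))" if "cls u t" "cls v t" for u v t
    using in_span_diff[OF that[unfolded cls_def]] by (simp add: face_sum_simps(4)[abs_def])
  have cls_shift: "cls v t" if "cls u t" "in_span ?B (face_sum (u - v))" for u v t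
    using in_span_diff[OF that(1)[unfolded cls_def] that(2)] by (simp add: cls_def)
  define rv where "rv = (\<lambda>t. SOME v. Poly_Mapping.keys v \<subseteq> arcs D \<and> deg v = 0 \<and> cls v t)"
  have rv: "Poly_Mapping.keys (rv t) \<subseteq> arcs D" "deg (rv t) = 0" "cls (rv t) t" for t
  proof -
    have "\<exists>v. Poly_Mapping.keys v \<subseteq> arcs D \<and> deg v = 0 \<and> cls v t"
      unfolding cls_def by (rule face_sum_onto)
    from someI_ex[OF this] show "Poly_Mapping.keys (rv t) \<subseteq> arcs D" "deg (rv t) = 0" "cls (rv t) t"
      by (auto simp: rv_def)
  qed
  have finite_order: "\<exists>k>0. frag_cmul (int k) a \<in> R" if a: "Poly_Mapping.keys a \<subseteq> arcs D" "deg a = 0" for a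
  proof -
    define tt where "tt = (\<lambda>k. THE t. t \<in> T \<and> cls (frag_cmul (int k) a) t)"
    have tt: "tt k \<in> T \<and> cls (frag_cmul (int k) a) (tt k)" for k
      unfolding tt_def using ex1 by (rule theI')
    have "finite (range tt)" using tt T(1) by (meson finite_subset image_subsetI)
    then have "\<not> inj tt" using finite_imageD[of tt UNIV] by auto
    then obtain i j where ij: "i \<noteq> j" "tt i = tt j" by (auto simp: inj_on_def)
    obtain p q where pq: "p < q" "tt p = tt q"
    proof (cases "i < j")
      case True then show ?thesis using that[of i j] ij by simp
    next
      case False then show ?thesis using that[of j i] ij by simp
    qed
    have "in_span ?B (face_sum (frag_cmul (int q) a - frag_cmul (int p) a))"
      using cls_diff tt[of p] tt[of q] pq(2) by metis
    moreover have "frag_cmul (int q) a - frag_cmul (int p) a = frag_cmul (int (q - p)) a"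
      using pq(1) by (simp add: frag_cmul_diff_distrib of_nat_diff)
    ultimately have "frag_cmul (int (q - p)) a \<in> R"
      using R_iff[of "frag_cmul (int (q - p)) a"] keys_cmul_arcs[OF a(1)] a(2) by simp
    then show ?thesis using pq(1) by (intro exI[of _ "q - p"]) simp
  qed
  have deg0: "deg a = 0" if "k > 0" "frag_cmul (int k) a \<in> R" for a and k :: nat
    using R_imp_span[OF that(2)] that(1) by simp
  have tors: "torsion (fox_module D) = {R #>\<^bsub>FA\<^esub> a | a. Poly_Mapping.keys a \<subseteq> arcs D \<and> deg a = 0}"
  proof -
    have "Poly_Mapping.keys a \<subseteq> arcs D \<and> (\<exists>n>0. frag_cmul (int n) a \<in> R) \<longleftrightarrow>
        Poly_Mapping.keys a \<subseteq> arcs D \<and> deg a = 0" for a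
    proof (intro conj_cong refl iffI)
      assume "\<exists>n>0. frag_cmul (int n) a \<in> R"
      then obtain n :: nat where "n > 0" "frag_cmul (int n) a \<in> R" by (elim exE conjE)
      then show "deg a = 0" by (rule deg0)
    qed (rule finite_order)
    then show ?thesis unfolding torsion_eq by (simp only:)
  qed
  have same: "a - b \<in> R \<longleftrightarrow> in_span ?B (face_sum (a - b))"
    if "Poly_Mapping.keys a \<subseteq> arcs D" "deg a = 0" "Poly_Mapping.keys b \<subseteq> arcs D" "deg b = 0" for a b
    using R_iff[OF keys_diff_arcs[OF that(1,3)]] that by simp
  have "bij_betw (\<lambda>t. R #>\<^bsub>FA\<^esub> rv t) T (torsion (fox_module D))"
    unfolding bij_betw_def
  proof
    show "inj_on (\<lambda>t. R #>\<^bsub>FA\<^esub> rv t) T"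
    proof (rule inj_onI)
      fix s t assume st: "s \<in> T" "t \<in> T" "R #>\<^bsub>FA\<^esub> rv s = R #>\<^bsub>FA\<^esub> rv t"
      then have "in_span ?B (face_sum (rv s - rv t))" 
        unfolding R_coset_eq_iff same[OF rv(1,2) rv(1,2)] by simp
      then have "cls (rv t) s" by (rule cls_shift[OF rv(3)])
      then show "s = t" using ex1[of "rv t"] rv(3)[of t] st(1,2) by metis
    qed
    show "(\<lambda>t. R #>\<^bsub>FA\<^esub> rv t) ` T = torsion (fox_module D)"
    proof
      show "(\<lambda>t. R #>\<^bsub>FA\<^esub> rv t) ` T \<subseteq> torsion (fox_module D)"
      proof
        fix C assume "C \<in> (\<lambda>t. R #>\<^bsub>FA\<^esub> rv t) ` T"
        then obtain t where "C = R #>\<^bsub>FA\<^esub> rv t" by (rule imageE)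
        then show "C \<in> torsion (fox_module D)" unfolding tors mem_Collect_eq using rv by (intro exI conjI)
      qed
      show "torsion (fox_module D) \<subseteq> (\<lambda>t. R #>\<^bsub>FA\<^esub> rv t) ` T"
      proof
        fix C assume "C \<in> torsion (fox_module D)"
        then obtain a where a: "C = R #>\<^bsub>FA\<^esub> a" "Poly_Mapping.keys a \<subseteq> arcs D" "deg a = 0"
          unfolding tors mem_Collect_eq by (elim exE conjE)
        obtain t where t: "t \<in> T" "cls a t" using ex1[of a] by (elim ex1E conjE)
        have "in_span ?B (face_sum (a - rv t))" using cls_diff[OF t(2) rv(3)] .
        then have "C = R #>\<^bsub>FA\<^esub> rv t"
          unfolding a(1) R_coset_eq_iff same[OF a(2,3) rv(1,2)] .
        then show "C \<in> (\<lambda>t. R #>\<^bsub>FA\<^esub> rv t) ` T" using t(1) by (rule image_eqI)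
      qed
    qed
  qed
  then have "card T = card (torsion (fox_module D))" by (rule bij_betw_same_card)
  then show ?thesis using T(2) by (simp add: knot_det_def)
qed

end

section \<open>Kasteleyn signs\<close>

lemma prod_signs_symmetric_difference:
  fixes g :: "'b \<Rightarrow> int"
  assumes "finite A" "finite B" "\<And>x. x \<in> A \<union> B \<Longrightarrow> g x \<in> {1, -1}"
  shows "prod g A * prod g B = prod g ((A - B) \<union> (B - A))"
proof -
  have A: "prod g A = prod g (A - B) * prod g (A \<inter> B)"
    using prod.Int_Diff[OF assms(1), of g B] by (simp add: mult.commute)
  have B: "prod g B = prod g (B - A) * prod g (A \<inter> B)"
    using prod.Int_Diff[OF assms(2), of g A] by (simp add: mult.commute Int_commute)
  have "prod g (A \<inter> B) * prod g (A \<inter> B) = (\<Prod>x\<in>A \<inter> B. g x * g x)" by (simp add: prod.distrib)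
  also have "\<dots> = 1"
  proof (rule prod.neutral, rule ballI)
    fix x assume "x \<in> A \<inter> B"
    then have "g x \<in> {1, -1}" using assms(3) by blast
    then show "g x * g x = 1" by auto
  qed
  finally have sq: "prod g (A \<inter> B) * prod g (A \<inter> B) = 1" .
  have "prod g A * prod g B = prod g (A - B) * prod g (B - A) * (prod g (A \<inter> B) * prod g (A \<inter> B))"
    unfolding A B by (simp only: mult_ac)
  also have "\<dots> = prod g (A - B) * prod g (B - A)" unfolding sq by simp
  also have "\<dots> = prod g ((A - B) \<union> (B - A))"
    using assms(1,2) by (intro prod.union_disjoint[symmetric]) auto
  finally show ?thesis .
qed

lemma map_permutation_image: "inj_on h A \<Longrightarrow> x \<in> A \<Longrightarrow> map_permutation A h p (h x) = h (p x)"
  by (simp add: map_permutation_def inv_into_f_f)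

locale reduced_bot_diagram = bot_diagram D f for D :: "'d diagram" and f :: "'d set" +
  assumes reduced: "reduced D"
begin

text \<open>
  In a reduced diagram an edge of the graph runs through a single corner.
\<close>

lemma corner_unique:
  assumes "d \<in> E" "e \<in> E" "V e = V d" "L e = L d"
  shows "e = d"
proof -
  have "inj_on L (V d)" using reduced assms(1) crossings_eq by (auto simp: reduced_def)
  moreover have "e \<in> V d" using assms(3) in_V_iff by simp
  ultimately show ?thesis using assms(4) self_in(1)[of d] by (metis inj_onD)
qed

text \<open>
  A dimer covering, as the set of the corners through which its edges run.
\<close>

definition is_matching :: "'d set \<Rightarrow> bool" where
  "is_matching M \<longleftrightarrow> M \<subseteq> E \<and> bij_betw V M (crossings D) \<and> bij_betw L M (bot_faces D f)"

lemma matching_in_E: "is_matching M \<Longrightarrow> d \<in> M \<Longrightarrow> d \<in> E"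
  by (auto simp: is_matching_def)

lemma matching_bot: "is_matching M \<Longrightarrow> d \<in> M \<Longrightarrow> L d \<in> bot_faces D f"
  using bij_betwE[of L M "bot_faces D f"] by (simp add: is_matching_def)

lemma matching_sum_crossing:
  assumes M: "is_matching M" and d: "d \<in> E"
  shows "(\<Sum>e\<in>V d. of_bool (e \<in> M) :: int) = 1"
proof -
  have "V d \<in> V ` M" using M d crossings_eq by (auto simp: is_matching_def bij_betw_def)
  then obtain m where m: "m \<in> M" "V m = V d" by auto
  have "e \<in> M \<longleftrightarrow> e = m" if "e \<in> V d" for e
  proof -
    have "V e = V m" using that in_V_iff m by simp
    moreover have "inj_on V M" using M by (simp add: is_matching_def bij_betw_def)
    ultimately show ?thesis using m(1) by (metis inj_onD)
  qed
  then have "(\<Sum>e\<in>V d. of_bool (e \<in> M) :: int) = (\<Sum>e\<in>V d. if m = e then 1 else 0)"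
    by (intro sum.cong) auto
  also have "\<dots> = 1"
    using m(2) in_V_iff[of m d] finite_subset[OF V_subset[OF d] finite_E] by simp
  finally show ?thesis .
qed

lemma matching_sum_face:
  assumes M: "is_matching M" and d: "d \<in> E"
  shows "(\<Sum>e\<in>L d. of_bool (e \<in> M) :: int) = of_bool (L d \<in> bot_faces D f)"
proof (cases "L d \<in> bot_faces D f")
  case True
  then have "L d \<in> L ` M" using M by (simp add: is_matching_def bij_betw_def)
  then obtain m where m: "m \<in> M" "L m = L d" by auto
  have "e \<in> M \<longleftrightarrow> e = m" if "e \<in> L d" for e
  proof -
    have "L e = L m" using that in_L_iff m by simp
    moreover have "inj_on L M" using M by (simp add: is_matching_def bij_betw_def)
    ultimately show ?thesis using m(1) by (metis inj_onD)
  qed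
  then have "(\<Sum>e\<in>L d. of_bool (e \<in> M) :: int) = (\<Sum>e\<in>L d. if m = e then 1 else 0)"
    by (intro sum.cong) auto
  also have "\<dots> = 1"
    using m(2) in_L_iff[of m d] finite_subset[OF L_subset[OF d] finite_E] by simp
  finally show ?thesis using True by simp
next
  case False
  have "e \<notin> M" if "e \<in> L d" for e
  proof
    assume "e \<in> M"
    then have "L e \<in> bot_faces D f" by (rule matching_bot[OF M])
    moreover have "L e = L d" using that in_L_iff by simp
    ultimately show False using False by simp
  qed
  then show ?thesis using False by simp
qed

text \<open>
  The difference of two matchings is a cycle, hence bounds a combination \<open>s\<close> of quadrilaterals.  No
  corner at an omitted face belongs to a matching, so \<open>s\<close> is constant around each of the two, and the
  constants agree along their common edge.  The quadrilaterals where \<open>s\<close> differs from this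
  constant by an odd number form \<open>S\<close>.
\<close>

lemma region_between_matchings:
  assumes M1: "is_matching M1" and M2: "is_matching M2"
  obtains S where "S \<subseteq> E" "\<And>d. \<iota> d \<in> S \<longleftrightarrow> d \<in> S" "\<And>d. d \<in> S \<Longrightarrow> L d \<in> bot_faces D f"
    "\<And>d. d \<in> E \<Longrightarrow> (d \<in> S) \<noteq> (r d \<in> S) \<longleftrightarrow> (d \<in> M1) \<noteq> (d \<in> M2)"
proof -
  define g :: "'d \<Rightarrow> int" where "g = (\<lambda>d. of_bool (d \<in> M1) - of_bool (d \<in> M2))"
  have "(\<Sum>e\<in>V d. g e) = 0" "(\<Sum>e\<in>L d. g e) = 0" if "d \<in> E" for d
    using matching_sum_crossing[OF M1 that] matching_sum_crossing[OF M2 that]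
      matching_sum_face[OF M1 that] matching_sum_face[OF M2 that] by (simp_all only: g_def sum_subtractf)
  then obtain s where s: "\<forall>d\<in>E. g d = s (r d) - s d \<and> s (\<iota> d) = s d"
    using corner_form_exact[of g] by metis
  obtain d0 where d0: "d0 \<in> E" "L d0 = outer D" "L (\<iota> d0) = f" by (rule base_dart)
  have const: "s e = s d" if d: "d \<in> E" "L d \<notin> bot_faces D f" and e: "e \<in> L d" for d e
  proof -
    have move: "\<phi> c \<in> E \<and> L (\<phi> c) = L d \<and> s (\<phi> c) = s d" if c: "c \<in> E" "L c = L d" "s c = s d" for c
    proof -
      have "\<phi> c \<notin> M" if "is_matching M" for M
      proof
        assume "\<phi> c \<in> M"
        then have "L (\<phi> c) \<in> bot_faces D f" by (rule matching_bot[OF that])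
        then show False using c(2) d(2) by simp
      qed
      then have "g (\<phi> c) = 0" using M1 M2 by (simp add: g_def)
      then have "s (\<iota> c) = s (\<phi> c)" using bspec[OF s, of "\<phi> c"] c(1) by simp
      moreover have "s (\<iota> c) = s c" using s c(1) by blast
      ultimately show ?thesis using c by simp
    qed
    have "e \<in> orbit \<phi> d" using e by (simp add: face_left_def)
    then have "e \<in> E \<and> L e = L d \<and> s e = s d"
    proof induction
      case base show ?case using move[of d] d(1) by simp
    next
      case (step y)
      then show ?case using move[of y] by simp
    qed
    then show ?thesis by simp
  qed
  have omitted: "s d = s d0" if d: "d \<in> E" "L d \<notin> bot_faces D f" for d
  proof -
    have "L d = outer D \<or> L d = f" using d(2) L_in_faces[OF d(1)] unfolding bot_faces_def by blast
    then have "L d = L d0 \<or> L d = L (\<iota> d0)" unfolding d0(2,3) .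
    then show ?thesis
    proof
      assume "L d = L d0"
      then have "d0 \<in> L d" using in_L_iff by simp
      from const[OF d this] show ?thesis by (rule sym)
    next
      assume "L d = L (\<iota> d0)"
      then have "\<iota> d0 \<in> L d" using in_L_iff by simp
      from const[OF d this] have "s (\<iota> d0) = s d" .
      then show ?thesis using bspec[OF s d0(1)] by simp
    qed
  qed
  define S where "S = {d \<in> E. odd (s d - s d0)}"
  show ?thesis
  proof (rule that[of S])
    show "S \<subseteq> E" by (auto simp: S_def)
    show "\<iota> d \<in> S \<longleftrightarrow> d \<in> S" for d using s by (auto simp: S_def)
    show "L d \<in> bot_faces D f" if "d \<in> S" for d
    proof (rule ccontr)
      assume no: "L d \<notin> bot_faces D f"
      have "d \<in> E" "odd (s d - s d0)" using that by (simp_all add: S_def)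
      then show False using omitted[OF _ no] by simp
    qed
    show "(d \<in> S) \<noteq> (r d \<in> S) \<longleftrightarrow> (d \<in> M1) \<noteq> (d \<in> M2)" if d: "d \<in> E" for d
    proof -
      have "odd (g d) \<longleftrightarrow> (d \<in> M1) \<noteq> (d \<in> M2)"
        by (cases "d \<in> M1"; cases "d \<in> M2") (simp_all add: g_def)
      then have "odd (s (r d) - s d) \<longleftrightarrow> (d \<in> M1) \<noteq> (d \<in> M2)" using s d by metis
      moreover have "(d \<in> S) \<noteq> (r d \<in> S) \<longleftrightarrow> odd (s (r d) - s d)" using d by (auto simp: S_def)
      ultimately show ?thesis by simp
    qed
  qed
qed

lemma inv_\<phi>: "inv_into UNIV \<phi> = \<iota> \<circ> r"
  by (rule inv_unique_comp) (auto simp: fun_eq_iff)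

text \<open>
  Going around the crossings within \<open>S\<close>, and going around the faces within \<open>S\<close>, are permutations of
  \<open>S\<close> with cycles of equal number, hence of equal sign.  The second is the first one composed with the
  reversal of darts and with the permutation that moves along the two matchings.
\<close>

lemma sign_region:
  assumes M1: "is_matching M1" and M2: "is_matching M2" and S: "S \<subseteq> E" "\<And>d. \<iota> d \<in> S \<longleftrightarrow> d \<in> S"
    "\<And>d. d \<in> S \<Longrightarrow> L d \<in> bot_faces D f"
    "\<And>d. d \<in> E \<Longrightarrow> (d \<in> S) \<noteq> (r d \<in> S) \<longleftrightarrow> (d \<in> M1) \<noteq> (d \<in> M2)"
  shows "cut_along V M1 M2 r E S" "cut_along L M1 M2 (\<iota> \<circ> r) E S"
    "bij_betw (swap_along V M1 M2 \<circ> swap_along L M1 M2) S S"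
    "sign_on S (swap_along V M1 M2 \<circ> swap_along L M1 M2) = sign_on S \<iota>"
proof -
  have M: "M1 \<subseteq> E" "M2 \<subseteq> E" "inj_on V M1" "inj_on V M2" "inj_on L M1" "inj_on L M2"
    "V ` M1 = crossings D" "V ` M2 = crossings D" "L ` M1 = bot_faces D f" "L ` M2 = bot_faces D f"
    using M1 M2 by (auto simp: is_matching_def bij_betw_def)
  have finS: "finite S" using S(1) finite_E by (rule finite_subset)
  show VX: "cut_along V M1 M2 r E S"
  proof unfold_locales
    show "orbit r d = {e \<in> E. V e = V d}" if "d \<in> E" for d
      using V_eq_Collect[OF that] by (simp add: vertex_at_def)
    show "V ` S \<subseteq> V ` M1" using S(1) M(7) crossings_eq by auto
  qed (use M S finite_E r_permutes in simp_all)
  \<comment> \<open>\<open>\<iota> \<circ> r\<close> is the inverse of \<open>\<phi>\<close>, so its cycles are the faces.\<close>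
  have \<psi>: "(\<iota> \<circ> r) permutes E" using permutes_compose[OF r_permutes \<iota>_permutes] .
  show LX: "cut_along L M1 M2 (\<iota> \<circ> r) E S"
  proof unfold_locales
    show "orbit (\<iota> \<circ> r) d = {e \<in> E. L e = L d}" if "d \<in> E" for d
      using L_eq_Collect[OF that] orbit_inv_eq[OF permutations(3)] by (simp add: face_left_def inv_\<phi>)
    show "L ` S \<subseteq> L ` M1" using S(3) M(9) by auto
    show "(d \<in> S) \<noteq> ((\<iota> \<circ> r) d \<in> S) \<longleftrightarrow> (d \<in> M1) \<noteq> (d \<in> M2)" if "d \<in> E" for d
      using S(4)[OF that] S(2) by simp
  qed (use M S(1) finite_E \<psi> in simp_all)
  interpret VX: cut_along V M1 M2 r E S by (rule VX)
  interpret LX: cut_along L M1 M2 "\<iota> \<circ> r" E S by (rule LX)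
  let ?X = "swap_along V M1 M2" and ?Y = "swap_along L M1 M2"
  have "{c \<in> M1. c \<in> S \<or> r c \<in> S} = {c \<in> M1. c \<in> S \<or> (\<iota> \<circ> r) c \<in> S}" using S(2) by simp
  then have eq: "sign_on S (r \<circ> ?X) = sign_on S ((\<iota> \<circ> r) \<circ> ?Y)"
    unfolding VX.sign_cut LX.sign_cut by simp
  have comp: "(\<iota> \<circ> r) \<circ> ?Y = (\<iota> \<circ> (r \<circ> ?X)) \<circ> (?X \<circ> ?Y)"
    by (rule ext) (simp add: VX.swap_swap)
  have b\<iota>: "bij_betw \<iota> S S" by (intro bij_betw_byWitness[of _ \<iota>]) (use S(2) in auto)
  have "(?X \<circ> ?Y) s \<in> S" if s: "s \<in> S" for s
  proof -
    have "((\<iota> \<circ> r) \<circ> ?Y) s \<in> S" using bij_betw_apply[OF LX.bij_cut s] .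
    moreover have "((\<iota> \<circ> r) \<circ> ?Y) s = \<iota> ((r \<circ> ?X) ((?X \<circ> ?Y) s))" unfolding comp by (simp only: o_apply)
    ultimately have "(r \<circ> ?X) ((?X \<circ> ?Y) s) \<in> S" using S(2) by metis
    moreover have "(r \<circ> ?X) ` S = S" using VX.bij_cut unfolding bij_betw_def by (rule conjunct2)
    ultimately have "(r \<circ> ?X) ((?X \<circ> ?Y) s) \<in> (r \<circ> ?X) ` S" by (simp only:)
    then show ?thesis using inj_image_mem_iff[OF permutes_inj[OF VX.r\<tau>_permutes]] by (rule iffD1[rotated])
  qed
  then have "(?X \<circ> ?Y) ` S \<subseteq> S" by (rule image_subsetI)
  moreover have "inj_on (?X \<circ> ?Y) S"
    using inj_on_subset[OF permutes_inj[OF permutes_compose[OF LX.swap_permutes[OF M(1,2)] VX.swap_permutes[OF M(1,2)]]], of S] by simp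
  ultimately show bXY: "bij_betw (?X \<circ> ?Y) S S"
    using endo_inj_surj[OF finS] unfolding bij_betw_def by blast
  have "sign_on S ((\<iota> \<circ> r) \<circ> ?Y) = sign_on S (\<iota> \<circ> (r \<circ> ?X)) * sign_on S (?X \<circ> ?Y)"
    unfolding comp by (rule sign_on_compose[OF bij_betw_trans[OF VX.bij_cut b\<iota>] bXY finS])
  also have "sign_on S (\<iota> \<circ> (r \<circ> ?X)) = sign_on S \<iota> * sign_on S (r \<circ> ?X)"
    by (rule sign_on_compose[OF b\<iota> VX.bij_cut finS])
  finally have "sign_on S (r \<circ> ?X) = sign_on S \<iota> * sign_on S (r \<circ> ?X) * sign_on S (?X \<circ> ?Y)"
    unfolding eq .
  moreover have pm: "sign_on S p = 1 \<or> sign_on S p = -1" for p :: "'d \<Rightarrow> 'd"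
    unfolding sign_on_def sign_def by simp
  ultimately show "sign_on S (?X \<circ> ?Y) = sign_on S \<iota>"
    using pm[of "r \<circ> ?X"] pm[of \<iota>] pm[of "?X \<circ> ?Y"] by (elim disjE) simp_all
qed

text \<open>
  The corners of the symmetric difference that lie in \<open>S\<close> correspond to the crossings moved by
  \<open>\<pi>\<close>, one for each.  Moving along the two matchings acts on them as \<open>\<pi>\<close> where the corner belongs to
  \<open>M1\<close> and as the inverse of \<open>\<pi>\<close> where it belongs to \<open>M2\<close>.  Both kinds are unions of cycles of \<open>\<pi>\<close>,
  and inverting some cycles does not change the sign.
\<close>

lemma sign_index_permutations:
  fixes n :: nat
  assumes xs: "bij_betw xs {..<n} (crossings D)" and ys: "bij_betw ys {..<n} (bot_faces D f)"
    and p: "p1 permutes {..<n}" "p2 permutes {..<n}"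
    and c1: "\<And>i. i < n \<Longrightarrow> c1 i \<in> E \<and> V (c1 i) = xs i \<and> L (c1 i) = ys (p1 i)"
    and c2: "\<And>i. i < n \<Longrightarrow> c2 i \<in> E \<and> V (c2 i) = xs i \<and> L (c2 i) = ys (p2 i)"
    and M1_def: "M1 = c1 ` {..<n}" and M2_def: "M2 = c2 ` {..<n}"
    and VX: "cut_along V M1 M2 r E S" and LX: "cut_along L M1 M2 (\<iota> \<circ> r) E S"
    and bXY: "bij_betw (swap_along V M1 M2 \<circ> swap_along L M1 M2) S S"
  shows "sign_on S (swap_along V M1 M2 \<circ> swap_along L M1 M2) = sign p1 * sign p2"
proof -
  interpret VX: cut_along V M1 M2 r E S by (rule VX)
  interpret LX: cut_along L M1 M2 "\<iota> \<circ> r" E S by (rule LX)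
  define \<sigma> where "\<sigma> = swap_along V M1 M2 \<circ> swap_along L M1 M2"
  have finS: "finite S" using VX.S_sub finite_E by (rule finite_subset)
  define \<pi> where "\<pi> = inv_into UNIV p2 \<circ> p1"
  have \<pi>: "\<pi> permutes {..<n}" unfolding \<pi>_def by (rule permutes_compose[OF p(1) permutes_inv[OF p(2)]])
  have p\<pi>: "p2 (\<pi> i) = p1 i" for i using permutes_inverses(1)[OF p(2)] by (simp add: \<pi>_def)
  have \<pi>n: "\<pi> i < n \<longleftrightarrow> i < n" for i using permutes_in_image[OF \<pi>, of i] by simp
  have p1n: "p1 i < n" if "i < n" for i using permutes_in_image[OF p(1), of i] that by simp
  have p2n: "p2 i < n" if "i < n" for i using permutes_in_image[OF p(2), of i] that by simp
  have inj\<pi>: "\<pi> i = \<pi> j \<longleftrightarrow> i = j" for i j using permutes_inj[OF \<pi>] by (simp add: inj_eq)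
  have injx: "xs i = xs j \<longleftrightarrow> i = j" if "i < n" "j < n" for i j
    using xs that inj_on_eq_iff[of xs "{..<n}" i j] by (simp add: bij_betw_def)
  have injy: "ys i = ys j \<longleftrightarrow> i = j" if "i < n" "j < n" for i j
    using ys that inj_on_eq_iff[of ys "{..<n}" i j] by (simp add: bij_betw_def)
  have in1: "c1 i \<in> M1" if "i < n" for i using that by (simp add: M1_def)
  have in2: "c2 i \<in> M2" if "i < n" for i using that by (simp add: M2_def)
  have VV: "V (c1 i) = V (c2 i)" if "i < n" for i using c1 c2 that by simp
  have LL: "L (c1 i) = L (c2 (\<pi> i))" if "i < n" for i using c1[OF that] c2[of "\<pi> i"] that p\<pi> \<pi>n by simp
  have \<sigma>1: "\<sigma> (c1 i) = c1 (\<pi> i)" if "i < n" for i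
    using LX.swap_pair(1)[OF in1[OF that] in2 LL[OF that]] VX.swap_pair(2)[OF in1 in2 VV] that \<pi>n
    by (simp add: \<sigma>_def)
  have \<sigma>2: "\<sigma> (c2 (\<pi> i)) = c2 i" if "i < n" for i
    using LX.swap_pair(2)[OF in1[OF that] in2 LL[OF that]] VX.swap_pair(1)[OF in1 in2 VV] that \<pi>n
    by (simp add: \<sigma>_def)
  have eqV: "i = j" if "i < n" "j < n" "c1 i = c2 j" for i j
    using c1[OF that(1)] c2[OF that(2)] that(3) injx[OF that(1,2)] by simp
  have fixed: "c1 i = c2 i \<longleftrightarrow> \<pi> i = i" if i: "i < n" for i
  proof
    assume "c1 i = c2 i"
    then have "ys (p1 i) = ys (p2 i)" using c1[OF i] c2[OF i] by simp
    then have "p2 (\<pi> i) = p2 i" using injy p1n p2n i p\<pi> by simp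
    then show "\<pi> i = i" using permutes_inj[OF p(2)] by (simp add: inj_eq)
  next
    assume "\<pi> i = i"
    then have "L (c1 i) = L (c2 i)" using LL[OF i] by simp
    then show "c1 i = c2 i" using corner_unique[of "c2 i" "c1 i"] VV[OF i] c1[OF i] c2[OF i] by simp
  qed
  define K where "K = {d \<in> S. (d \<in> M1) \<noteq> (d \<in> M2)}"
  define \<kappa> where "\<kappa> = (\<lambda>d. the_inv_into {..<n} xs (V d))"
  have \<kappa>: "\<kappa> (c1 i) = i" "\<kappa> (c2 i) = i" if "i < n" for i
    using xs c1[OF that] c2[OF that] that by (simp_all add: \<kappa>_def bij_betw_def the_inv_into_f_f)
  have both1: "c1 i \<in> M2 \<longleftrightarrow> \<pi> i = i" if "i < n" for i
    using fixed[OF that] eqV[OF that] in2[OF that] by (auto simp: M2_def)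
  have both2: "c2 i \<in> M1 \<longleftrightarrow> \<pi> i = i" if "i < n" for i
  proof -
    have "c2 i \<in> M1 \<longleftrightarrow> c1 i = c2 i"
    proof
      assume "c2 i \<in> M1"
      then obtain j where j: "j < n" "c1 j = c2 i" by (auto simp: M1_def)
      then show "c1 i = c2 i" using eqV[OF j(1) that j(2)] by simp
    next
      assume "c1 i = c2 i"
      then show "c2 i \<in> M1" using in1[OF that] by simp
    qed
    then show ?thesis using fixed[OF that] by simp
  qed
  have K1: "c1 i \<in> K \<longleftrightarrow> c1 i \<in> S \<and> \<pi> i \<noteq> i" if "i < n" for i using in1[OF that] both1[OF that] by (auto simp: K_def)
  have K2: "c2 i \<in> K \<longleftrightarrow> c2 i \<in> S \<and> \<pi> i \<noteq> i" if "i < n" for i using in2[OF that] both2[OF that] by (auto simp: K_def)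
  have Kform: "\<exists>i<n. d = c1 i \<or> d = c2 i" if "d \<in> K" for d using that by (auto simp: K_def M1_def M2_def)
  have sepV: "(c1 i \<in> S) \<noteq> (c2 i \<in> S)" if "i < n" "\<pi> i \<noteq> i" for i
    using VX.separated[OF in1 in2 VV] that fixed by simp
  have sepL: "(c1 i \<in> S) \<noteq> (c2 (\<pi> i) \<in> S)" if i: "i < n" "\<pi> i \<noteq> i" for i
  proof -
    have "c1 i \<noteq> c2 (\<pi> i)" using eqV[of i "\<pi> i"] i \<pi>n by auto
    then show ?thesis using LX.separated[OF in1 in2 LL] i \<pi>n by simp
  qed
  have \<sigma>_fix: "\<sigma> d = d" if d: "d \<in> S - K" for d
  proof (cases "d \<in> M1")
    case True
    then obtain i where i: "i < n" "d = c1 i" by (auto simp: M1_def)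
    have "d \<in> M2" using d True by (simp add: K_def)
    then have "\<pi> i = i" using both1[OF i(1)] i by simp
    then show ?thesis using \<sigma>1[OF i(1)] i by simp
  next
    case False
    then have "d \<notin> M2" using d by (simp add: K_def)
    then show ?thesis using False VX.swap_other LX.swap_other by (simp add: \<sigma>_def)
  qed
  define q where "q = restrict_id \<sigma> S"
  have "q permutes S" unfolding q_def \<sigma>_def by (rule permutes_restrict_id[OF bXY])
  then have qK: "q permutes K"
    by (rule permutes_superset) (use \<sigma>_fix in \<open>simp add: q_def\<close>)
  have qd: "q d = \<sigma> d" if "d \<in> K" for d using that by (simp add: q_def K_def)
  have finK: "finite K" using finS by (simp add: K_def)
  have inj\<kappa>: "inj_on \<kappa> K"
  proof (rule inj_onI)
    fix d e assume de: "d \<in> K" "e \<in> K" "\<kappa> d = \<kappa> e"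
    obtain i where i: "i < n" "d = c1 i \<or> d = c2 i" using Kform[OF de(1)] by blast
    obtain j where j: "j < n" "e = c1 j \<or> e = c2 j" using Kform[OF de(2)] by blast
    have "i = j" using de(3) i j \<kappa> by auto
    then have "\<not> (d = c1 i \<and> e = c2 i)" "\<not> (d = c2 i \<and> e = c1 i)"
      using sepV[OF i(1)] K1[OF i(1)] K2[OF i(1)] de(1,2) by auto
    then show "d = e" using i(2) j(2) \<open>i = j\<close> by auto
  qed
  define \<theta> where "\<theta> = map_permutation K \<kappa> q"
  have \<theta>\<kappa>: "\<theta> (\<kappa> d) = \<kappa> (\<sigma> d)" if "d \<in> K" for d
    unfolding \<theta>_def using map_permutation_image[OF inj\<kappa> that] qd[OF that] by simp
  have \<theta>p: "\<theta> permutes \<kappa> ` K"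
    unfolding \<theta>_def using inj\<kappa> qK by (intro map_permutation_permutes) (auto simp: bij_betw_def)
  have sign\<theta>: "sign \<theta> = sign_on S \<sigma>"
    unfolding \<theta>_def sign_on_def q_def[symmetric] by (rule sign_map_permutation[OF inj\<kappa> qK finK])
  define B where "B = {i. i < n \<and> c2 i \<in> K}"
  \<comment> \<open>Applying \<open>\<pi>\<close> twice on \<open>B\<close> turns the inverse of \<open>\<pi>\<close> into \<open>\<pi>\<close> and does not affect the sign.\<close>
  define b where "b = restrict_id \<pi> B"
  have \<pi>B: "\<pi> i \<in> B" if "i \<in> B" for i
  proof -
    have i: "i < n" "c2 i \<in> S" "\<pi> i \<noteq> i" using that K2 by (auto simp: B_def)
    have "c2 (\<pi> i) \<in> S" using sepV[OF i(1,3)] sepL[OF i(1,3)] i(2) by simp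
    moreover have "\<pi> (\<pi> i) \<noteq> \<pi> i" using i(3) inj\<pi> by simp
    ultimately show ?thesis using K2[of "\<pi> i"] i(1) \<pi>n by (simp add: B_def)
  qed
  have finB: "finite B" by (simp add: B_def)
  have "bij_betw \<pi> B B"
    unfolding bij_betw_def
    using endo_inj_surj[OF finB, of \<pi>] \<pi>B inj_on_subset[OF permutes_inj[OF \<pi>], of B] by blast
  then have bB: "b permutes B" unfolding b_def by (rule permutes_restrict_id)
  have pi_eq: "\<pi> = \<theta> \<circ> (b \<circ> b)"
  proof
    fix i
    show "\<pi> i = (\<theta> \<circ> (b \<circ> b)) i"
    proof (cases "i \<in> B")
      case True
      define j where "j = \<pi> i"
      have j: "j \<in> B" "\<pi> j \<in> B" using \<pi>B True by (auto simp: j_def)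
      then have "\<theta> (\<pi> j) = \<kappa> (\<sigma> (c2 (\<pi> j)))" using \<theta>\<kappa>[of "c2 (\<pi> j)"] \<kappa>(2)[of "\<pi> j"] by (simp add: B_def)
      also have "\<dots> = j" using \<sigma>2[of j] \<kappa>(2)[of j] j by (simp add: B_def)
      finally show ?thesis using True j by (simp add: b_def j_def)
    next
      case False
      have "\<theta> i = \<pi> i"
      proof (cases "i < n \<and> c1 i \<in> K")
        case True
        then show ?thesis using \<theta>\<kappa>[of "c1 i"] \<kappa>(1)[of i] \<sigma>1[of i] \<kappa>(1)[of "\<pi> i"] \<pi>n by simp
      next
        case F: False
        have "i \<notin> \<kappa> ` K"
        proof
          assume "i \<in> \<kappa> ` K"
          then obtain d where d: "d \<in> K" "i = \<kappa> d" by auto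
          obtain k where k: "k < n" "d = c1 k \<or> d = c2 k" using Kform[OF d(1)] by blast
          then have "i = k" using d(2) \<kappa>[OF k(1)] by auto
          then show False using F False k d(1) by (auto simp: B_def)
        qed
        then have "\<theta> i = i" using \<theta>p by (simp add: permutes_not_in)
        moreover have "\<pi> i = i"
        proof (cases "i < n")
          case True
          show ?thesis
          proof (rule ccontr)
            assume "\<pi> i \<noteq> i"
            then have "c1 i \<in> K \<or> c2 i \<in> K" using sepV[OF True] K1[OF True] K2[OF True] by blast
            then show False using F False True by (auto simp: B_def)
          qed
        next
          case no: False
          then show ?thesis using permutes_not_in[OF \<pi>, of i] by simp
        qed
        ultimately show ?thesis by simp
      qed
      then show ?thesis using False by (simp add: b_def)
    qed
  qed
  have perms: "permutation \<theta>" "permutation b"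
    using \<theta>p bB finK finB by (auto intro: permutes_imp_permutation)
  have "sign \<pi> = sign \<theta> * (sign b * sign b)"
    unfolding pi_eq by (simp only: sign_compose perms permutation_compose)
  also have "\<dots> = sign_on S \<sigma>" using sign\<theta> by simp
  finally have "sign_on S \<sigma> = sign \<pi>" ..
  also have "\<dots> = sign (inv_into UNIV p2) * sign p1"
    unfolding \<pi>_def using p by (intro sign_compose) (auto intro: permutes_imp_permutation permutation_inverse)
  also have "\<dots> = sign p1 * sign p2"
    using sign_inverse[OF permutes_imp_permutation[OF _ p(2)]] by simp
  finally show ?thesis by (simp add: \<sigma>_def)
qed

lemma kasteleyn_sign:
  fixes n :: nat
  assumes xs: "bij_betw xs {..<n} (crossings D)" and ys: "bij_betw ys {..<n} (bot_faces D f)"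
    and p: "p1 permutes {..<n}" "p2 permutes {..<n}"
    and c1: "\<And>i. i < n \<Longrightarrow> c1 i \<in> E \<and> V (c1 i) = xs i \<and> L (c1 i) = ys (p1 i)"
    and c2: "\<And>i. i < n \<Longrightarrow> c2 i \<in> E \<and> V (c2 i) = xs i \<and> L (c2 i) = ys (p2 i)"
    and \<eta>: "\<And>d. d \<in> E \<Longrightarrow> L d \<in> bot_faces D f \<Longrightarrow> \<eta> d \<in> {1, -1}"
    and quad: "\<And>d. d \<in> E \<Longrightarrow> L d \<in> bot_faces D f \<Longrightarrow> L (\<iota> d) \<in> bot_faces D f \<Longrightarrow>
      (\<eta> d * \<eta> (rot_back D d)) * (\<eta> (\<iota> d) * \<eta> (rot_back D (\<iota> d))) = (-1 :: int)"
  shows "sign p1 * (\<Prod>i<n. \<eta> (c1 i)) = sign p2 * (\<Prod>i<n. \<eta> (c2 i))"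
proof -
  have match: "is_matching (c ` {..<n}) \<and> inj_on c {..<n}"
    if pp: "p permutes {..<n}" and c: "\<And>i. i < n \<Longrightarrow> c i \<in> E \<and> V (c i) = xs i \<and> L (c i) = ys (p i)" for p c
  proof -
    have inj: "inj_on c {..<n}"
    proof (rule inj_onI)
      fix i j assume ij: "i \<in> {..<n}" "j \<in> {..<n}" "c i = c j"
      then have "xs i = xs j" using c[of i] c[of j] by simp
      then show "i = j" using xs ij by (auto simp: bij_betw_def inj_on_def)
    qed
    then have bc: "bij_betw c {..<n} (c ` {..<n})" by (simp add: bij_betw_def)
    have "bij_betw (V \<circ> c) {..<n} (crossings D)"
      using xs c bij_betw_cong[of "{..<n}" "V \<circ> c" xs "crossings D"] by simp
    moreover have "bij_betw (L \<circ> c) {..<n} (bot_faces D f)"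
    proof -
      have "bij_betw (ys \<circ> p) {..<n} (bot_faces D f)" by (rule bij_betw_trans[OF permutes_imp_bij[OF pp] ys])
      then show ?thesis using c bij_betw_cong[of "{..<n}" "L \<circ> c" "ys \<circ> p" "bot_faces D f"] by simp
    qed
    ultimately show ?thesis
      using c inj bij_betw_comp_iff[OF bc, of V "crossings D"] bij_betw_comp_iff[OF bc, of L "bot_faces D f"]
      by (auto simp: is_matching_def)
  qed
  define M1 where "M1 = c1 ` {..<n}"
  define M2 where "M2 = c2 ` {..<n}"
  have M1: "is_matching M1" "inj_on c1 {..<n}" using match[OF p(1) c1] by (auto simp: M1_def)
  have M2: "is_matching M2" "inj_on c2 {..<n}" using match[OF p(2) c2] by (auto simp: M2_def)
  obtain S where S: "S \<subseteq> E" "\<And>d. \<iota> d \<in> S \<longleftrightarrow> d \<in> S" "\<And>d. d \<in> S \<Longrightarrow> L d \<in> bot_faces D f"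
    "\<And>d. d \<in> E \<Longrightarrow> (d \<in> S) \<noteq> (r d \<in> S) \<longleftrightarrow> (d \<in> M1) \<noteq> (d \<in> M2)"
    using region_between_matchings[OF M1(1) M2(1)] by metis
  note region = sign_region[OF M1(1) M2(1) S]
  have finS: "finite S" using S(1) finite_E by (rule finite_subset)
  have finM: "finite M1" "finite M2" by (simp_all add: M1_def M2_def)
  have "sign p1 * sign p2 = sign_on S \<iota>"
    using sign_index_permutations[OF xs ys p c1 c2 M1_def M2_def region(1,2,3)] region(4) by simp
  also have "\<dots> = (\<Prod>d\<in>S. \<eta> d * \<eta> (rot_back D d))"
  proof (rule sign_on_fixfree_involution[OF finS])
    fix d assume d: "d \<in> S"
    then show "\<iota> d \<in> S \<and> \<iota> d \<noteq> d \<and> \<iota> (\<iota> d) = d" using S(1,2) \<iota>_neq by auto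
    have "\<iota> d \<in> S" using S(2) d by simp
    then show "\<eta> d * \<eta> (rot_back D d) * (\<eta> (\<iota> d) * \<eta> (rot_back D (\<iota> d))) = -1"
      using quad[of d] d S(1,3) by blast
  qed
  also have "\<dots> = prod \<eta> S * (\<Prod>d\<in>S. \<eta> (rot_back D d))" by (rule prod.distrib)
  also have "(\<Prod>d\<in>S. \<eta> (rot_back D d)) = prod \<eta> {e \<in> E. r e \<in> S}"
  proof (rule prod.reindex_bij_betw)
    show "bij_betw (rot_back D) S {e \<in> E. r e \<in> S}"
      by (rule bij_betw_byWitness[of _ r]) (use S(1) in auto)
  qed
  also have "prod \<eta> S * prod \<eta> {e \<in> E. r e \<in> S}
      = prod \<eta> ((S - {e \<in> E. r e \<in> S}) \<union> ({e \<in> E. r e \<in> S} - S))"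
  proof (rule prod_signs_symmetric_difference[OF finS])
    show "finite {e \<in> E. r e \<in> S}" using finite_E by simp
    fix x assume x: "x \<in> S \<union> {e \<in> E. r e \<in> S}"
    have "x \<in> E" using x S(1) by auto
    moreover have "L x \<in> bot_faces D f"
    proof (cases "x \<in> S")
      case True then show ?thesis by (rule S(3))
    next
      case False
      then have "\<iota> (r x) \<in> S" using x S(2) by simp
      then show ?thesis using S(3)[of "\<iota> (r x)"] by simp
    qed
    ultimately show "\<eta> x \<in> {1, -1}" by (rule \<eta>)
  qed
  also have "(S - {e \<in> E. r e \<in> S}) \<union> ({e \<in> E. r e \<in> S} - S) = (M1 - M2) \<union> (M2 - M1)"
  proof -
    have "M1 \<subseteq> E" "M2 \<subseteq> E" using M1 M2 by (auto simp: is_matching_def)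
    then have key: "x \<in> (S - {e \<in> E. r e \<in> S}) \<union> ({e \<in> E. r e \<in> S} - S) \<longleftrightarrow> x \<in> (M1 - M2) \<union> (M2 - M1)" for x
      using S(1,4) by (cases "x \<in> E") auto
    show ?thesis by (rule Set.set_eqI) (rule key)
  qed
  also have "prod \<eta> ((M1 - M2) \<union> (M2 - M1)) = prod \<eta> M1 * prod \<eta> M2"
  proof (rule prod_signs_symmetric_difference[symmetric, OF finM])
    fix x assume "x \<in> M1 \<union> M2"
    then have "x \<in> E" "L x \<in> bot_faces D f" using matching_in_E matching_bot M1(1) M2(1) by blast+
    then show "\<eta> x \<in> {1, -1}" by (rule \<eta>)
  qed
  also have "prod \<eta> M1 = (\<Prod>i<n. \<eta> (c1 i))" unfolding M1_def using M1(2) by (simp add: prod.reindex)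
  also have "prod \<eta> M2 = (\<Prod>i<n. \<eta> (c2 i))" unfolding M2_def using M2(2) by (simp add: prod.reindex)
  finally have eq: "sign p1 * sign p2 = (\<Prod>i<n. \<eta> (c1 i)) * (\<Prod>i<n. \<eta> (c2 i))" .
  have "\<eta> (c2 i) * \<eta> (c2 i) = 1" if "i < n" for i
  proof -
    have "c2 i \<in> M2" using that by (simp add: M2_def)
    then have "c2 i \<in> E" "L (c2 i) \<in> bot_faces D f" using matching_in_E[OF M2(1)] matching_bot[OF M2(1)] by simp_all
    then have "\<eta> (c2 i) \<in> {1, -1}" by (rule \<eta>)
    then show ?thesis by auto
  qed
  then have sq: "(\<Prod>i<n. \<eta> (c2 i)) * (\<Prod>i<n. \<eta> (c2 i)) = 1"
    unfolding prod.distrib[symmetric] by (intro prod.neutral) simp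
  have "sign p1 * (\<Prod>i<n. \<eta> (c1 i)) = sign p1 * (\<Prod>i<n. \<eta> (c1 i)) * ((\<Prod>i<n. \<eta> (c2 i)) * (\<Prod>i<n. \<eta> (c2 i)))"
    unfolding sq by simp
  also have "\<dots> = sign p1 * (sign p1 * sign p2) * (\<Prod>i<n. \<eta> (c2 i))" unfolding eq by (simp only: mult_ac)
  also have "\<dots> = sign p2 * (\<Prod>i<n. \<eta> (c2 i))" by simp
  finally show ?thesis .
qed

end

section \<open>The dimer sum\<close>

lemma prod_signs_eq_power:
  fixes g :: "'b \<Rightarrow> int"
  assumes "finite Q" "\<And>a. a \<in> Q \<Longrightarrow> g a \<in> {1, -1}"
  shows "prod g Q = (-1) ^ card {a \<in> Q. g a = -1}"
proof -
  have "prod g Q = (\<Prod>a\<in>Q. if g a = -1 then -1 else 1)"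
  proof (rule prod.cong[OF refl])
    fix a assume "a \<in> Q"
    then have "g a = 1 \<or> g a = -1" using assms(2) by blast
    then show "g a = (if g a = -1 then -1 else 1)" by auto
  qed
  also have "\<dots> = (\<Prod>a\<in>Q \<inter> {a. g a = -1}. -1)"
    using prod.inter_restrict[OF assms(1), of "\<lambda>_. -1 :: int" "{a. g a = -1}"] by simp
  also have "\<dots> = (-1) ^ card (Q \<inter> {a. g a = -1})" by simp
  finally show ?thesis by (simp add: Int_def)
qed

definition dimer_of_perm :: "nat \<Rightarrow> (nat \<Rightarrow> 'v) \<Rightarrow> (nat \<Rightarrow> 'w) \<Rightarrow> (nat \<Rightarrow> nat) \<Rightarrow> ('v \<times> 'w) set" where
  "dimer_of_perm n xs ys p = (\<lambda>i. (xs i, ys (p i))) ` {..<n}"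

lemma dimer_coverings_as_permutations:
  assumes xs: "bij_betw xs {..<n :: nat} X" and ys: "bij_betw ys {..<n} Y" and Ed: "Ed \<subseteq> X \<times> Y"
  shows "bij_betw (dimer_of_perm n xs ys) {p. p permutes {..<n} \<and> (\<forall>i<n. (xs i, ys (p i)) \<in> Ed)}
    (dimer_coverings X Y Ed)"
proof -
  let ?P = "{p. p permutes {..<n} \<and> (\<forall>i<n. (xs i, ys (p i)) \<in> Ed)}"
  have injx: "xs i = xs j \<longleftrightarrow> i = j" if "i < n" "j < n" for i j
    using xs that inj_on_eq_iff[of xs "{..<n}" i j] by (simp add: bij_betw_def)
  have injy: "ys i = ys j \<longleftrightarrow> i = j" if "i < n" "j < n" for i j
    using ys that inj_on_eq_iff[of ys "{..<n}" i j] by (simp add: bij_betw_def)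
  have pn: "p i < n" if "p permutes {..<n}" "i < n" for p i using permutes_in_image[OF that(1), of i] that(2) by simp
  have mem: "e \<in> dimer_of_perm n xs ys p \<longleftrightarrow> (\<exists>i<n. e = (xs i, ys (p i)))" for e p
    by (auto simp: dimer_of_perm_def)
  have inj: "inj_on (dimer_of_perm n xs ys) ?P"
  proof (rule inj_onI)
    fix p q assume pq: "p \<in> ?P" "q \<in> ?P" and eq: "dimer_of_perm n xs ys p = dimer_of_perm n xs ys q"
    have pp: "p permutes {..<n}" and qq: "q permutes {..<n}" using pq by auto
    show "p = q"
    proof
      fix i
      show "p i = q i"
      proof (cases "i < n")
        case True
        have "(xs i, ys (p i)) \<in> dimer_of_perm n xs ys q" unfolding eq[symmetric] mem using True by blast
        then obtain j where j: "j < n" "xs i = xs j" "ys (p i) = ys (q j)" unfolding mem by auto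
        then have "i = j" using injx[OF True j(1)] by simp
        then show ?thesis using j(3) injy[OF pn[OF pp True] pn[OF qq True]] by simp
      next
        case False
        then show ?thesis using permutes_not_in[OF pp, of i] permutes_not_in[OF qq, of i] by simp
      qed
    qed
  qed
  have into: "dimer_of_perm n xs ys p \<in> dimer_coverings X Y Ed" if "p \<in> ?P" for p
  proof -
    have pp: "p permutes {..<n}" and ed: "\<And>i. i < n \<Longrightarrow> (xs i, ys (p i)) \<in> Ed" using that by auto
    have "dimer_of_perm n xs ys p \<subseteq> Ed" using ed by (auto simp: mem)
    moreover have "\<exists>!e. e \<in> dimer_of_perm n xs ys p \<and> fst e = x" if x: "x \<in> X" for x
    proof -
      obtain i where i: "i < n" "x = xs i" using xs x by (auto simp: bij_betw_def)
      show ?thesis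
      proof (rule ex1I[of _ "(xs i, ys (p i))"])
        show "(xs i, ys (p i)) \<in> dimer_of_perm n xs ys p \<and> fst (xs i, ys (p i)) = x" using i unfolding mem by auto
        fix e assume "e \<in> dimer_of_perm n xs ys p \<and> fst e = x"
        then obtain j where "j < n" "e = (xs j, ys (p j))" "xs j = xs i" unfolding mem using i by auto
        then show "e = (xs i, ys (p i))" using injx[of j i] i by simp
      qed
    qed
    moreover have "\<exists>!e. e \<in> dimer_of_perm n xs ys p \<and> snd e = y" if y: "y \<in> Y" for y
    proof -
      obtain k where k: "k < n" "y = ys k" using ys y by (auto simp: bij_betw_def)
      have "k \<in> p ` {..<n}" using permutes_image[OF pp] k by simp
      then obtain i where i: "i < n" "k = p i" by auto
      show ?thesis
      proof (rule ex1I[of _ "(xs i, ys (p i))"])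
        show "(xs i, ys (p i)) \<in> dimer_of_perm n xs ys p \<and> snd (xs i, ys (p i)) = y" using i k unfolding mem by auto
        fix e assume "e \<in> dimer_of_perm n xs ys p \<and> snd e = y"
        then obtain j where j: "j < n" "e = (xs j, ys (p j))" "ys (p j) = ys (p i)" unfolding mem using i k by auto
        then have "p j = p i" using injy[of "p j" "p i"] pn[OF pp] i by simp
        then have "j = i" using permutes_inj[OF pp] by (simp add: inj_eq)
        then show "e = (xs i, ys (p i))" using j by simp
      qed
    qed
    ultimately show ?thesis unfolding dimer_coverings_def by blast
  qed
  have onto: "m \<in> dimer_of_perm n xs ys ` ?P" if m: "m \<in> dimer_coverings X Y Ed" for m
  proof -
    have mE: "m \<subseteq> Ed" and mX: "\<And>x. x \<in> X \<Longrightarrow> \<exists>!e. e \<in> m \<and> fst e = x"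
      and mY: "\<And>y. y \<in> Y \<Longrightarrow> \<exists>!e. e \<in> m \<and> snd e = y"
      using m unfolding dimer_coverings_def by auto
    have "\<exists>j<n. (xs i, ys j) \<in> m" if i: "i < n" for i
    proof -
      have "xs i \<in> X" using bij_betw_apply[OF xs, of i] i by simp
      then obtain e where e: "e \<in> m" "fst e = xs i" using mX by blast
      have "snd e \<in> Y" using e(1) mE Ed by auto
      then obtain j where "j < n" "snd e = ys j" using ys by (auto simp: bij_betw_def)
      then show ?thesis using e by (metis prod.collapse)
    qed
    then obtain q where q: "\<And>i. i < n \<Longrightarrow> q i < n \<and> (xs i, ys (q i)) \<in> m" by metis
    define p where "p = (\<lambda>i. if i < n then q i else i)"
    have p: "p i < n" "(xs i, ys (p i)) \<in> m" if "i < n" for i using q[OF that] that by (simp_all add: p_def)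
    have "inj_on p {..<n}"
    proof (rule inj_onI)
      fix i j assume ij: "i \<in> {..<n}" "j \<in> {..<n}" "p i = p j"
      then have "ys (p i) \<in> Y" using bij_betw_apply[OF ys, of "p i"] p by simp
      then have "(xs i, ys (p i)) = (xs j, ys (p j))" using mY p(2) ij by (metis lessThan_iff snd_conv)
      then show "i = j" using injx ij by simp
    qed
    moreover have "p ` {..<n} \<subseteq> {..<n}" using p by auto
    ultimately have "bij_betw p {..<n} {..<n}" unfolding bij_betw_def using endo_inj_surj[of "{..<n}" p] by blast
    then have pp: "p permutes {..<n}" by (rule bij_imp_permutes) (simp add: p_def)
    then have "p \<in> ?P" using p mE by auto
    moreover have "m = dimer_of_perm n xs ys p"
    proof (intro equalityI subsetI)
      fix e assume e: "e \<in> m"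
      then have x: "fst e \<in> X" using mE Ed by auto
      then obtain i where i: "i < n" "fst e = xs i" using xs by (auto simp: bij_betw_def)
      then have "e = (xs i, ys (p i))" using mX[OF x] e p(2)[OF i(1)] by (metis fst_conv)
      then show "e \<in> dimer_of_perm n xs ys p" using i unfolding mem by blast
    next
      fix e assume "e \<in> dimer_of_perm n xs ys p"
      then show "e \<in> m" unfolding mem using p by auto
    qed
    ultimately show ?thesis by blast
  qed
  show ?thesis unfolding bij_betw_def using inj into onto by blast
qed

lemma prod_dimer_of_perm:
  assumes "bij_betw xs {..<n} X"
  shows "(\<Prod>e\<in>dimer_of_perm n xs ys p. h e) = (\<Prod>i<n. h (xs i, ys (p i)))"
proof -
  have "inj_on (\<lambda>i. (xs i, ys (p i))) {..<n}"
    using assms by (auto simp: bij_betw_def inj_on_def)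
  then show ?thesis unfolding dimer_of_perm_def by (simp add: prod.reindex)
qed

context reduced_bot_diagram begin

lemma bot_edges_iff:
  "(x, y) \<in> bot_edges D f \<longleftrightarrow> y \<in> bot_faces D f \<and> (\<exists>c\<in>E. x = V c \<and> y = L c)"
proof
  assume a: "(x, y) \<in> bot_edges D f"
  then obtain c where c: "c \<in> x" "c \<in> y" and y: "y \<in> bot_faces D f" and x: "x \<in> crossings D"
    by (auto simp: bot_edges_def)
  obtain d where d: "d \<in> E" "x = V d" using x by (auto simp: crossings_eq)
  obtain e where e: "e \<in> E" "y = L e" using y by (auto simp: faces_eq bot_faces_def)
  have "c \<in> E" using c(1) d V_subset by blast
  moreover have "x = V c" using c(1) d(2) in_V_iff by simp
  moreover have "y = L c" using c(2) e(2) in_L_iff by simp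
  ultimately show "y \<in> bot_faces D f \<and> (\<exists>c\<in>E. x = V c \<and> y = L c)" using y by blast
next
  assume "y \<in> bot_faces D f \<and> (\<exists>c\<in>E. x = V c \<and> y = L c)"
  then obtain c where c: "y \<in> bot_faces D f" "c \<in> E" "x = V c" "y = L c" by blast
  then have "c \<in> x \<inter> y" "x \<in> crossings D" by (simp_all add: crossings_eq)
  then show "(x, y) \<in> bot_edges D f" unfolding bot_edges_def using c(1) by blast
qed

abbreviation T where "T \<equiv> overlaid_tait_map D"

lemma darts_T: "darts T = E <+> E"
proof -
  have "\<Union>(crossings D) = E" using V_subset self_in(1) unfolding crossings_eq by blast
  then show ?thesis by (simp add: overlaid_tait_map_def)
qed

lemma in_darts_T: "Inl c \<in> darts T \<longleftrightarrow> c \<in> E" "Inr c \<in> darts T \<longleftrightarrow> c \<in> E"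
  by (auto simp: darts_T)

lemma face_step_T: "face_step T (Inl c) = Inr (\<iota> (r c))" "face_step T (Inr c) = Inl (rot_back D c)"
proof -
  have "inv_into UNIV (map_sum r \<phi>) = map_sum (rot_back D) (\<iota> \<circ> r)"
  proof (rule Hilbert_Choice.inv_equality)
    show "map_sum (rot_back D) (\<iota> \<circ> r) (map_sum r \<phi> a) = a" for a by (cases a) simp_all
    show "map_sum r \<phi> (map_sum (rot_back D) (\<iota> \<circ> r) a) = a" for a by (cases a) simp_all
  qed
  then have rb: "rot_back T = map_sum (rot_back D) (\<iota> \<circ> r)"
    unfolding rot_back_def overlaid_tait_map_def by (simp only: plane_map.simps)
  show "face_step T (Inl c) = Inr (\<iota> (r c))" "face_step T (Inr c) = Inl (rot_back D c)"
    by (simp_all only: face_step_def[of T] rb) (simp_all add: overlaid_tait_map_def)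
qed

lemma drev_T: "drev T (Inl c) = Inr c" "drev T (Inr c) = Inl c"
  by (simp_all add: overlaid_tait_map_def)

lemma tait_edge_T: "tait_edge D (Inl c) = (V c, L c)" "tait_edge D (Inr c) = (V c, L c)"
  by (simp_all add: tait_edge_def Let_def)

lemma bot_darts_iff:
  "Inl c \<in> bot_darts D f \<longleftrightarrow> c \<in> E \<and> L c \<in> bot_faces D f"
  "Inr c \<in> bot_darts D f \<longleftrightarrow> c \<in> E \<and> L c \<in> bot_faces D f"
  by (auto simp: bot_darts_def darts_T tait_edge_T bot_edges_iff)

text \<open>
  The boundary walk of the quadrilateral around the edge of \<open>d\<close>.
\<close>

definition quad :: "'d \<Rightarrow> ('d + 'd) set" where
  "quad d = {Inl (rot_back D d), Inr (\<iota> d), Inl (rot_back D (\<iota> d)), Inr d}"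

text \<open>
  No edge of the quadrilateral is deleted, so it is not glued to another face.
\<close>

lemma quad_is_bounded_face:
  assumes d: "d \<in> E" "L d \<in> bot_faces D f" "L (\<iota> d) \<in> bot_faces D f"
  shows "quad d \<in> bot_bounded_faces D f" "quad d \<subseteq> bot_darts D f"
proof -
  show sub: "quad d \<subseteq> bot_darts D f"
    using d L_rot_back[of d] L_rot_back[of "\<iota> d"] by (simp add: quad_def bot_darts_iff)
  define Rl where "Rl = {(a, face_step T a) | a. a \<in> darts T} \<union> {(a, drev T a) | a. a \<in> darts T \<and> a \<notin> bot_darts D f}"
  have closed: "a \<in> quad d \<longleftrightarrow> b \<in> quad d" if ab: "(a, b) \<in> Rl" for a b
  proof -
    consider (step) "b = face_step T a" | (rev) "b = drev T a" "a \<notin> bot_darts D f"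
      using ab unfolding Rl_def by blast
    then show ?thesis
    proof cases
      case step
      have inl: "Inl c \<in> quad d \<longleftrightarrow> c = rot_back D d \<or> c = rot_back D (\<iota> d)" for c
        by (simp add: quad_def)
      have inr: "Inr c \<in> quad d \<longleftrightarrow> c = \<iota> d \<or> c = d" for c
        by (simp add: quad_def)
      show ?thesis
      proof (cases a)
        case (Inl c)
        have "c = rot_back D d \<longleftrightarrow> \<iota> (r c) = \<iota> d" "c = rot_back D (\<iota> d) \<longleftrightarrow> \<iota> (r c) = d"
          by (metis r_rot_back \<iota>_\<iota>)+
        then show ?thesis by (simp only: step Inl face_step_T inl inr)
      next
        case (Inr c)
        have "rot_back D c = rot_back D d \<longleftrightarrow> c = d" "rot_back D c = rot_back D (\<iota> d) \<longleftrightarrow> c = \<iota> d"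
          by (metis r_rot_back(1))+
        then have "Inl (rot_back D c) \<in> quad d \<longleftrightarrow> Inr c \<in> quad d" unfolding inl inr by blast
        then show ?thesis by (simp only: step Inr face_step_T)
      qed
    next
      case rev
      have "b \<notin> bot_darts D f" using rev bot_darts_iff by (cases a) (simp_all add: drev_T)
      then show ?thesis using rev sub by blast
    qed
  qed
  have "linked_class Rl (Inr d) = quad d"
  proof (intro equalityI subsetI)
    fix a assume "a \<in> linked_class Rl (Inr d)"
    then have "(Inr d, a) \<in> (Rl \<union> Rl\<inverse>)\<^sup>*" unfolding linked_class_def by simp
    then show "a \<in> quad d"
    proof induction
      case base show ?case by (simp add: quad_def)
    next
      case (step b c) then show ?case using closed[of b c] closed[of c b] by auto
    qed
  next
    have "(a, face_step T a) \<in> (Rl \<union> Rl\<inverse>)\<^sup>*" if "a \<in> darts T" for a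
      using that unfolding Rl_def by (intro r_into_rtrancl) blast
    note st = this
    have s1: "(Inr d, Inl (rot_back D d)) \<in> (Rl \<union> Rl\<inverse>)\<^sup>*"
      using st[of "Inr d"] d(1) by (simp add: in_darts_T face_step_T)
    have s2: "(Inl (rot_back D d), Inr (\<iota> d)) \<in> (Rl \<union> Rl\<inverse>)\<^sup>*"
      using st[of "Inl (rot_back D d)"] d(1) by (simp add: in_darts_T face_step_T)
    have s3: "(Inr (\<iota> d), Inl (rot_back D (\<iota> d))) \<in> (Rl \<union> Rl\<inverse>)\<^sup>*"
      using st[of "Inr (\<iota> d)"] d(1) by (simp add: in_darts_T face_step_T)
    fix a assume "a \<in> quad d"
    then have "(Inr d, a) \<in> (Rl \<union> Rl\<inverse>)\<^sup>*"
      using s1 rtrancl_trans[OF s1 s2] rtrancl_trans[OF rtrancl_trans[OF s1 s2] s3]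
      unfolding quad_def by (elim insertE emptyE) simp_all
    then show "a \<in> linked_class Rl (Inr d)" unfolding linked_class_def by simp
  qed
  moreover have "Inr d \<in> darts T" using d(1) by (simp add: in_darts_T)
  ultimately have "quad d \<in> linked_class Rl ` darts T" by (intro image_eqI) (rule sym)
  then have "quad d \<in> subgraph_faces T (bot_darts D f)" unfolding subgraph_faces_def Rl_def .
  moreover have "quad d \<inter> Inr ` outer D = {}"
  proof -
    obtain d0 where d0: "d0 \<in> E" "L d0 = outer D" by (rule base_dart)
    have "c \<notin> outer D" if "L c \<in> bot_faces D f" for c
    proof
      assume "c \<in> outer D"
      then have "L c = outer D" using in_L_iff[of c d0] d0(2) by simp
      then show False using that by (simp add: bot_faces_def)
    qed
    then have "d \<notin> outer D" "\<iota> d \<notin> outer D" using d(2,3) by blast+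
    then show ?thesis unfolding quad_def by blast
  qed
  ultimately show "quad d \<in> bot_bounded_faces D f" by (simp add: bot_bounded_faces_def)
qed

lemma kasteleyn_quad:
  assumes K: "kasteleyn_weighting D f \<epsilon>" and d: "d \<in> E" "L d \<in> bot_faces D f" "L (\<iota> d) \<in> bot_faces D f"
  defines "\<eta> \<equiv> \<lambda>c. \<epsilon> (V c, L c)"
  shows "(\<eta> d * \<eta> (rot_back D d)) * (\<eta> (\<iota> d) * \<eta> (rot_back D (\<iota> d))) = (-1 :: int)"
proof -
  note Q = quad_is_bounded_face[OF d]
  have ne: "d \<noteq> \<iota> d" using \<iota>_neq[OF d(1)] by simp
  then have ne': "rot_back D d \<noteq> rot_back D (\<iota> d)" by (metis r_rot_back(1))
  let ?neg = "{a \<in> quad d. \<epsilon> (tait_edge D a) = -1}"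
  have "quad d \<inter> bot_darts D f = quad d" using Q(2) by blast
  moreover have "card (quad d) = 4" unfolding quad_def using ne ne' by simp
  moreover have "card (quad d \<inter> bot_darts D f) mod 4 = 0 \<longrightarrow>
      odd (card {a \<in> quad d \<inter> bot_darts D f. \<epsilon> (tait_edge D a) = -1})"
    using bspec[OF conjunct2[OF K[unfolded kasteleyn_weighting_def Let_def]] Q(1)] by (rule conjunct1)
  ultimately have odd: "odd (card ?neg)" by simp
  have "prod (\<lambda>a. \<epsilon> (tait_edge D a)) (quad d) = (-1) ^ card ?neg"
  proof (rule prod_signs_eq_power)
    show "finite (quad d)" by (simp add: quad_def)
    fix a assume "a \<in> quad d"
    then have "tait_edge D a \<in> bot_edges D f" using Q(2) by (auto simp: bot_darts_def)
    then show "\<epsilon> (tait_edge D a) \<in> {1, -1}" using K unfolding kasteleyn_weighting_def by blast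
  qed
  also have "\<dots> = -1" using odd by simp
  finally have "prod (\<lambda>a. \<epsilon> (tait_edge D a)) (quad d) = -1" .
  moreover have "prod (\<lambda>a. \<epsilon> (tait_edge D a)) (quad d)
      = \<eta> (rot_back D d) * (\<eta> (\<iota> d) * (\<eta> (rot_back D (\<iota> d)) * \<eta> d))"
    unfolding quad_def using ne ne' by (simp add: tait_edge_T \<eta>_def)
  ultimately show ?thesis by (simp only: mult_ac)
qed

text \<open>
  By \<open>kasteleyn_sign\<close>, the sign of a permutation in the Leibniz expansion can be replaced by the product
  of the Kasteleyn weights of its dimer covering, up to a sign \<open>k\<close> common to all permutations.
\<close>

lemma signed_dimer_sum:
  assumes K: "kasteleyn_weighting D f \<epsilon>"
    and xs: "bij_betw xs {..<n} (crossings D)" and ys: "bij_betw ys {..<n} (bot_faces D f)"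
    and A: "\<And>x y. x \<in> crossings D \<Longrightarrow> y \<in> bot_faces D f \<Longrightarrow>
      A x y = (if (x, y) \<in> bot_edges D f then \<mu> (x, y) else 0)"
  shows "\<bar>\<Sum>m\<in>dimer_coverings (crossings D) (bot_faces D f) (bot_edges D f). \<Prod>e\<in>m. \<epsilon> e * \<mu> e\<bar>
    = \<bar>fun_det n (\<lambda>i j. A (xs i) (ys j))\<bar>"
proof -
  define P where "P = {p. p permutes {..<n} \<and> (\<forall>i<n. (xs i, ys (p i)) \<in> bot_edges D f)}"
  have sub: "bot_edges D f \<subseteq> crossings D \<times> bot_faces D f" by (auto simp: bot_edges_def)
  have xin: "xs i \<in> crossings D" if "i < n" for i using bij_betw_apply[OF xs, of i] that by simp
  have yin: "ys i \<in> bot_faces D f" if "i < n" for i using bij_betw_apply[OF ys, of i] that by simp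
  have "(\<Sum>m\<in>dimer_coverings (crossings D) (bot_faces D f) (bot_edges D f). \<Prod>e\<in>m. \<epsilon> e * \<mu> e)
      = (\<Sum>p\<in>P. \<Prod>e\<in>dimer_of_perm n xs ys p. \<epsilon> e * \<mu> e)"
    unfolding P_def by (rule sum.reindex_bij_betw[OF dimer_coverings_as_permutations[OF xs ys sub], symmetric])
  also have "\<dots> = (\<Sum>p\<in>P. (\<Prod>i<n. \<epsilon> (xs i, ys (p i))) * (\<Prod>i<n. \<mu> (xs i, ys (p i))))"
    unfolding prod_dimer_of_perm[OF xs] prod.distrib ..
  finally have dimers: "(\<Sum>m\<in>dimer_coverings (crossings D) (bot_faces D f) (bot_edges D f). \<Prod>e\<in>m. \<epsilon> e * \<mu> e)
      = (\<Sum>p\<in>P. (\<Prod>i<n. \<epsilon> (xs i, ys (p i))) * (\<Prod>i<n. \<mu> (xs i, ys (p i))))" .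
  have "fun_det n (\<lambda>i j. A (xs i) (ys j)) = (\<Sum>p | p permutes {0..<n}. sign p * (\<Prod>i = 0..<n. A (xs i) (ys (p i))))"
  proof -
    have "(\<Prod>i = 0..<n. mat n n (\<lambda>(i, j). A (xs i) (ys j)) $$ (i, p i)) = (\<Prod>i = 0..<n. A (xs i) (ys (p i)))"
      if "p permutes {0..<n}" for p
    proof (rule prod.cong[OF refl])
      fix i assume i: "i \<in> {0..<n}"
      then have "p i \<in> {0..<n}" using permutes_in_image[OF that] by simp
      then show "mat n n (\<lambda>(i, j). A (xs i) (ys j)) $$ (i, p i) = A (xs i) (ys (p i))" using i by simp
    qed
    then show ?thesis unfolding fun_det_def by (subst det_def'[of _ n]) (auto intro!: sum.cong)
  qed
  also have "\<dots> = (\<Sum>p\<in>{p. p permutes {..<n}}. sign p * (\<Prod>i<n. A (xs i) (ys (p i))))"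
    by (simp only: atLeast0LessThan)
  also have "\<dots> = (\<Sum>p\<in>P. sign p * (\<Prod>i<n. A (xs i) (ys (p i))))"
  proof (rule sum.mono_neutral_right)
    show "finite {p. p permutes {..<n}}" by (rule finite_permutations) simp
    show "P \<subseteq> {p. p permutes {..<n}}" by (auto simp: P_def)
    show "\<forall>p\<in>{p. p permutes {..<n}} - P. sign p * (\<Prod>i<n. A (xs i) (ys (p i))) = 0"
    proof
      fix p assume p: "p \<in> {p. p permutes {..<n}} - P"
      then have pp: "p permutes {..<n}" by simp
      obtain i where i: "i < n" "(xs i, ys (p i)) \<notin> bot_edges D f" using p by (auto simp: P_def)
      have "p i < n" using permutes_in_image[OF pp, of i] i(1) by simp
      then have "A (xs i) (ys (p i)) = 0" using A[OF xin[OF i(1)] yin[of "p i"]] i(2) by simp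
      then have "(\<Prod>i<n. A (xs i) (ys (p i))) = 0" using i(1) by (intro prod_zero) auto
      then show "sign p * (\<Prod>i<n. A (xs i) (ys (p i))) = 0" by simp
    qed
  qed
  also have "\<dots> = (\<Sum>p\<in>P. sign p * (\<Prod>i<n. \<mu> (xs i, ys (p i))))"
  proof (intro sum.cong refl arg_cong2[of _ _ _ _ "(*)"] prod.cong)
    fix p i assume p: "p \<in> P" and i: "i \<in> {..<n}"
    have pp: "p permutes {..<n}" and ed: "(xs i, ys (p i)) \<in> bot_edges D f" using p i by (auto simp: P_def)
    have "p i < n" using permutes_in_image[OF pp, of i] i by simp
    then show "A (xs i) (ys (p i)) = \<mu> (xs i, ys (p i))" using A[OF xin yin] i ed by simp
  qed
  finally have det: "fun_det n (\<lambda>i j. A (xs i) (ys j)) = (\<Sum>p\<in>P. sign p * (\<Prod>i<n. \<mu> (xs i, ys (p i))))" .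
  let ?\<eta> = "\<lambda>c. \<epsilon> (V c, L c)"
  have \<eta>: "?\<eta> d \<in> {1, -1}" if "d \<in> E" "L d \<in> bot_faces D f" for d
  proof -
    have "(V d, L d) \<in> bot_edges D f" using that bot_edges_iff by blast
    then show ?thesis using K unfolding kasteleyn_weighting_def by blast
  qed
  have corners: "\<exists>c. \<forall>i<n. c i \<in> E \<and> V (c i) = xs i \<and> L (c i) = ys (p i)" if "p \<in> P" for p
  proof -
    have "\<exists>c. c \<in> E \<and> V c = xs i \<and> L c = ys (p i)" if "i < n" for i
      using \<open>p \<in> P\<close> that bot_edges_iff[of "xs i" "ys (p i)"] by (auto simp: P_def)
    then show ?thesis by metis
  qed
  have const: "sign p * (\<Prod>i<n. \<epsilon> (xs i, ys (p i))) = sign q * (\<Prod>i<n. \<epsilon> (xs i, ys (q i)))"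
    if pq: "p \<in> P" "q \<in> P" for p q
  proof -
    obtain c where c: "\<And>i. i < n \<Longrightarrow> c i \<in> E \<and> V (c i) = xs i \<and> L (c i) = ys (p i)" using corners[OF pq(1)] by blast
    obtain c' where c': "\<And>i. i < n \<Longrightarrow> c' i \<in> E \<and> V (c' i) = xs i \<and> L (c' i) = ys (q i)" using corners[OF pq(2)] by blast
    have pp: "p permutes {..<n}" "q permutes {..<n}" using pq by (auto simp: P_def)
    have "sign p * (\<Prod>i<n. ?\<eta> (c i)) = sign q * (\<Prod>i<n. ?\<eta> (c' i))"
      by (rule kasteleyn_sign[OF xs ys pp c c', where \<eta> = ?\<eta>]) (use \<eta> kasteleyn_quad[OF K] in auto)
    moreover have "(\<Prod>i<n. ?\<eta> (c i)) = (\<Prod>i<n. \<epsilon> (xs i, ys (p i)))" using c by (intro prod.cong) auto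
    moreover have "(\<Prod>i<n. ?\<eta> (c' i)) = (\<Prod>i<n. \<epsilon> (xs i, ys (q i)))" using c' by (intro prod.cong) auto
    ultimately show ?thesis by simp
  qed
  show ?thesis
  proof (cases "P = {}")
    case True
    then show ?thesis unfolding dimers det by simp
  next
    case False
    then obtain q where q: "q \<in> P" by blast
    define k where "k = sign q * (\<Prod>i<n. \<epsilon> (xs i, ys (q i)))"
    have "\<bar>\<epsilon> (xs i, ys (q i))\<bar> = 1" if "i < n" for i
    proof -
      have "(xs i, ys (q i)) \<in> bot_edges D f" using q that by (auto simp: P_def)
      then have "\<epsilon> (xs i, ys (q i)) \<in> {1, -1}" using K unfolding kasteleyn_weighting_def by blast
      then show ?thesis by auto
    qed
    then have absk: "\<bar>k\<bar> = 1" by (simp add: k_def abs_mult abs_prod)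
    have "(\<Prod>i<n. \<epsilon> (xs i, ys (p i))) = k * sign p" if "p \<in> P" for p
    proof -
      have "k * sign p = sign p * sign p * (\<Prod>i<n. \<epsilon> (xs i, ys (p i)))"
        unfolding k_def const[OF q that] by (simp only: mult_ac)
      then show ?thesis by simp
    qed
    then have "(\<Sum>p\<in>P. (\<Prod>i<n. \<epsilon> (xs i, ys (p i))) * (\<Prod>i<n. \<mu> (xs i, ys (p i))))
        = k * (\<Sum>p\<in>P. sign p * (\<Prod>i<n. \<mu> (xs i, ys (p i))))"
      unfolding sum_distrib_left by (intro sum.cong) (simp_all add: mult.assoc)
    then show ?thesis unfolding dimers det by (simp add: abs_mult absk)
  qed
qed

lemma card_bot_faces: "card (bot_faces D f) = card (crossings D)"
proof -
  obtain d0 where d0: "d0 \<in> E" "L d0 = outer D" "L (\<iota> d0) = f" "f \<noteq> outer D" by (rule base_dart)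
  have "{outer D, f} \<subseteq> faces D" using d0 L_in_faces[of d0] L_in_faces[of "\<iota> d0"] by auto
  then have "card (bot_faces D f) = card (faces D) - card {outer D, f}"
    unfolding bot_faces_def by (intro card_Diff_subset) auto
  then show ?thesis using card_faces d0(4) by simp
qed

end

text \<open>
  Both faces of the circle are omitted, so the graph is empty and has one dimer covering, the empty one;
  the Fox module is infinite cyclic and so torsion free.
\<close>

lemma crossingless_case:
  assumes knot: "knot_diagram D" and omis: "omissible_face D f" and circle: "crossingless_circle D"
  shows "int (knot_det D) =
    \<bar>\<Sum>m\<in>dimer_coverings (crossings D) (bot_faces D f) (bot_edges D f). \<Prod>e\<in>m. \<epsilon> e * \<mu> e\<bar>"
proof -
  obtain d where d: "darts D = {d, drev D d}" using circle by (auto simp: crossingless_circle_def)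
  have r: "rot D permutes darts D" using knot by (simp add: knot_diagram_def)
  have "card (vertex_at D e) \<noteq> 4" if "e \<in> darts D" for e
  proof -
    have "vertex_at D e \<subseteq> {d, drev D d}"
      using permutes_orbit_subset[OF r that] d by (simp add: vertex_at_def)
    then have "card (vertex_at D e) \<le> card {d, drev D d}" by (intro card_mono) auto
    also have "\<dots> \<le> 2" by (simp add: card_insert_if)
    finally show ?thesis by simp
  qed
  then have cr: "crossings D = {}" by (auto simp: crossings_def vertices_def)
  have fc: "faces D = {face_left D d, face_left D (drev D d)}" by (simp add: faces_def d)
  have "f \<in> faces D" "outer D \<in> faces D" "f \<noteq> outer D"
    using omis knot by (auto simp: omissible_face_def knot_diagram_def)
  then have bot: "bot_faces D f = {}" using fc by (auto simp: bot_faces_def)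
  have "bot_edges D f = {}" by (auto simp: bot_edges_def cr)
  then have dc: "dimer_coverings (crossings D) (bot_faces D f) (bot_edges D f) = {{}}"
    by (auto simp: dimer_coverings_def cr bot)
  let ?G = "free_Abelian_group (arcs D)"
  have "fox_relations D = {}" by (auto simp: fox_relations_def cr)
  then have gen: "generate ?G (fox_relations D) = {0}"
    using group.generate_empty[OF group_free_Abelian_group, of "arcs D"] by simp
  have sub: "subgroup {0} ?G"
    using group.generate_is_subgroup[OF group_free_Abelian_group, of "{}" "arcs D"] gen \<open>fox_relations D = {}\<close> by simp
  interpret N: normal "{0}" ?G
    using comm_group.subgroup_imp_normal[OF abelian_free_Abelian_group sub] .
  have coset: "{0} #>\<^bsub>?G\<^esub> a = {a}" for a by (auto simp: r_coset_def)
  have "torsion (?G Mod {0}) = {{0}}"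
  proof (intro equalityI subsetI)
    fix g assume "g \<in> torsion (?G Mod {0})"
    then obtain a and n :: nat where a: "Poly_Mapping.keys a \<subseteq> arcs D" "g = {a}" "n > 0"
      "g [^]\<^bsub>?G Mod {0}\<^esub> n = {0}"
      by (auto simp: torsion_def carrier_FactGroup coset)
    then have "{frag_cmul (int n) a} = {0 :: 'a set \<Rightarrow>\<^sub>0 int}" using N.FactGroup_pow[of a n] by (simp add: coset)
    then have "a = 0" using a(3) by simp
    then show "g \<in> {{0}}" using a(2) by simp
  next
    fix g :: "('a set \<Rightarrow>\<^sub>0 int) set" assume "g \<in> {{0}}"
    then have g: "g = {0} #>\<^bsub>?G\<^esub> 0" by (simp add: coset)
    then have "g \<in> carrier (?G Mod {0})" by (auto simp: carrier_FactGroup)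
    moreover have "g [^]\<^bsub>?G Mod {0}\<^esub> (1 :: nat) = {0}"
      unfolding g using N.FactGroup_pow[of 0 1] by (simp add: coset)
    ultimately show "g \<in> torsion (?G Mod {0})" unfolding torsion_def by auto
  qed
  then have "knot_det D = 1" by (simp add: knot_det_def fox_module_def gen)
  then show ?thesis by (simp add: dc)
qed

theorem mainTheorem4:
  fixes D :: "'d diagram" and f :: "'d set"
    and \<epsilon> \<mu> :: "'d set \<times> 'd set \<Rightarrow> int"
  assumes "knot_diagram D"
    and "reduced D"
    and "omissible_face D f"
    and "dehn_weighting D f \<mu>"
    and "kasteleyn_weighting D f \<epsilon>"
  shows "int (knot_det D) =
    \<bar>\<Sum>m\<in>dimer_coverings (crossings D) (bot_faces D f) (bot_edges D f). \<Prod>e\<in>m. \<epsilon> e * \<mu> e\<bar>"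
proof (cases "crossingless_circle D")
  case True
  then show ?thesis using crossingless_case assms(1,3) by blast
next
  case False
  then have four: "vertices D = crossings D" using assms(1) by (auto simp: knot_diagram_def)
  interpret reduced_bot_diagram D f
    using assms(1-3) four by unfold_locales auto
  have "\<forall>x\<in>crossings D. \<exists>d. d \<in> x \<inter> over D \<and>
        (\<forall>c\<in>{rot D d, straight D d}. face_left D c \<in> bot_faces D f \<longrightarrow> \<mu> (x, face_left D c) = -1) \<and>
        (\<forall>c\<in>{d, rot_back D d}. face_left D c \<in> bot_faces D f \<longrightarrow> \<mu> (x, face_left D c) = 1)"
    using assms(4) unfolding dehn_weighting_def by blast
  then obtain w where w: "\<And>x. x \<in> crossings D \<Longrightarrow> w x \<in> x \<inter> over D"
    and w\<mu>: "\<And>x c. x \<in> crossings D \<Longrightarrow> c \<in> {rot D (w x), straight D (w x)} \<Longrightarrow> face_left D c \<in> bot_faces D f \<Longrightarrow> \<mu> (x, face_left D c) = -1"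
      "\<And>x c. x \<in> crossings D \<Longrightarrow> c \<in> {w x, rot_back D (w x)} \<Longrightarrow> face_left D c \<in> bot_faces D f \<Longrightarrow> \<mu> (x, face_left D c) = 1"
    by metis
  interpret fox_setup D f w by unfold_locales (rule w)
  have rel_\<mu>: "dehn_rel x y = (if (x, y) \<in> bot_edges D f then \<mu> (x, y) else 0)"
    if x: "x \<in> crossings D" and y: "y \<in> bot_faces D f" for x y
  proof -
    define d where "d = w x"
    have d: "d \<in> E" "V d = x" using w_in_E[OF x] V_w[OF x] by (simp_all add: d_def)
    have dehn_rel: "dehn_rel x y = of_bool (L d = y) + of_bool (L (r (r (r d))) = y) - of_bool (L (r (r d)) = y) - of_bool (L (r d) = y)"
      using L_corners[OF d(1)] by (simp add: dehn_rel_def sides_def d_def)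
    have x_eq: "x = {d, r d, r (r d), r (r (r d))}" using vertex_darts(1)[OF d(1)] d(2) by simp
    have inj: "inj_on L x" using assms(2) x by (simp add: reduced_def)
    have "distinct (map L [d, r d, r (r d), r (r (r d))])"
      unfolding distinct_map using vertex_darts(3)[OF d(1)] inj x_eq by simp
    then have ne: "distinct [L d, L (r d), L (r (r d)), L (r (r (r d)))]" by (simp only: list.map)
    have neqs: "L d \<noteq> L (r d)" "L d \<noteq> L (r (r d))" "L d \<noteq> L (r (r (r d)))" "L (r d) \<noteq> L (r (r d))"
      "L (r d) \<noteq> L (r (r (r d)))" "L (r (r d)) \<noteq> L (r (r (r d)))"
      using ne by simp_all
    show ?thesis
    proof (cases "(x, y) \<in> bot_edges D f")
      case True
      then obtain c where c: "c \<in> E" "x = V c" "y = L c" using bot_edges_iff by blast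
      have bot: "L c \<in> bot_faces D f" using y c(3) by simp
      have "c \<in> {d, r d, r (r d), r (r (r d))}" using c(2) self_in(1)[of c] x_eq by simp
      then consider "c = d" | "c = r d" | "c = r (r d)" | "c = r (r (r d))" by blast
      then show ?thesis
      proof cases
        case 1
        then have "\<mu> (x, L c) = 1" using w\<mu>(2)[OF x _ bot] by (simp add: d_def)
        then show ?thesis using True unfolding dehn_rel by (simp add: c(3) 1 neqs neqs[symmetric])
      next
        case 2
        then have "\<mu> (x, L c) = -1" using w\<mu>(1)[OF x _ bot] by (simp add: d_def)
        then show ?thesis using True unfolding dehn_rel by (simp add: c(3) 2 neqs neqs[symmetric])
      next
        case 3
        then have "\<mu> (x, L c) = -1" using w\<mu>(1)[OF x _ bot] by (simp add: d_def straight_eq)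
        then show ?thesis using True unfolding dehn_rel by (simp add: c(3) 3 neqs neqs[symmetric])
      next
        case 4
        then have "\<mu> (x, L c) = 1" using w\<mu>(2)[OF x _ bot] rot_back_eq[OF d(1)] by (simp add: d_def)
        then show ?thesis using True unfolding dehn_rel by (simp add: c(3) 4 neqs neqs[symmetric])
      qed
    next
      case False
      have "L c \<noteq> y" if "c \<in> {d, r d, r (r d), r (r (r d))}" for c
      proof
        assume "L c = y"
        moreover have "c \<in> V d" using that vertex_darts(1)[OF d(1)] by simp
        then have "c \<in> E" "V c = x" using V_subset[OF d(1)] in_V_iff[of c d] d(2) by (blast, simp)
        ultimately have "(x, y) \<in> bot_edges D f" unfolding bot_edges_iff using y by blast
        then show False using False by simp
      qed
      then show ?thesis using False unfolding dehn_rel by (simp only: insert_iff simp_thms of_bool_eq if_False)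
    qed
  qed
  obtain xs where xs: "bij_betw xs {..<card (crossings D)} (crossings D)"
    using ex_bij_betw_nat_finite[OF finite_crossings] by (auto simp: atLeast0LessThan)
  obtain ys where ys: "bij_betw ys {..<card (crossings D)} (bot_faces D f)"
    using ex_bij_betw_nat_finite[OF finite_bot] by (auto simp: atLeast0LessThan card_bot_faces)
  have "dehn_matrix xs ys = (\<lambda>i j. dehn_rel (xs i) (ys j))" by (simp add: dehn_matrix_def fun_eq_iff)
  then show ?thesis
    using knot_det_eq_det[OF xs ys] signed_dimer_sum[OF assms(5) xs ys rel_\<mu>] by simp
qed

end
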